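(* Let $(M,g)$ be a compact oriented $C^\infty$ Riemannian manifold of dimension $n\ge 2$, let $p\ge 1$, and let $\Delta_{sym}=\delta\delta^*-\delta^*\delta : C^\infty S^pM\to C^\infty S^pM$ be the Yano Laplacian. Then for every $\varphi\in C^\infty S^pM$ $$\langle \Delta_{sym}\varphi,\varphi\rangle=\langle\nabla\varphi,\nabla\varphi\rangle-\langle B_p(\varphi),\varphi\rangle ,$$ where, in local coordinates, $$\langle B_p(\varphi),\varphi\rangle=\int_M\frac{1}{(p-1)!}\Bigl(r_{ij}\,\varphi^{i i_2\dots i_p}\varphi^{j}{}_{i_2\dots i_p}-(p-1)R_{ijkl}\,\varphi^{ik i_3\dots i_p}\varphi^{jl}{}_{i_3\dots i_p}\Bigr)dv .$$
   Context: $S^pM$ is the bundle of (covariant) completely symmetric $p$-tensors on $M$, $C^\infty S^pM$ its smooth sections; $\nabla$ is the Levi-Civita connection, $dv$ the volume element, indices are raised and lowered with $g$, and repeated indices are summed. Global scalar products: for $\varphi,\varphi'\in C^\infty S^pM$, $\langle\varphi,\varphi'\rangle=\int_M\frac1{p!}\varphi^{i_1\dots i_p}\varphi'_{i_1\dots i_p}\,dv$; and $\langle\nabla\varphi,\nabla\varphi\rangle=\int_M\frac1{p!}(\nabla_{i_0}\varphi_{i_1\dots i_p})(\nabla^{i_0}\varphi^{i_1\dots i_p})\,dv$. Operators: $\delta^*:C^\infty S^pM\to C^\infty S^{p+1}M$ is $(\delta^*\varphi)_{i_0i_1\dots i_p}=\nabla_{i_0}\varphi_{i_1\dots i_p}+\dots+\nabla_{i_p}\varphi_{i_0\dots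 i_{p-1}}$ (sum of $p+1$ terms, each index in turn being the differentiation index), and $\delta:C^\infty S^{p+1}M\to C^\infty S^pM$ is $(\delta\xi)_{i_1\dots i_p}=-g^{ij}\nabla_j\xi_{i i_1\dots i_p}$, the formal adjoint of $\delta^*$ for the global scalar products. The Yano Laplacian is $\Delta_{sym}=\delta\delta^*-\delta^*\delta$ on $C^\infty S^pM$. $R_{ijkl}$ and $r_{ij}$ are the components of the curvature tensor and the Ricci tensor, with signs such that $r_{ik}=g^{jl}R_{ijkl}$ and the Ricci tensor of the round sphere is positive. $B_p$ is the symmetric endomorphism of $S^pM$ given by $$B_p(\varphi)_{i_1\dots i_p}=\sum_k g^{js}r_{i_kj}\varphi_{i_1\dots i_{k-1}s i_{k+1}\dots i_p}-\sum_{k\ne l}g^{js}g^{mt}R_{i_kj i_l m}\varphi_{i_1\dots i_{k-1}s i_{k+1}\dots i_{l-1}t i_{l+1}\dots i_p}$$ (index $s$ in slot $k$ and $t$ in slot $l$). *)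

theory Defs
  imports "HOL-Analysis.Analysis" "HOL-Library.Multiset"
begin

section \<open>Smooth functions on open subsets of Euclidean space\<close>

definition pd :: "'n \<Rightarrow> (real^'n::finite \<Rightarrow> real) \<Rightarrow> real^'n \<Rightarrow> real" where
  "pd i f y = frechet_derivative f (at y) (axis i 1)"

primrec Ck_on :: "nat \<Rightarrow> (real^'n::finite) set \<Rightarrow> (real^'n \<Rightarrow> real) \<Rightarrow> bool" where
  "Ck_on 0 S f \<longleftrightarrow> continuous_on S f"
| "Ck_on (Suc k) S f \<longleftrightarrow> f differentiable_on S \<and> (\<forall>i. Ck_on k S (pd i f))"

definition smooth_on :: "(real^'n::finite) set \<Rightarrow> (real^'n \<Rightarrow> real) \<Rightarrow> bool" where
  "smooth_on S f \<longleftrightarrow> (\<forall>k. Ck_on k S f)"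

section \<open>Smooth manifolds\<close>

text \<open>
  A chart is a pair of a domain and a coordinate map. The manifold is a subset \<open>M\<close> of a
  topological space, carrying the subspace topology and an atlas \<open>A\<close> (not required to be maximal).
\<close>

type_synonym ('a, 'n) chart = "'a set \<times> ('a \<Rightarrow> real^'n)"

definition chart_inv :: "('a, 'n) chart \<Rightarrow> real^'n::finite \<Rightarrow> 'a" where
  "chart_inv c = inv_into (fst c) (snd c)"

definition chart_image :: "('a, 'n) chart \<Rightarrow> (real^'n::finite) set" where
  "chart_image c = snd c ` fst c"

definition transition :: "('a, 'n) chart \<Rightarrow> ('a, 'n) chart \<Rightarrow> real^'n::finite \<Rightarrow> real^'n" where
  "transition c d = snd d \<circ> chart_inv c"

definition smooth_atlas :: "'a::topological_space set \<Rightarrow> ('a, 'n::finite) chart set \<Rightarrow> bool" where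
  "smooth_atlas M A \<longleftrightarrow>
     (\<Union>c\<in>A. fst c) = M \<and>
     (\<forall>c\<in>A. openin (top_of_set M) (fst c) \<and> open (chart_image c) \<and>
        homeomorphism (fst c) (chart_image c) (snd c) (chart_inv c)) \<and>
     (\<forall>c\<in>A. \<forall>d\<in>A. \<forall>i. smooth_on (snd c ` (fst c \<inter> fst d)) (\<lambda>y. transition c d y $ i))"

definition oriented_atlas :: "('a, 'n::finite) chart set \<Rightarrow> bool" where
  "oriented_atlas A \<longleftrightarrow>
     (\<forall>c\<in>A. \<forall>d\<in>A. \<forall>x\<in>fst c \<inter> fst d. det (jacobian (transition c d) (at (snd c x))) > 0)"

section \<open>Symmetric tensor fields and Riemannian metrics\<close>

text \<open>
  A covariant \<open>p\<close>-tensor field is given by its components \<open>\<phi> c [i\<^sub>1,\<dots>,i\<^sub>p] y\<close> in each chart \<open>c\<close>, as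
  functions of the coordinates \<open>y\<close> ranging over the image of \<open>c\<close>; the components in different charts
  are related by the tensor transformation law. Only index lists of length \<open>p\<close> are significant, so
  the rank is not an argument of operators that read it off the length of the index list.
\<close>

type_synonym ('a, 'n) field = "('a, 'n) chart \<Rightarrow> 'n list \<Rightarrow> real^'n \<Rightarrow> real"

definition sym_tensor_fields :: "('a, 'n::finite) chart set \<Rightarrow> nat \<Rightarrow> ('a, 'n) field set" where
  "sym_tensor_fields A p = {\<phi>.
     (\<forall>c\<in>A. \<forall>is. length is = p \<longrightarrow> smooth_on (chart_image c) (\<phi> c is)) \<and>
     (\<forall>c\<in>A. \<forall>is js. \<forall>y\<in>chart_image c. length is = p \<longrightarrow> mset is = mset js \<longrightarrow> \<phi> c is y = \<phi> c js y) \<and>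
     (\<forall>c\<in>A. \<forall>d\<in>A. \<forall>x\<in>fst c \<inter> fst d. \<forall>is. length is = p \<longrightarrow>
        \<phi> c is (snd c x) =
          (\<Sum>js | length js = p.
             (\<Prod>k<p. jacobian (transition c d) (at (snd c x)) $ (js ! k) $ (is ! k)) * \<phi> d js (snd d x)))}"

definition metric_matrix :: "('a, 'n::finite) field \<Rightarrow> ('a, 'n) chart \<Rightarrow> real^'n \<Rightarrow> real^'n^'n" where
  "metric_matrix g c y = (\<chi> i j. g c [i, j] y)"

definition riemannian_metric :: "('a, 'n::finite) chart set \<Rightarrow> ('a, 'n) field \<Rightarrow> bool" where
  "riemannian_metric A g \<longleftrightarrow>
     g \<in> sym_tensor_fields A 2 \<and>
     (\<forall>c\<in>A. \<forall>y\<in>chart_image c. \<forall>v. v \<noteq> 0 \<longrightarrow> v \<bullet> (metric_matrix g c y *v v) > 0)"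

definition ginv :: "('a, 'n::finite) field \<Rightarrow> ('a, 'n) chart \<Rightarrow> 'n \<Rightarrow> 'n \<Rightarrow> real^'n \<Rightarrow> real" where
  "ginv g c i j y = matrix_inv (metric_matrix g c y) $ i $ j"

text \<open>Components of a field whose first \<open>q\<close> indices have been raised.\<close>

definition raise :: "('a, 'n::finite) field \<Rightarrow> nat \<Rightarrow> ('a, 'n) field \<Rightarrow> ('a, 'n) field" where
  "raise g q \<phi> c is y =
     (\<Sum>ms | length ms = q. (\<Prod>k<q. ginv g c (is ! k) (ms ! k) y) * \<phi> c (ms @ drop q is) y)"

section \<open>Levi-Civita connection and curvature\<close>

text \<open>\<open>christoffel g c k i j\<close> is \<open>\<Gamma>\<^sup>k\<^sub>i\<^sub>j\<close>.\<close>

definition christoffel ::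
    "('a, 'n::finite) field \<Rightarrow> ('a, 'n) chart \<Rightarrow> 'n \<Rightarrow> 'n \<Rightarrow> 'n \<Rightarrow> real^'n \<Rightarrow> real" where
  "christoffel g c k i j y =
     (\<Sum>l\<in>UNIV. ginv g c k l y *
        (pd i (g c [j, l]) y + pd j (g c [i, l]) y - pd l (g c [i, j]) y)) / 2"

text \<open>
  The differentiation index comes first: \<open>nabla g \<phi> c (i # is)\<close> is \<open>\<nabla>\<^sub>i \<phi>\<^sub>i\<^sub>s\<close>.
\<close>

definition nabla :: "('a, 'n::finite) field \<Rightarrow> ('a, 'n) field \<Rightarrow> ('a, 'n) field" where
  "nabla g \<phi> c is y =
     pd (hd is) (\<phi> c (tl is)) y
     - (\<Sum>k<length (tl is). \<Sum>m\<in>UNIV.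
          christoffel g c m (hd is) (tl is ! k) y * \<phi> c ((tl is)[k := m]) y)"

text \<open>
  \<open>riemann_up g c m j k l\<close> is the \<open>m\<close>-th component of \<open>R(\<partial>\<^sub>k, \<partial>\<^sub>l) \<partial>\<^sub>j\<close>, where
  \<open>R(X, Y) = [\<nabla>\<^sub>X, \<nabla>\<^sub>Y] - \<nabla>\<^sub>[\<^sub>X\<^sub>,\<^sub>Y\<^sub>]\<close>. With the index lowered into first position, a metric of constant
  sectional curvature 1 has \<open>R\<^sub>i\<^sub>j\<^sub>k\<^sub>l = g\<^sub>i\<^sub>k g\<^sub>j\<^sub>l - g\<^sub>i\<^sub>l g\<^sub>j\<^sub>k\<close>, so that \<open>ricci\<close> is positive on the round sphere.
\<close>

definition riemann_up ::
    "('a, 'n::finite) field \<Rightarrow> ('a, 'n) chart \<Rightarrow> 'n \<Rightarrow> 'n \<Rightarrow> 'n \<Rightarrow> 'n \<Rightarrow> real^'n \<Rightarrow> real" where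
  "riemann_up g c m j k l y =
     pd k (christoffel g c m l j) y - pd l (christoffel g c m k j) y
     + (\<Sum>s\<in>UNIV. christoffel g c m k s y * christoffel g c s l j y
                - christoffel g c m l s y * christoffel g c s k j y)"

definition riemann ::
    "('a, 'n::finite) field \<Rightarrow> ('a, 'n) chart \<Rightarrow> 'n \<Rightarrow> 'n \<Rightarrow> 'n \<Rightarrow> 'n \<Rightarrow> real^'n \<Rightarrow> real" where
  "riemann g c i j k l y = (\<Sum>m\<in>UNIV. g c [i, m] y * riemann_up g c m j k l y)"

definition ricci ::
    "('a, 'n::finite) field \<Rightarrow> ('a, 'n) chart \<Rightarrow> 'n \<Rightarrow> 'n \<Rightarrow> real^'n \<Rightarrow> real" where
  "ricci g c i k y = (\<Sum>j\<in>UNIV. \<Sum>l\<in>UNIV. ginv g c j l y * riemann g c i j k l y)"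

section \<open>The operators\<close>

definition delta_star :: "('a, 'n::finite) field \<Rightarrow> ('a, 'n) field \<Rightarrow> ('a, 'n) field" where
  "delta_star g \<phi> c is y =
     (\<Sum>k<length is. nabla g \<phi> c (is ! k # take k is @ drop (Suc k) is) y)"

definition delta :: "('a, 'n::finite) field \<Rightarrow> ('a, 'n) field \<Rightarrow> ('a, 'n) field" where
  "delta g \<xi> c is y = - (\<Sum>i\<in>UNIV. \<Sum>j\<in>UNIV. ginv g c i j y * nabla g \<xi> c (j # i # is) y)"

definition yano_laplacian :: "('a, 'n::finite) field \<Rightarrow> ('a, 'n) field \<Rightarrow> ('a, 'n) field" where
  "yano_laplacian g \<phi> c is y =
     delta g (delta_star g \<phi>) c is y - delta_star g (delta g \<phi>) c is y"

definition B_op :: "('a, 'n::finite) field \<Rightarrow> ('a, 'n) field \<Rightarrow> ('a, 'n) field" where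
  "B_op g \<phi> c is y =
     (\<Sum>k<length is. \<Sum>j\<in>UNIV. \<Sum>s\<in>UNIV.
        ginv g c j s y * ricci g c (is ! k) j y * \<phi> c (is[k := s]) y)
     - (\<Sum>k<length is. \<Sum>l\<in>{..<length is} - {k}.
          \<Sum>j\<in>UNIV. \<Sum>s\<in>UNIV. \<Sum>m\<in>UNIV. \<Sum>t\<in>UNIV.
            ginv g c j s y * ginv g c m t y * riemann g c (is ! k) j (is ! l) m y
            * \<phi> c (is[k := s, l := t]) y)"

section \<open>Integration and global scalar products\<close>

text \<open>
  The Riemannian measure is the Borel measure on \<open>M\<close> with density \<open>\<surd>(det g)\<close> in every chart; on a compact
  manifold it exists and is uniquely determined by this property.
\<close>

definition is_riemannian_measure ::
    "'a::topological_space set \<Rightarrow> ('a, 'n::finite) chart set \<Rightarrow> ('a, 'n) field \<Rightarrow> 'a measure \<Rightarrow> bool" where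
  "is_riemannian_measure M A g \<mu> \<longleftrightarrow>
     space \<mu> = M \<and> sets \<mu> = sets (restrict_space borel M) \<and>
     (\<forall>c\<in>A. \<forall>X\<in>sets \<mu>. X \<subseteq> fst c \<longrightarrow>
        emeasure \<mu> X = (\<integral>\<^sup>+y\<in>snd c ` X. ennreal (sqrt (det (metric_matrix g c y))) \<partial>lborel))"

definition riemannian_measure ::
    "'a::topological_space set \<Rightarrow> ('a, 'n::finite) chart set \<Rightarrow> ('a, 'n) field \<Rightarrow> 'a measure" where
  "riemannian_measure M A g = (SOME \<mu>. is_riemannian_measure M A g \<mu>)"

text \<open>
  A scalar given by its coordinate expressions \<open>f c\<close> (agreeing on overlaps) is integrated by
  evaluating it at each point in some chart around that point.
\<close>

definition scalar_at ::
    "('a, 'n::finite) chart set \<Rightarrow> (('a, 'n) chart \<Rightarrow> real^'n \<Rightarrow> real) \<Rightarrow> 'a \<Rightarrow> real" where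
  "scalar_at A f x = (let c = (SOME c. c \<in> A \<and> x \<in> fst c) in f c (snd c x))"

definition manifold_integral ::
    "'a::topological_space set \<Rightarrow> ('a, 'n::finite) chart set \<Rightarrow> ('a, 'n) field
      \<Rightarrow> (('a, 'n) chart \<Rightarrow> real^'n \<Rightarrow> real) \<Rightarrow> real" where
  "manifold_integral M A g f = (\<integral>x. scalar_at A f x \<partial>riemannian_measure M A g)"

definition inner_sym ::
    "'a::topological_space set \<Rightarrow> ('a, 'n::finite) chart set \<Rightarrow> ('a, 'n) field \<Rightarrow> nat
      \<Rightarrow> ('a, 'n) field \<Rightarrow> ('a, 'n) field \<Rightarrow> real" where
  "inner_sym M A g p \<phi> \<psi> = manifold_integral M A g
     (\<lambda>c y. 1 / fact p * (\<Sum>is | length is = p. raise g p \<phi> c is y * \<psi> c is y))"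

text \<open>The factor is \<open>1 / p!\<close>, although the tensors contracted have rank \<open>p + 1\<close>.\<close>

definition inner_nabla ::
    "'a::topological_space set \<Rightarrow> ('a, 'n::finite) chart set \<Rightarrow> ('a, 'n) field \<Rightarrow> nat
      \<Rightarrow> ('a, 'n) field \<Rightarrow> ('a, 'n) field \<Rightarrow> real" where
  "inner_nabla M A g p \<phi> \<psi> = manifold_integral M A g
     (\<lambda>c y. 1 / fact p *
        (\<Sum>is | length is = Suc p. nabla g \<phi> c is y * raise g (Suc p) (nabla g \<psi>) c is y))"

end

theory Submission
  imports Defs
begin

text \<open>
  In a single chart, the Ricci identity for \<open>\<nabla>\<nabla>\<phi>\<close> and the symmetries of the curvature tensor give the
  pointwise formula \<open>\<Delta>\<^sub>s\<^sub>y\<^sub>m \<phi> = - tr \<nabla>\<nabla>\<phi> - B\<^sub>p \<phi>\<close>, where the trace is over the two differentiation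
  indices, and metric compatibility gives
  \<open>\<langle>tr \<nabla>\<nabla>\<phi>, \<phi>\<rangle> + \<langle>\<nabla>\<phi>, \<nabla>\<phi>\<rangle> = div grad (\<bar>\<phi>\<bar>\<^sup>2 / 2)\<close>. Covariant differentiation, traces and
  transpositions of slots preserve the tensor transformation law, so every term is a continuous function
  on the compact manifold; in particular \<open>B\<^sub>p \<phi>\<close> is a tensor because it is a trace of commutators of
  covariant derivatives. The integral of the divergence vanishes by a \<open>C\<^sup>1\<close> partition of unity: in one
  chart it is the integral of a partial derivative of a compactly supported function on Euclidean space.
  The Riemannian measure is glued from a finite cover by charts; the pieces agree on overlaps by the change
  of variables formula.
\<close>

section \<open>Partial derivatives\<close>

text \<open>The operators are coordinate formulas in each chart, and
  \<open>manifold_integral\<close> evaluates its integrand at every point in an arbitrarily chosen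
  chart. Such an integral can be controlled once the expressions are known to agree on overlaps: the
  integrand is then continuous on \<open>M\<close>, hence integrable, and only integrable functions
  allow the Bochner integral of a sum to be split. This is why the tensor law has to be carried
  through every operator, starting from the inhomogeneous transformation law of the Christoffel
  symbols. When that divergence is integrated by parts, only first derivatives fall on the partition
  functions, so squares of positive parts of polynomials serve as bump functions. The Riemannian
  measure is a Hilbert choice, so its existence comes before any of its properties. Its defining
  property speaks only of sets inside one chart, which is the reason for localising integrands to a
  single chart.\<close>

lemma pd_eq: "(f has_derivative f') (at y) \<Longrightarrow> pd i f y = f' (axis i 1)"
  unfolding pd_def using frechet_derivative_at by metis

text \<open>\<open>frechet_derivative\<close> is a Hilbert choice from the set of derivatives at
  \<open>y\<close>, and functions that agree near \<open>y\<close> have the same set. The chosen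
  values therefore coincide even where neither function is differentiable.\<close>

lemma pd_cong:
  assumes "open S" "y \<in> S" "\<And>z. z \<in> S \<Longrightarrow> f z = h z"
  shows "pd i f y = pd i h y"
proof -
  have "(f has_derivative D) (at y) \<longleftrightarrow> (h has_derivative D) (at y)" for D
    using has_derivative_transform_within_open[of f D y UNIV S h]
      has_derivative_transform_within_open[of h D y UNIV S f] assms by auto
  then show ?thesis unfolding pd_def frechet_derivative_def by simp
qed

lemma pd_const [simp]: "pd i (\<lambda>_. c) = (\<lambda>_. 0)"
  by (simp add: pd_def fun_eq_iff)

lemma pd_add:
  assumes "f differentiable (at y)" "h differentiable (at y)"
  shows "pd i (\<lambda>y. f y + h y) y = pd i f y + pd i h y"
proof -
  have "(f has_derivative frechet_derivative f (at y)) (at y)"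
    "(h has_derivative frechet_derivative h (at y)) (at y)"
    using assms frechet_derivative_works by blast+
  from pd_eq[OF has_derivative_add[OF this]] show ?thesis
    by (simp add: pd_def)
qed

lemma pd_minus:
  assumes "f differentiable (at y)"
  shows "pd i (\<lambda>y. - f y) y = - pd i f y"
proof -
  have "(f has_derivative frechet_derivative f (at y)) (at y)"
    using assms frechet_derivative_works by blast
  from pd_eq[OF has_derivative_minus[OF this]] show ?thesis
    by (simp add: pd_def)
qed

lemma pd_diff:
  assumes "f differentiable (at y)" "h differentiable (at y)"
  shows "pd i (\<lambda>y. f y - h y) y = pd i f y - pd i h y"
proof -
  have "(f has_derivative frechet_derivative f (at y)) (at y)"
    "(h has_derivative frechet_derivative h (at y)) (at y)"
    using assms frechet_derivative_works by blast+
  from pd_eq[OF has_derivative_diff[OF this]] show ?thesis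
    by (simp add: pd_def)
qed

lemma pd_mult:
  assumes "f differentiable (at y)" "h differentiable (at y)"
  shows "pd i (\<lambda>y. f y * h y) y = pd i f y * h y + f y * pd i h y"
proof -
  have "(f has_derivative frechet_derivative f (at y)) (at y)"
    "(h has_derivative frechet_derivative h (at y)) (at y)"
    using assms frechet_derivative_works by blast+
  from pd_eq[OF has_derivative_mult[OF this]] show ?thesis
    by (simp add: pd_def algebra_simps)
qed

lemma pd_cmult:
  "f differentiable (at y) \<Longrightarrow> pd i (\<lambda>y. a * f y) y = a * pd i f y"
  by (subst pd_mult) auto

lemma pd_inverse:
  assumes "f differentiable (at y)" "f y \<noteq> 0"
  shows "pd i (\<lambda>y. inverse (f y)) y = - (pd i f y * inverse (f y) * inverse (f y))"
proof -
  have "(f has_derivative frechet_derivative f (at y)) (at y)"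
    using assms frechet_derivative_works by blast+
  from pd_eq[OF Deriv.has_derivative_inverse[OF assms(2) this]] show ?thesis
    by (simp add: pd_def algebra_simps)
qed

lemma pd_sum:
  assumes "\<And>a. a \<in> I \<Longrightarrow> f a differentiable (at y)"
  shows "pd i (\<lambda>y. \<Sum>a\<in>I. f a y) y = (\<Sum>a\<in>I. pd i (f a) y)"
proof -
  have "(f a has_derivative frechet_derivative (f a) (at y)) (at y)" if "a \<in> I" for a
    using assms that frechet_derivative_works by blast
  from pd_eq[OF has_derivative_sum[OF this]] show ?thesis
    by (simp add: pd_def)
qed

lemma pd_prod:
  assumes "\<And>a. a \<in> I \<Longrightarrow> f a differentiable (at y)" "finite I"
  shows "pd i (\<lambda>y. \<Prod>a\<in>I. f a y) y = (\<Sum>a\<in>I. pd i (f a) y * (\<Prod>b\<in>I - {a}. f b y))"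
proof -
  have "(f a has_derivative frechet_derivative (f a) (at y)) (at y)" if "a \<in> I" for a
    using assms that frechet_derivative_works by blast
  from pd_eq[OF has_derivative_prod[OF this]] show ?thesis
    by (simp add: pd_def)
qed

lemma differentiable_prod:
  fixes f :: "'b \<Rightarrow> 'c::real_normed_vector \<Rightarrow> 'd::real_normed_field"
  assumes "\<And>a. a \<in> I \<Longrightarrow> f a differentiable (at y)" "finite I"
  shows "(\<lambda>y. \<Prod>a\<in>I. f a y) differentiable (at y)"
  using assms(2,1) by induction auto

lemma frechet_derivative_pd:
  assumes "f differentiable (at y)"
  shows "frechet_derivative f (at y) v = (\<Sum>i\<in>UNIV. v $ i * pd i f y)"
proof -
  have l: "linear (frechet_derivative f (at y))"
    using assms by (rule linear_frechet_derivative)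
  have "frechet_derivative f (at y) v = frechet_derivative f (at y) (\<Sum>i\<in>UNIV. v $ i *\<^sub>R axis i 1)"
    by (simp add: basis_expansion flip: scalar_mult_eq_scaleR)
  also have "\<dots> = (\<Sum>i\<in>UNIV. v $ i * pd i f y)"
    by (simp add: linear_sum[OF l] linear_scale[OF l] pd_def)
  finally show ?thesis .
qed

lemma has_derivative_vec:
  fixes T :: "'b::real_normed_vector \<Rightarrow> real^'n::finite"
  assumes "\<And>a. ((\<lambda>y. T y $ a) has_derivative (\<lambda>v. T' v $ a)) (at y)"
  shows "(T has_derivative T') (at y)"
proof -
  have "((\<lambda>x. T x \<bullet> b) has_derivative (\<lambda>x. T' x \<bullet> b)) (at y)" if b: "b \<in> Basis" for b
  proof -
    from b obtain a where "b = axis a 1" by (auto simp: Basis_vec_def)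
    then show ?thesis using assms[of a] by (simp add: inner_axis)
  qed
  then show ?thesis
    by (subst has_derivative_componentwise_within) blast
qed

lemma has_derivative_vec_frechet:
  fixes T :: "'b::real_normed_vector \<Rightarrow> real^'n::finite"
  assumes "\<And>a. (\<lambda>y. T y $ a) differentiable (at y)"
  shows "(T has_derivative (\<lambda>v. \<chi> a. frechet_derivative (\<lambda>y. T y $ a) (at y) v)) (at y)"
  by (rule has_derivative_vec) (use assms frechet_derivative_works in auto)

text \<open>Smoothness of a transition map is stated component by component, so the chain rule
  starts from componentwise differentiability and assembles the derivative of \<open>T\<close>
  itself.\<close>

lemma pd_compose:
  fixes T :: "real^'n::finite \<Rightarrow> real^'n"
  assumes T: "\<And>a. (\<lambda>y. T y $ a) differentiable (at y)" and f: "f differentiable (at (T y))"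
  shows "pd i (\<lambda>y. f (T y)) y = (\<Sum>a\<in>UNIV. pd i (\<lambda>y. T y $ a) y * pd a f (T y))"
    and "(\<lambda>y. f (T y)) differentiable (at y)"
proof -
  define T' where "T' = (\<lambda>v. \<chi> a. frechet_derivative (\<lambda>y. T y $ a) (at y) v)"
  have T': "(T has_derivative T') (at y)"
    unfolding T'_def by (rule has_derivative_vec_frechet[OF T])
  have f': "(f has_derivative frechet_derivative f (at (T y))) (at (T y))"
    using f frechet_derivative_works by blast
  note c = has_derivative_compose[OF T' f']
  show "pd i (\<lambda>y. f (T y)) y = (\<Sum>a\<in>UNIV. pd i (\<lambda>y. T y $ a) y * pd a f (T y))"
    unfolding pd_eq[OF c] frechet_derivative_pd[OF f] by (simp add: T'_def pd_def)
  show "(\<lambda>y. f (T y)) differentiable (at y)"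
    using c differentiable_def by blast
qed

lemma jacobian_pd:
  fixes T :: "real^'n::finite \<Rightarrow> real^'n"
  assumes T: "\<And>a. (\<lambda>y. T y $ a) differentiable (at y)"
  shows "jacobian T (at y) $ a $ i = pd i (\<lambda>y. T y $ a) y"
    and "(T has_derivative frechet_derivative T (at y)) (at y)"
    and "continuous (at y) T"
proof -
  define T' where "T' = (\<lambda>v. \<chi> a. frechet_derivative (\<lambda>y. T y $ a) (at y) v)"
  have T': "(T has_derivative T') (at y)"
    unfolding T'_def by (rule has_derivative_vec_frechet[OF T])
  then have "frechet_derivative T (at y) = T'"
    by (rule frechet_derivative_at[symmetric])
  then show "jacobian T (at y) $ a $ i = pd i (\<lambda>y. T y $ a) y"
    by (simp add: jacobian_def matrix_def T'_def pd_def)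
  show "(T has_derivative frechet_derivative T (at y)) (at y)"
    using T' differentiable_def frechet_derivative_works by blast
  show "continuous (at y) T"
    using T' has_derivative_continuous by blast
qed

text \<open>Restriction to a coordinate line makes the one-variable mean value theorem available,
  both for mixed partial derivatives and for difference quotients under an integral.\<close>

lemma pd_line:
  assumes "f differentiable (at (a + t *\<^sub>R axis i 1))"
  shows "((\<lambda>t. f (a + t *\<^sub>R axis i 1)) has_real_derivative pd i f (a + t *\<^sub>R axis i 1)) (at t)"
proof -
  let ?D = "frechet_derivative f (at (a + t *\<^sub>R axis i 1))"
  have "((\<lambda>t. a + t *\<^sub>R axis i 1) has_derivative (\<lambda>t. t *\<^sub>R axis i 1)) (at t)"
    by (auto intro!: derivative_eq_intros)
  moreover have "(f has_derivative ?D) (at (a + t *\<^sub>R axis i 1))"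
    using assms frechet_derivative_works by blast
  ultimately have "((\<lambda>t. f (a + t *\<^sub>R axis i 1)) has_derivative (\<lambda>t. ?D (t *\<^sub>R axis i 1))) (at t)"
    by (rule has_derivative_compose)
  moreover have "(\<lambda>t. ?D (t *\<^sub>R axis i 1)) = (*) (pd i f (a + t *\<^sub>R axis i 1))"
    using linear_scale[OF linear_frechet_derivative[OF assms]] by (auto simp: pd_def)
  ultimately show ?thesis by (simp add: has_field_derivative_def)
qed

section \<open>Functions of class \<open>C\<^sup>k\<close>\<close>

lemma Ck_on_cong:
  assumes "open S" "\<And>z. z \<in> S \<Longrightarrow> f z = h z"
  shows "Ck_on k S f \<longleftrightarrow> Ck_on k S h"
  using assms(2)
proof (induction k arbitrary: f h)
  case 0
  then show ?case by (simp cong: continuous_on_cong)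
next
  case (Suc k)
  have "f differentiable_on S \<longleftrightarrow> h differentiable_on S"
    using Suc.prems unfolding differentiable_on_def differentiable_def
    by (metis has_derivative_transform)
  moreover have "Ck_on k S (pd i f) \<longleftrightarrow> Ck_on k S (pd i h)" for i
    by (rule Suc.IH) (use pd_cong[OF assms(1)] Suc.prems in blast)
  ultimately show ?case by simp
qed

lemma Ck_on_Suc_imp: "Ck_on (Suc k) S f \<Longrightarrow> Ck_on k S f"
proof (induction k arbitrary: f)
  case 0
  then show ?case by (simp add: differentiable_imp_continuous_on)
qed simp

context
  fixes S :: "(real^'n::finite) set"
  assumes S: "open S"
begin

lemma Ck_on_differentiable: "Ck_on (Suc k) S f \<Longrightarrow> y \<in> S \<Longrightarrow> f differentiable (at y)"
  using S by (simp add: differentiable_on_eq_differentiable_at)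

lemma Ck_on_const: "Ck_on k S (\<lambda>_. a)"
  by (induction k arbitrary: a) (auto)

lemma Ck_on_add: "Ck_on k S f \<Longrightarrow> Ck_on k S h \<Longrightarrow> Ck_on k S (\<lambda>y. f y + h y)"
proof (induction k arbitrary: f h)
  case 0
  then show ?case by (auto intro: continuous_on_add)
next
  case (Suc k)
  have "Ck_on k S (\<lambda>y. pd i f y + pd i h y)" for i
    using Suc by auto
  then have "Ck_on k S (pd i (\<lambda>y. f y + h y))" for i
    using Ck_on_differentiable[OF Suc.prems(1)] Ck_on_differentiable[OF Suc.prems(2)]
    by (subst Ck_on_cong[OF S pd_add])
  with Suc.prems show ?case by (simp add: differentiable_on_def)
qed

lemma Ck_on_mult: "Ck_on k S f \<Longrightarrow> Ck_on k S h \<Longrightarrow> Ck_on k S (\<lambda>y. f y * h y)"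
proof (induction k arbitrary: f h)
  case 0
  then show ?case by (auto intro: continuous_on_mult)
next
  case (Suc k)
  have "Ck_on k S (\<lambda>y. pd i f y * h y + f y * pd i h y)" for i
    using Suc Suc.prems[THEN Ck_on_Suc_imp] by (auto intro!: Ck_on_add)
  then have "Ck_on k S (pd i (\<lambda>y. f y * h y))" for i
    using Ck_on_differentiable[OF Suc.prems(1)] Ck_on_differentiable[OF Suc.prems(2)]
    by (subst Ck_on_cong[OF S pd_mult])
  with Suc.prems show ?case by (simp add: differentiable_on_def)
qed

lemma Ck_on_inverse:
  "Ck_on k S f \<Longrightarrow> (\<And>y. y \<in> S \<Longrightarrow> f y \<noteq> 0) \<Longrightarrow> Ck_on k S (\<lambda>y. inverse (f y))"
proof (induction k)
  case 0
  then show ?case by (auto intro: continuous_on_inverse)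
next
  case (Suc k)
  have "Ck_on k S (\<lambda>y. (-1) * (pd i f y * inverse (f y) * inverse (f y)))" for i
    using Suc Suc.prems(1)[THEN Ck_on_Suc_imp] by (intro Ck_on_mult Ck_on_const) auto
  then have "Ck_on k S (\<lambda>y. - (pd i f y * inverse (f y) * inverse (f y)))" for i
    by simp
  then have "Ck_on k S (pd i (\<lambda>y. inverse (f y)))" for i
    using Ck_on_differentiable[OF Suc.prems(1)] Suc.prems(2)
    by (subst Ck_on_cong[OF S pd_inverse])
  moreover have "(\<lambda>y. inverse (f y)) differentiable_on S"
    using Suc.prems by (auto simp: differentiable_on_def intro!: differentiable_inverse)
  ultimately show ?case by simp
qed

lemma Ck_on_minus: "Ck_on k S f \<Longrightarrow> Ck_on k S (\<lambda>y. - f y)"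
  using Ck_on_mult[OF Ck_on_const[of k "-1"]] by simp

lemma Ck_on_diff: "Ck_on k S f \<Longrightarrow> Ck_on k S h \<Longrightarrow> Ck_on k S (\<lambda>y. f y - h y)"
  using Ck_on_add[OF _ Ck_on_minus] by simp

lemma Ck_on_sum: "(\<And>a. a \<in> I \<Longrightarrow> Ck_on k S (f a)) \<Longrightarrow> Ck_on k S (\<lambda>y. \<Sum>a\<in>I. f a y)"
  by (induction I rule: infinite_finite_induct) (auto intro: Ck_on_add Ck_on_const)

lemma Ck_on_prod: "(\<And>a. a \<in> I \<Longrightarrow> Ck_on k S (f a)) \<Longrightarrow> Ck_on k S (\<lambda>y. \<Prod>a\<in>I. f a y)"
  by (induction I rule: infinite_finite_induct) (auto intro: Ck_on_mult Ck_on_const)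

end

lemma smooth_on_pd: "smooth_on S f \<Longrightarrow> smooth_on S (pd i f)"
  unfolding smooth_on_def by (metis Ck_on.simps(2))

lemma smooth_on_cong:
  "open S \<Longrightarrow> (\<And>z. z \<in> S \<Longrightarrow> f z = h z) \<Longrightarrow> smooth_on S f \<longleftrightarrow> smooth_on S h"
  unfolding smooth_on_def using Ck_on_cong[of S f h] by simp

lemma smooth_on_differentiable: "smooth_on S f \<Longrightarrow> open S \<Longrightarrow> y \<in> S \<Longrightarrow> f differentiable (at y)"
  unfolding smooth_on_def using Ck_on_differentiable[of S 0 f y] by blast

lemma smooth_on_continuous: "smooth_on S f \<Longrightarrow> continuous_on S f"
  unfolding smooth_on_def by (metis Ck_on.simps(1))

lemma smooth_on_const: "open S \<Longrightarrow> smooth_on S (\<lambda>_. a)"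
  by (simp add: smooth_on_def Ck_on_const)

lemma smooth_on_add: "open S \<Longrightarrow> smooth_on S f \<Longrightarrow> smooth_on S h \<Longrightarrow> smooth_on S (\<lambda>y. f y + h y)"
  by (simp add: smooth_on_def Ck_on_add)

lemma smooth_on_mult: "open S \<Longrightarrow> smooth_on S f \<Longrightarrow> smooth_on S h \<Longrightarrow> smooth_on S (\<lambda>y. f y * h y)"
  by (simp add: smooth_on_def Ck_on_mult)

lemma smooth_on_minus: "open S \<Longrightarrow> smooth_on S f \<Longrightarrow> smooth_on S (\<lambda>y. - f y)"
  by (simp add: smooth_on_def Ck_on_minus)

lemma smooth_on_diff: "open S \<Longrightarrow> smooth_on S f \<Longrightarrow> smooth_on S h \<Longrightarrow> smooth_on S (\<lambda>y. f y - h y)"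
  by (simp add: smooth_on_def Ck_on_diff)

lemma smooth_on_inverse:
  "open S \<Longrightarrow> smooth_on S f \<Longrightarrow> (\<And>y. y \<in> S \<Longrightarrow> f y \<noteq> 0) \<Longrightarrow> smooth_on S (\<lambda>y. inverse (f y))"
  by (simp add: smooth_on_def Ck_on_inverse)

lemma smooth_on_divide:
  "open S \<Longrightarrow> smooth_on S f \<Longrightarrow> smooth_on S h \<Longrightarrow> (\<And>y. y \<in> S \<Longrightarrow> h y \<noteq> 0) \<Longrightarrow> smooth_on S (\<lambda>y. f y / h y)"
  unfolding divide_inverse by (intro smooth_on_mult smooth_on_inverse)

lemma smooth_on_sum:
  "open S \<Longrightarrow> (\<And>a. a \<in> I \<Longrightarrow> smooth_on S (f a)) \<Longrightarrow> smooth_on S (\<lambda>y. \<Sum>a\<in>I. f a y)"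
  by (simp add: smooth_on_def Ck_on_sum)

lemma smooth_on_prod:
  "open S \<Longrightarrow> (\<And>a. a \<in> I \<Longrightarrow> smooth_on S (f a)) \<Longrightarrow> smooth_on S (\<lambda>y. \<Prod>a\<in>I. f a y)"
  by (simp add: smooth_on_def Ck_on_prod)

lemmas smooth_on_intros = smooth_on_pd smooth_on_const smooth_on_add smooth_on_mult smooth_on_minus
  smooth_on_diff smooth_on_sum smooth_on_prod

text \<open>Two applications of the mean value theorem: along direction \<open>j\<close> to the
  increment of \<open>f\<close> in direction \<open>i\<close>, then along direction \<open>i\<close>
  to \<open>pd j f\<close>. The left side does not change when \<open>i\<close> and \<open>j\<close>
  are exchanged, which is what the symmetry of second derivatives rests on.\<close>

lemma second_difference:
  fixes f :: "real^'n::finite \<Rightarrow> real"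
  assumes r: "ball y r \<subseteq> S" and S: "open S" and f: "smooth_on S f" and h: "0 < h" "2 * h < r"
  shows "\<exists>x\<in>ball y r. f (y + h *\<^sub>R axis i 1 + h *\<^sub>R axis j 1) - f (y + h *\<^sub>R axis i 1) -
      f (y + h *\<^sub>R axis j 1) + f y = h * h * pd i (pd j f) x"
proof -
  have ball: "y + t *\<^sub>R axis i 1 + s *\<^sub>R axis j 1 \<in> ball y r"
    if "0 \<le> t" "t \<le> h" "0 \<le> s" "s \<le> h" for s t
  proof -
    have "dist y (y + t *\<^sub>R axis i 1 + s *\<^sub>R axis j 1) \<le> t + s"
      using norm_triangle_ineq[of "t *\<^sub>R axis i (1::real)" "s *\<^sub>R axis j 1"] that
      by (simp add: dist_norm norm_minus_commute algebra_simps)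
    then show ?thesis using that h by auto
  qed
  have ball0: "y + s *\<^sub>R axis j 1 \<in> ball y r" if "0 \<le> s" "s \<le> h" for s
    using ball[of 0 s] that h by auto
  note df = smooth_on_differentiable[OF f S] smooth_on_differentiable[OF smooth_on_pd[OF f] S]
  \<comment> \<open>\<open>F s\<close> is the increment of \<open>f\<close> in direction
    \<open>i\<close> after a step \<open>s\<close> in direction \<open>j\<close>; the second
    difference is \<open>F h - F 0\<close>.\<close>
  define F where "F s = f (y + h *\<^sub>R axis i 1 + s *\<^sub>R axis j 1) - f (y + s *\<^sub>R axis j 1)" for s
  have "(F has_real_derivative
      (pd j f (y + h *\<^sub>R axis i 1 + s *\<^sub>R axis j 1) - pd j f (y + s *\<^sub>R axis j 1))) (at s)"
    if "0 \<le> s" "s \<le> h" for s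
    unfolding F_def by (intro DERIV_diff pd_line df) (use ball ball0 that h r in force)+
  from MVT2[OF h(1) this] obtain s where s: "0 < s" "s < h"
    "F h - F 0 = h * (pd j f (y + h *\<^sub>R axis i 1 + s *\<^sub>R axis j 1) - pd j f (y + s *\<^sub>R axis j 1))"
    by auto
  have "((\<lambda>t. pd j f (y + s *\<^sub>R axis j 1 + t *\<^sub>R axis i 1)) has_real_derivative
      pd i (pd j f) (y + s *\<^sub>R axis j 1 + t *\<^sub>R axis i 1)) (at t)"
    if "0 \<le> t" "t \<le> h" for t
    by (intro pd_line df) (use ball[of t s] that s r in \<open>force simp: algebra_simps\<close>)+
  from MVT2[OF h(1) this] obtain t where t: "0 < t" "t < h"
    "pd j f (y + s *\<^sub>R axis j 1 + h *\<^sub>R axis i 1) - pd j f (y + s *\<^sub>R axis j 1)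
      = h * pd i (pd j f) (y + s *\<^sub>R axis j 1 + t *\<^sub>R axis i 1)"
    by auto
  show ?thesis
    by (rule bexI[of _ "y + s *\<^sub>R axis j 1 + t *\<^sub>R axis i 1"])
      (use s t ball[of t s] in \<open>auto simp: F_def algebra_simps\<close>)
qed

text \<open>By \<open>second_difference\<close> the two mixed derivatives take a common value at
  points arbitrarily close to \<open>y\<close>, and both are continuous there.\<close>

lemma pd_commute:
  fixes f :: "real^'n::finite \<Rightarrow> real"
  assumes S: "open S" and f: "smooth_on S f" and y: "y \<in> S"
  shows "pd i (pd j f) y = pd j (pd i f) y"
proof (rule ccontr)
  let ?A = "pd i (pd j f)" and ?B = "pd j (pd i f)"
  assume "?A y \<noteq> ?B y"
  \<comment> \<open>Half the gap: two values within \<open>e\<close> of the two different limits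
    cannot be equal.\<close>
  define e where "e = \<bar>?A y - ?B y\<bar> / 2"
  have e: "e > 0" using \<open>?A y \<noteq> ?B y\<close> by (simp add: e_def)
  have "isCont ?A y" "isCont ?B y"
    using f S y continuous_on_eq_continuous_at[OF S] smooth_on_continuous smooth_on_pd by blast+
  then obtain d1 d2 where d: "d1 > 0" "d2 > 0"
    "\<And>x. dist x y < d1 \<Longrightarrow> dist (?A x) (?A y) < e" "\<And>x. dist x y < d2 \<Longrightarrow> dist (?B x) (?B y) < e"
    using e unfolding continuous_at_eps_delta by blast
  obtain d3 where d3: "d3 > 0" "ball y d3 \<subseteq> S" using S y open_contains_ball by blast
  define r where "r = min d1 (min d2 d3)"
  have r: "r > 0" "ball y r \<subseteq> S" using d d3 by (auto simp: r_def)
  define h where "h = r / 4"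
  have h: "0 < h" "2 * h < r" using r by (auto simp: h_def)
  obtain x where x: "x \<in> ball y r" "f (y + h *\<^sub>R axis i 1 + h *\<^sub>R axis j 1) - f (y + h *\<^sub>R axis i 1) -
      f (y + h *\<^sub>R axis j 1) + f y = h * h * ?A x"
    using second_difference[OF r(2) S f h] by blast
  obtain z where z: "z \<in> ball y r" "f (y + h *\<^sub>R axis j 1 + h *\<^sub>R axis i 1) - f (y + h *\<^sub>R axis j 1) -
      f (y + h *\<^sub>R axis i 1) + f y = h * h * ?B z"
    using second_difference[OF r(2) S f h] by blast
  have "h * h * ?A x = h * h * ?B z"
    unfolding x(2)[symmetric] z(2)[symmetric] by (simp add: algebra_simps)
  then have "?A x = ?B z" using h by simp
  have "dist (?A x) (?A y) < e" "dist (?B z) (?B y) < e"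
    using x(1) z(1) d(3)[of x] d(4)[of z] by (auto simp: r_def dist_commute)
  with \<open>?A x = ?B z\<close> show False unfolding e_def dist_real_def by (simp add: abs_if split: if_splits)
qed

section \<open>Sums over index lists\<close>

text \<open>Entry at \<open>(I, J)\<close> of the \<open>p\<close>-th tensor power of the matrix
  \<open>A\<close>. With the inverse metric it raises all indices at once; with a Jacobian it is the
  matrix of the tensor transformation law.\<close>

definition tpow :: "nat \<Rightarrow> ('n \<Rightarrow> 'm \<Rightarrow> real) \<Rightarrow> 'n list \<Rightarrow> 'm list \<Rightarrow> real" where
  "tpow p A I J = (\<Prod>k<p. A (I ! k) (J ! k))"

definition lswap :: "nat \<Rightarrow> nat \<Rightarrow> 'n list \<Rightarrow> 'n list" where
  "lswap a b I = I[b := I ! a, a := I ! b]"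

lemma finite_idx [simp]: "finite {I::'n::finite list. length I = p}"
  using finite_lists_length_eq[of "UNIV :: 'n set" p] by simp

lemma sum_idx_0 [simp]: "(\<Sum>I | length I = 0. F I) = F []"
proof -
  have "{I. length I = 0} = {[]}" by auto
  then show ?thesis by simp
qed

lemma sum_idx_Suc:
  "(\<Sum>I::'n::finite list | length I = Suc p. F I) = (\<Sum>i\<in>UNIV. \<Sum>I | length I = p. F (i # I))"
proof -
  have "{I::'n list. length I = Suc p} = (\<lambda>(i, I). i # I) ` (UNIV \<times> {I. length I = p})"
    by (auto simp: length_Suc_conv)
  then have "(\<Sum>I::'n list | length I = Suc p. F I)
      = (\<Sum>x\<in>UNIV \<times> {I. length I = p}. F ((\<lambda>(i, I). i # I) x))"
    by (simp add: sum.reindex inj_on_def)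
  then show ?thesis
    by (simp add: sum.cartesian_product case_prod_unfold)
qed

text \<open>Exchanging the dummy \<open>m\<close> with the entry in slot \<open>k\<close> is an
  involution on the pairs \<open>(J, m)\<close>. This is the renaming that moves a Christoffel
  symbol from one factor of a contraction to another.\<close>

lemma sum_idx_slot:
  fixes F :: "'n::finite list \<Rightarrow> 'n \<Rightarrow> real"
  assumes "k < p"
  shows "(\<Sum>J | length J = p. \<Sum>m\<in>UNIV. F J m) = (\<Sum>J | length J = p. \<Sum>m\<in>UNIV. F (J[k := m]) (J ! k))"
  unfolding sum.cartesian_product
  by (rule sum.reindex_bij_witness[of _ "\<lambda>(J, m). (J[k := m], J ! k)" "\<lambda>(J, m). (J[k := m], J ! k)"])
    (use assms in auto)

lemma length_lswap [simp]: "length (lswap a b I) = length I"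
  by (simp add: lswap_def)

lemma nth_lswap:
  "a < length I \<Longrightarrow> b < length I \<Longrightarrow> k < length I \<Longrightarrow> lswap a b I ! k = I ! Transposition.transpose a b k"
  by (auto simp: lswap_def nth_list_update Transposition.transpose_def)

lemma mset_lswap: "a < length I \<Longrightarrow> b < length I \<Longrightarrow> mset (lswap a b I) = mset I"
  by (simp add: lswap_def mset_swap)

lemma transpose_less: "a < p \<Longrightarrow> b < p \<Longrightarrow> k < p \<Longrightarrow> Transposition.transpose a b k < (p::nat)"
  by (auto simp: Transposition.transpose_def)

lemma lswap_lswap:
  assumes "a < length I" "b < length I" shows "lswap a b (lswap a b I) = I"
  by (rule nth_equalityI) (use assms in \<open>auto simp: nth_lswap transpose_less\<close>)

lemma lswap_update:
  assumes "a < length I" "b < length I" "k < length I"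
  shows "lswap a b (I[k := m]) = (lswap a b I)[Transposition.transpose a b k := m]"
  by (rule nth_equalityI)
    (use assms in \<open>auto simp: nth_lswap transpose_less nth_list_update transpose_eq_iff\<close>)

lemma lswap_Cons: "k < length I \<Longrightarrow> lswap 0 (Suc k) (i # I) = I ! k # I[k := i]"
  by (simp add: lswap_def)

lemma lswap_0 [simp]: "lswap a a I = I"
  by (simp add: lswap_def)

lemma sum_idx_lswap:
  fixes F :: "'n::finite list \<Rightarrow> real"
  assumes "a < p" "b < p"
  shows "(\<Sum>J | length J = p. F (lswap a b J)) = (\<Sum>J | length J = p. F J)"
  by (rule sum.reindex_bij_witness[of _ "lswap a b" "lswap a b"]) (use assms lswap_lswap in auto)

lemma sum_transpose:
  assumes "a < p" "b < (p::nat)"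
  shows "(\<Sum>k<p. f (Transposition.transpose a b k)) = (\<Sum>k<p. f k)"
  by (rule sum.reindex_bij_witness[of _ "Transposition.transpose a b" "Transposition.transpose a b"])
    (use assms in \<open>auto simp: transpose_less\<close>)

lemma prod_transpose:
  assumes "a < p" "b < (p::nat)"
  shows "(\<Prod>k<p. f (Transposition.transpose a b k)) = (\<Prod>k<p. f k)"
  by (rule prod.reindex_bij_witness[of _ "Transposition.transpose a b" "Transposition.transpose a b"])
    (use assms in \<open>auto simp: transpose_less\<close>)

lemma tpow_0 [simp]: "tpow 0 A I J = 1"
  by (simp add: tpow_def)

lemma tpow_Suc [simp]: "tpow (Suc p) A (i # I) (j # J) = A i j * tpow p A I J"
  by (simp add: tpow_def prod.lessThan_Suc_shift del: prod.lessThan_Suc)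

lemma tpow_lswap:
  assumes "a < p" "b < p" "length I = p" "length J = p"
  shows "tpow p A (lswap a b I) (lswap a b J) = tpow p A I J"
proof -
  have "tpow p A (lswap a b I) (lswap a b J) = (\<Prod>k<p. A (I ! Transposition.transpose a b k) (J ! Transposition.transpose a b k))"
    unfolding tpow_def by (rule prod.cong) (use assms in \<open>auto simp: nth_lswap\<close>)
  also have "\<dots> = tpow p A I J"
    unfolding tpow_def using assms(1,2) by (rule prod_transpose)
  finally show ?thesis .
qed

text \<open>Taking tensor powers is multiplicative, because a sum of products over all lists factors
  into a product of sums, one for each slot.\<close>

lemma tpow_mult:
  fixes A :: "'n \<Rightarrow> 'm::finite \<Rightarrow> real" and B :: "'m \<Rightarrow> 'o \<Rightarrow> real"
  assumes "length I = p" "length K = p"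
  shows "(\<Sum>J | length J = p. tpow p A I J * tpow p B J K) = tpow p (\<lambda>i k. \<Sum>j\<in>UNIV. A i j * B j k) I K"
  using assms
proof (induction p arbitrary: I K)
  case (Suc p)
  obtain i I' k K' where IK: "I = i # I'" "K = k # K'" "length I' = p" "length K' = p"
    using Suc.prems by (auto simp: length_Suc_conv)
  show ?case
    by (simp add: IK sum_idx_Suc sum_product mult_ac flip: Suc.IH[OF IK(3,4)])
qed simp

lemma tpow_remove:
  assumes "r < p"
  shows "tpow p A I J = A (I ! r) (J ! r) * (\<Prod>k\<in>{..<p} - {r}. A (I ! k) (J ! k))"
  using assms unfolding tpow_def by (subst prod.remove[of _ r]) auto

text \<open>The product rule leaves a tensor power with slot \<open>r\<close> removed, multiplied by
  some expression. If that expression is a linear combination of entries, each term is again a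
  tensor power with one index replaced.\<close>

lemma tpow_update_left:
  assumes "r < p" "length I = p"
  shows "tpow p A (I[r := m]) J = A m (J ! r) * (\<Prod>k\<in>{..<p} - {r}. A (I ! k) (J ! k))"
  unfolding tpow_remove[OF assms(1)] using assms by (auto intro!: arg_cong2[where f="(*)"] prod.cong)

lemma tpow_update_right:
  assumes "r < p" "length J = p"
  shows "tpow p A I (J[r := m]) = A (I ! r) m * (\<Prod>k\<in>{..<p} - {r}. A (I ! k) (J ! k))"
  unfolding tpow_remove[OF assms(1)] using assms by (auto intro!: arg_cong2[where f="(*)"] prod.cong)

lemma tpow_flip: "tpow p A I J = tpow p (\<lambda>i j. A j i) J I"
  by (simp add: tpow_def)

section \<open>Linear algebra\<close>

text \<open>If \<open>A B\<close> is the identity then \<open>A (B x) = x\<close>, in the form of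
  nested sums that cancels a metric against its inverse.\<close>

lemma contract_delta:
  fixes A B :: "'n::finite \<Rightarrow> 'n \<Rightarrow> real"
  assumes "\<And>i j. (\<Sum>k\<in>UNIV. A i k * B k j) = (if i = j then 1 else 0)"
  shows "(\<Sum>k\<in>UNIV. A i k * (\<Sum>j\<in>UNIV. B k j * x j)) = x i"
proof -
  have "(\<Sum>k\<in>UNIV. A i k * (\<Sum>j\<in>UNIV. B k j * x j)) = (\<Sum>k\<in>UNIV. \<Sum>j\<in>UNIV. A i k * B k j * x j)"
    by (simp add: sum_distrib_left mult.assoc)
  also have "\<dots> = (\<Sum>j\<in>UNIV. (\<Sum>k\<in>UNIV. A i k * B k j) * x j)"
    by (subst sum.swap) (simp add: sum_distrib_right)
  also have "\<dots> = x i" by (simp add: assms if_distrib[of "\<lambda>z. z * _"] cong: if_cong)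
  finally show ?thesis .
qed

lemma det_pos_definite:
  fixes A :: "real^'n::finite^'n"
  assumes "\<And>v. v \<noteq> 0 \<Longrightarrow> v \<bullet> (A *v v) > 0"
  shows "det A > 0"
proof -
  \<comment> \<open>\<open>det\<close> does not vanish on the segment of positive definite matrices from the identity to \<open>A\<close>.\<close>
  define B where "B t = (1 - t) *\<^sub>R mat 1 + t *\<^sub>R A" for t :: real
  have nz: "det (B t) \<noteq> 0" if t: "0 \<le> t" "t \<le> 1" for t
  proof
    assume "det (B t) = 0"
    then obtain v where v: "v \<noteq> 0" "B t *v v = 0"
      using invertible_det_nz[of "B t"] invertible_left_inverse[of "B t"]
        matrix_left_invertible_ker[of "B t"] by blast
    have "B t *v v = (1 - t) *\<^sub>R v + t *\<^sub>R (A *v v)"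
      by (simp add: B_def matrix_vector_mult_add_rdistrib scaleR_matrix_vector_assoc[symmetric])
    then have "v \<bullet> (B t *v v) = (1 - t) * (v \<bullet> v) + t * (v \<bullet> (A *v v))"
      by (simp add: inner_add_right)
    moreover have "v \<bullet> v > 0" "v \<bullet> (A *v v) > 0" using v assms by auto
    ultimately have "v \<bullet> (B t *v v) > 0"
      using t by (cases "t = 0") (auto intro!: add_nonneg_pos mult_nonneg_nonneg)
    with v show False by simp
  qed
  have cont: "continuous_on {0..1} (\<lambda>t. det (B t))"
    unfolding det_def B_def by (intro continuous_intros)
  show ?thesis
  proof (rule ccontr)
    assume "\<not> det A > 0"
    then have "det (B 1) \<le> 0" "0 \<le> det (B 0)" by (auto simp: B_def)
    from IVT2'[OF this(1) this(2) _ cont] nz show False by force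
  qed
qed

text \<open>Each term of the differentiated Leibniz formula has one factor differentiated and the
  others evaluated at the identity matrix. A permutation other than \<open>id\<close> moves at least
  two indices, so an off-diagonal entry, which is zero, remains undifferentiated.\<close>

lemma pd_det_at_id:
  fixes W :: "real^'n::finite \<Rightarrow> real^'m::finite^'m"
  assumes W: "W y = mat 1" and d: "\<And>i j. (\<lambda>y. W y $ i $ j) differentiable (at y)"
  shows "pd k (\<lambda>y. det (W y)) y = (\<Sum>i\<in>UNIV. pd k (\<lambda>y. W y $ i $ i) y)"
proof -
  let ?P = "{\<pi>. \<pi> permutes (UNIV::'m set)}"
  have dp: "(\<lambda>y. \<Prod>i\<in>UNIV. W y $ i $ \<pi> i) differentiable (at y)" for \<pi>
    by (rule differentiable_prod) (use d in auto)
  have "pd k (\<lambda>y. det (W y)) y = (\<Sum>\<pi>\<in>?P. of_int (sign \<pi>) *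
      (\<Sum>i\<in>UNIV. pd k (\<lambda>y. W y $ i $ \<pi> i) y * (\<Prod>j\<in>UNIV - {i}. W y $ j $ \<pi> j)))"
    unfolding det_def
    by (subst pd_sum) (auto simp: pd_cmult dp pd_prod d)
  also have "\<dots> = (\<Sum>\<pi>\<in>?P. if \<pi> = id then (\<Sum>i\<in>UNIV. pd k (\<lambda>y. W y $ i $ i) y) else 0)"
  proof (rule sum.cong[OF refl])
    fix \<pi> assume "\<pi> \<in> ?P"
    have z: "(\<Prod>j\<in>UNIV - {i}. W y $ j $ \<pi> j) = 0" if nid: "\<pi> \<noteq> id" for i
    proof -
      obtain a where a: "\<pi> a \<noteq> a" using nid by (auto simp: fun_eq_iff)
      have "\<pi> (\<pi> a) \<noteq> \<pi> a" using \<open>\<pi> \<in> ?P\<close> a by (metis mem_Collect_eq permutes_inverses(2))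
      then obtain j where "j \<noteq> i" "\<pi> j \<noteq> j" using a by metis
      then have "W y $ j $ \<pi> j = 0" by (simp add: W mat_def)
      then show ?thesis using \<open>j \<noteq> i\<close> by (intro prod_zero) auto
    qed
    have o: "(\<Prod>j\<in>UNIV - {i}. W y $ j $ j) = 1" for i
      by (simp add: W mat_def)
    show "of_int (sign \<pi>) *
        (\<Sum>i\<in>UNIV. pd k (\<lambda>y. W y $ i $ \<pi> i) y * (\<Prod>j\<in>UNIV - {i}. W y $ j $ \<pi> j))
        = (if \<pi> = id then (\<Sum>i\<in>UNIV. pd k (\<lambda>y. W y $ i $ i) y) else 0)"
      by (cases "\<pi> = id") (simp_all add: z o sign_id)
  qed
  also have "\<dots> = (\<Sum>i\<in>UNIV. pd k (\<lambda>y. W y $ i $ i) y)"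
    by (simp add: permutes_id)
  finally show ?thesis .
qed

lemma pd_det:
  fixes V :: "real^'n::finite \<Rightarrow> real^'m::finite^'m"
  assumes d: "\<And>i j. (\<lambda>y. V y $ i $ j) differentiable (at y)" and inv: "C ** V y = mat 1"
  shows "pd k (\<lambda>y. det (V y)) y = det (V y) * (\<Sum>i\<in>UNIV. \<Sum>j\<in>UNIV. C $ i $ j * pd k (\<lambda>y. V y $ j $ i) y)"
proof -
  \<comment> \<open>\<open>det (V z) = det (V y) * det (C ** V z)\<close>, and the derivative of \<open>det\<close> at the identity is the trace.\<close>
  have "V y ** C = mat 1" using inv matrix_left_right_inverse by blast
  then have eq: "det (V z) = det (V y) * det (C ** V z)" for z
    by (metis det_I det_mul inv mult.commute mult.left_commute mult.right_neutral)
  have dC: "(\<lambda>z. (C ** V z) $ i $ j) differentiable (at y)" for i j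
    unfolding matrix_matrix_mult_def
    by (auto intro!: differentiable_sum differentiable_mult d)
  have dd: "(\<lambda>z. det (C ** V z)) differentiable (at y)"
    unfolding det_def
    by (intro differentiable_sum differentiable_mult) (auto intro!: differentiable_prod dC)
  have "pd k (\<lambda>z. det (V z)) y = pd k (\<lambda>z. det (V y) * det (C ** V z)) y"
    by (subst eq) simp
  also have "\<dots> = det (V y) * (\<Sum>i\<in>UNIV. pd k (\<lambda>z. (C ** V z) $ i $ i) y)"
    by (subst pd_cmult[OF dd], subst pd_det_at_id) (use inv dC in auto)
  also have "(\<Sum>i\<in>UNIV. pd k (\<lambda>z. (C ** V z) $ i $ i) y)
      = (\<Sum>i\<in>UNIV. \<Sum>j\<in>UNIV. C $ i $ j * pd k (\<lambda>y. V y $ j $ i) y)"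
    unfolding matrix_matrix_mult_def
    by (intro sum.cong refl) (simp add: pd_sum pd_cmult d)
  finally show ?thesis .
qed

lemma matrix_inv_works:
  fixes A :: "real^'n::finite^'n"
  assumes "det A \<noteq> 0"
  shows "A ** matrix_inv A = mat 1 \<and> matrix_inv A ** A = mat 1"
proof -
  have "\<exists>B. A ** B = mat 1 \<and> B ** A = mat 1"
    using assms invertible_det_nz[of A] unfolding invertible_def by blast
  then show ?thesis
    unfolding matrix_inv_def by (rule someI_ex)
qed

text \<open>A quotient of determinants, hence of polynomials in the entries: this is what makes the
  inverse metric smooth.\<close>

lemma matrix_inv_cramer:
  fixes A :: "real^'n::finite^'n"
  assumes "det A \<noteq> 0"
  shows "matrix_inv A $ k $ j = det (\<chi> i l. if l = k then (if i = j then 1 else 0) else A $ i $ l) / det A"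
proof -
  have "A ** matrix_inv A = mat 1"
    using matrix_inv_works[OF assms] by blast
  then have "A *v column j (matrix_inv A) = axis j 1"
    by (simp add: vec_eq_iff matrix_matrix_mult_def matrix_vector_mult_def column_def mat_def axis_def)
  then have "column j (matrix_inv A) = (\<chi> k. det (\<chi> i l. if l = k then axis j 1 $ i else A $ i $ l) / det A)"
    using cramer[OF assms] by simp
  then have "column j (matrix_inv A) $ k = det (\<chi> i l. if l = k then axis j 1 $ i else A $ i $ l) / det A"
    by simp
  moreover have "(axis j 1 :: real^'n) $ i = (if i = j then 1 else 0)" for i
    by (simp add: axis_def)
  ultimately show ?thesis by (simp add: column_def cong: if_cong)
qed

lemma smooth_on_det:
  assumes "open S" "\<And>i j. smooth_on S (\<lambda>y. W y $ i $ j)"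
  shows "smooth_on S (\<lambda>y. det (W y))"
  unfolding det_def by (intro smooth_on_sum smooth_on_mult smooth_on_const smooth_on_prod assms)

section \<open>Riemannian geometry in one chart\<close>

lemma sum_delta_mult [simp]:
  fixes x :: "'n::finite \<Rightarrow> real"
  shows "(\<Sum>k\<in>UNIV. x k * (if k = i then 1 else 0)) = x i"
    and "(\<Sum>k\<in>UNIV. x k * (if i = k then 1 else 0)) = x i"
    and "(\<Sum>k\<in>UNIV. (if k = i then 1 else 0) * x k) = x i"
    and "(\<Sum>k\<in>UNIV. (if i = k then 1 else 0) * x k) = x i"
  by (simp_all add: if_distrib[of "(*) _"] if_distrib[of "\<lambda>z. z * _"] cong: if_cong)

lemma sum_swap3:
  "(\<Sum>k\<in>A. \<Sum>m\<in>B. \<Sum>i\<in>C. f k m i) = (\<Sum>i\<in>C. \<Sum>k\<in>A. \<Sum>m\<in>B. f k m i)"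
proof -
  have "(\<Sum>k\<in>A. \<Sum>m\<in>B. \<Sum>i\<in>C. f k m i) = (\<Sum>k\<in>A. \<Sum>i\<in>C. \<Sum>m\<in>B. f k m i)"
    by (intro sum.cong refl sum.swap)
  also have "\<dots> = (\<Sum>i\<in>C. \<Sum>k\<in>A. \<Sum>m\<in>B. f k m i)"
    by (rule sum.swap)
  finally show ?thesis .
qed

lemma sum_swap4:
  "(\<Sum>k\<in>A. \<Sum>m\<in>B. \<Sum>i\<in>C. \<Sum>j\<in>D. f k m i j) = (\<Sum>i\<in>C. \<Sum>j\<in>D. \<Sum>k\<in>A. \<Sum>m\<in>B. f k m i j)"
  by (subst sum_swap3, intro sum.cong refl, rule sum_swap3)

lemma smooth_on_if: "(P \<Longrightarrow> smooth_on S f) \<Longrightarrow> (\<not> P \<Longrightarrow> smooth_on S h) \<Longrightarrow> smooth_on S (\<lambda>y. if P then f y else h y)"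
  by (cases P) simp_all

lemma nabla_Cons:
  "nabla g \<phi> c (i # I) y = pd i (\<phi> c I) y
     - (\<Sum>k<length I. \<Sum>m\<in>UNIV. christoffel g c m i (I ! k) y * \<phi> c (I[k := m]) y)"
  by (simp add: nabla_def)

lemma nabla_Cons_Cons:
  "nabla g \<psi> c (i # j # I) y = nabla g (\<lambda>c I. \<psi> c (j # I)) c (i # I) y
     - (\<Sum>m\<in>UNIV. christoffel g c m i j y * \<psi> c (m # I) y)"
  by (simp add: nabla_Cons sum.lessThan_Suc_shift del: sum.lessThan_Suc)

definition smooth_comp :: "('a, 'n::finite) chart \<Rightarrow> nat \<Rightarrow> ('a, 'n) field \<Rightarrow> bool" where
  "smooth_comp c p \<phi> \<longleftrightarrow> (\<forall>I. length I = p \<longrightarrow> smooth_on (chart_image c) (\<phi> c I))"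

text \<open>The argument order \<open>j # i\<close> is that of \<open>delta\<close>. Applied to
  \<open>nabla g (nabla g \<phi>)\<close> it is the rough Laplacian, with the sign of a
  trace.\<close>

definition trace2 :: "('a, 'n::finite) field \<Rightarrow> ('a, 'n) field \<Rightarrow> ('a, 'n) field" where
  "trace2 g \<psi> c I y = (\<Sum>i\<in>UNIV. \<Sum>j\<in>UNIV. ginv g c i j y * \<psi> c (j # i # I) y)"

text \<open>A metric on one open coordinate domain, detached from any manifold: the setting for all
  pointwise identities.\<close>

locale chart_metric =
  fixes g :: "('a, 'n::finite) field" and c :: "('a, 'n) chart"
  assumes open_S: "open (chart_image c)"
    and smooth_g: "\<And>i j. smooth_on (chart_image c) (g c [i, j])"
    and sym_g: "\<And>i j y. y \<in> chart_image c \<Longrightarrow> g c [i, j] y = g c [j, i] y"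
    and pos_g: "\<And>y v. y \<in> chart_image c \<Longrightarrow> v \<noteq> 0 \<Longrightarrow> v \<bullet> (metric_matrix g c y *v v) > 0"
begin

abbreviation "S \<equiv> chart_image c"

lemma det_pos: "y \<in> S \<Longrightarrow> det (metric_matrix g c y) > 0"
  using pos_g det_pos_definite by blast

lemma G_H: "y \<in> S \<Longrightarrow> (\<Sum>k\<in>UNIV. g c [i, k] y * ginv g c k j y) = (if i = j then 1 else 0)"
  and H_G: "y \<in> S \<Longrightarrow> (\<Sum>k\<in>UNIV. ginv g c i k y * g c [k, j] y) = (if i = j then 1 else 0)"
proof -
  assume "y \<in> S"
  then have "det (metric_matrix g c y) \<noteq> 0" using det_pos by force
  note inv = matrix_inv_works[OF this]
  have "(metric_matrix g c y ** matrix_inv (metric_matrix g c y)) $ i $ j = mat 1 $ i $ j"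
    and "(matrix_inv (metric_matrix g c y) ** metric_matrix g c y) $ i $ j = mat 1 $ i $ j"
    using inv by simp_all
  then show "(\<Sum>k\<in>UNIV. g c [i, k] y * ginv g c k j y) = (if i = j then 1 else 0)"
    and "(\<Sum>k\<in>UNIV. ginv g c i k y * g c [k, j] y) = (if i = j then 1 else 0)"
    by (simp_all add: matrix_matrix_mult_def ginv_def metric_matrix_def mat_def)
qed

text \<open>The transpose of the inverse of a symmetric matrix is an inverse as well, and inverses
  are unique.\<close>

lemma H_sym:
  assumes y: "y \<in> S" shows "ginv g c i j y = ginv g c j i y"
proof -
  have "(\<Sum>l\<in>UNIV. g c [k, l] y * ginv g c j l y) = (if j = k then 1 else 0)" for k
    using H_G[OF y, of j k] by (simp add: sym_g[OF y, of k] mult.commute)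
  then show ?thesis
    using contract_delta[OF H_G[OF y], of i "\<lambda>l. ginv g c j l y"] by simp
qed

lemma smooth_H: "smooth_on S (ginv g c i j)"
proof -
  define F where "F y = det (\<chi> a l. if l = i then (if a = j then 1 else 0) else g c [a, l] y)
      / det (metric_matrix g c y)" for y
  have "smooth_on S F"
    unfolding F_def[abs_def] by (intro smooth_on_divide smooth_on_det open_S)
      (use det_pos in \<open>auto simp: less_imp_neq[THEN not_sym], auto simp: metric_matrix_def
          intro!: smooth_g smooth_on_if smooth_on_const open_S\<close>)
  moreover have "F y = ginv g c i j y" if "y \<in> S" for y
    using det_pos[OF that] unfolding ginv_def F_def
    by (subst matrix_inv_cramer) (auto simp: metric_matrix_def cong: if_cong)
  ultimately show ?thesis
    using smooth_on_cong[OF open_S, of F "ginv g c i j"] by blast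
qed

lemma smooth_christoffel: "smooth_on S (christoffel g c k i j)"
  unfolding christoffel_def[abs_def] divide_inverse
  by (intro smooth_on_intros smooth_H smooth_g open_S)

lemma differentiable_g: "y \<in> S \<Longrightarrow> (\<lambda>y. g c [i, j] y) differentiable (at y)"
  and differentiable_H: "y \<in> S \<Longrightarrow> (\<lambda>y. ginv g c i j y) differentiable (at y)"
  and differentiable_christoffel: "y \<in> S \<Longrightarrow> (\<lambda>y. christoffel g c k i j y) differentiable (at y)"
  using smooth_on_differentiable[OF _ open_S] smooth_g smooth_H smooth_christoffel by blast+

lemma pd_sym_g: "y \<in> S \<Longrightarrow> pd k (g c [i, j]) y = pd k (g c [j, i]) y"
  by (rule pd_cong[OF open_S _ sym_g])

lemma christoffel_sym: "y \<in> S \<Longrightarrow> christoffel g c k i j y = christoffel g c k j i y"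
  by (simp add: christoffel_def pd_sym_g[of y _ i j] algebra_simps)

lemma lower_christoffel:
  assumes y: "y \<in> S"
  shows "(\<Sum>m\<in>UNIV. g c [a, m] y * christoffel g c m i j y)
     = (pd i (g c [j, a]) y + pd j (g c [i, a]) y - pd a (g c [i, j]) y) / 2"
  using contract_delta[OF G_H[OF y], of a "\<lambda>l. (pd i (g c [j, l]) y + pd j (g c [i, l]) y - pd l (g c [i, j]) y) / 2"]
  by (simp add: christoffel_def sum_divide_distrib)

text \<open>This is \<nabla>g = 0 written out. Adding the lowered Christoffel symbols with
  \<open>i\<close> and \<open>j\<close> exchanged doubles the half of the \<open>k\<close>
  derivative, and the other derivatives cancel in pairs.\<close>

lemma metric_compat:
  assumes y: "y \<in> S"
  shows "pd k (g c [i, j]) y = (\<Sum>m\<in>UNIV. g c [m, j] y * christoffel g c m k i y)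
    + (\<Sum>m\<in>UNIV. g c [i, m] y * christoffel g c m k j y)"
  using lower_christoffel[OF y, of j k i] lower_christoffel[OF y, of i k j]
  by (simp add: sym_g[OF y, of _ j] pd_sym_g[OF y, of _ _ i] pd_sym_g[OF y, of _ k j] field_simps)

text \<open>The inverse metric is parallel too. Differentiating \<open>G H = 1\<close> gives
  \<open>G (pd H) = - (pd G) H\<close>; metric compatibility replaces \<open>pd G\<close>, and
  contraction with \<open>H\<close> isolates \<open>pd H\<close>.\<close>

lemma pd_H:
  assumes y: "y \<in> S"
  shows "pd k (ginv g c i j) y = - (\<Sum>m\<in>UNIV. christoffel g c i k m y * ginv g c m j y)
    - (\<Sum>m\<in>UNIV. christoffel g c j k m y * ginv g c i m y)"
proof -
  let ?D = "\<lambda>l. pd k (ginv g c l j) y"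
  have "(\<Sum>l\<in>UNIV. g c [a, l] y * ?D l) = - (\<Sum>l\<in>UNIV. pd k (g c [a, l]) y * ginv g c l j y)" for a
  proof -
    have "pd k (\<lambda>y. \<Sum>l\<in>UNIV. g c [a, l] y * ginv g c l j y) y = pd k (\<lambda>y. if a = j then 1 else 0) y"
      by (rule pd_cong[OF open_S y G_H])
    moreover have "pd k (\<lambda>y. \<Sum>l\<in>UNIV. g c [a, l] y * ginv g c l j y) y
        = (\<Sum>l\<in>UNIV. pd k (g c [a, l]) y * ginv g c l j y) + (\<Sum>l\<in>UNIV. g c [a, l] y * ?D l)"
      by (subst pd_sum) (auto simp: pd_mult differentiable_g differentiable_H y sum.distrib)
    ultimately show ?thesis by simp
  qed
  moreover have "(\<Sum>l\<in>UNIV. pd k (g c [a, l]) y * ginv g c l j y)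
      = christoffel g c j k a y
        + (\<Sum>m\<in>UNIV. g c [a, m] y * (\<Sum>l\<in>UNIV. christoffel g c m k l y * ginv g c l j y))" for a
  proof -
    have "(\<Sum>l\<in>UNIV. (\<Sum>m\<in>UNIV. g c [m, l] y * christoffel g c m k a y) * ginv g c l j y)
        = (\<Sum>m\<in>UNIV. christoffel g c m k a y * (\<Sum>l\<in>UNIV. g c [m, l] y * ginv g c l j y))"
      unfolding sum_distrib_left sum_distrib_right by (subst sum.swap) (simp add: mult_ac)
    also have "\<dots> = christoffel g c j k a y"
      by (simp add: G_H[OF y])
    finally have 1: "(\<Sum>l\<in>UNIV. (\<Sum>m\<in>UNIV. g c [m, l] y * christoffel g c m k a y) * ginv g c l j y)
        = christoffel g c j k a y" .
    have 2: "(\<Sum>l\<in>UNIV. (\<Sum>m\<in>UNIV. g c [a, m] y * christoffel g c m k l y) * ginv g c l j y)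
        = (\<Sum>m\<in>UNIV. g c [a, m] y * (\<Sum>l\<in>UNIV. christoffel g c m k l y * ginv g c l j y))"
      unfolding sum_distrib_left sum_distrib_right by (subst sum.swap) (simp add: mult_ac)
    show ?thesis
      by (simp add: metric_compat[OF y, of k a] distrib_right sum.distrib 1 2)
  qed
  ultimately have "(\<Sum>l\<in>UNIV. g c [a, l] y * ?D l) = - christoffel g c j k a y
      - (\<Sum>m\<in>UNIV. g c [a, m] y * (\<Sum>l\<in>UNIV. christoffel g c m k l y * ginv g c l j y))" for a
    by simp
  then have "?D i = (\<Sum>a\<in>UNIV. ginv g c i a y * (- christoffel g c j k a y
      - (\<Sum>m\<in>UNIV. g c [a, m] y * (\<Sum>l\<in>UNIV. christoffel g c m k l y * ginv g c l j y))))"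
    using contract_delta[OF H_G[OF y], of i ?D] by simp
  also have "\<dots> = - (\<Sum>m\<in>UNIV. christoffel g c j k m y * ginv g c i m y)
      - (\<Sum>l\<in>UNIV. christoffel g c i k l y * ginv g c l j y)"
    by (simp add: right_diff_distrib sum_subtractf contract_delta[OF H_G[OF y]] sum_negf mult.commute)
  finally show ?thesis by simp
qed

lemma smooth_compD: "smooth_comp c p \<phi> \<Longrightarrow> length I = p \<Longrightarrow> smooth_on S (\<phi> c I)"
  by (simp add: smooth_comp_def)

lemma smooth_comp_differentiable:
  "smooth_comp c p \<phi> \<Longrightarrow> length I = p \<Longrightarrow> y \<in> S \<Longrightarrow> \<phi> c I differentiable (at y)"
  using smooth_compD smooth_on_differentiable open_S by blast

lemma smooth_comp_nabla: "smooth_comp c p \<phi> \<Longrightarrow> smooth_comp c (Suc p) (nabla g \<phi>)"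
  unfolding smooth_comp_def nabla_def[abs_def]
  by (auto simp: length_Suc_conv intro!: smooth_on_intros smooth_christoffel open_S)

lemma smooth_comp_Cons: "smooth_comp c (Suc p) \<psi> \<Longrightarrow> smooth_comp c p (\<lambda>c I. \<psi> c (j # I))"
  by (simp add: smooth_comp_def)

lemma nabla_cong:
  assumes "\<And>I z. length I = p \<Longrightarrow> z \<in> S \<Longrightarrow> \<phi> c I z = \<psi> c I z" "length I = Suc p" "y \<in> S"
  shows "nabla g \<phi> c I y = nabla g \<psi> c I y"
proof -
  obtain i J where "I = i # J" "length J = p" using assms(2) by (auto simp: length_Suc_conv)
  moreover from this have "pd i (\<phi> c J) y = pd i (\<psi> c J) y"
    using assms by (intro pd_cong[OF open_S]) auto
  ultimately show ?thesis using assms by (simp add: nabla_Cons)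
qed

lemma nabla_sum:
  assumes "\<And>a. a \<in> X \<Longrightarrow> smooth_comp c p (\<phi> a)" "length I = Suc p" "y \<in> S"
  shows "nabla g (\<lambda>c I y. \<Sum>a\<in>X. \<phi> a c I y) c I y = (\<Sum>a\<in>X. nabla g (\<phi> a) c I y)"
proof -
  obtain i J where J: "I = i # J" "length J = p" using assms(2) by (auto simp: length_Suc_conv)
  have "(\<Sum>k<p. \<Sum>m\<in>UNIV. christoffel g c m i (J ! k) y * (\<Sum>a\<in>X. \<phi> a c (J[k := m]) y))
      = (\<Sum>a\<in>X. \<Sum>k<p. \<Sum>m\<in>UNIV. christoffel g c m i (J ! k) y * \<phi> a c (J[k := m]) y)"
    by (simp add: sum_distrib_left sum.swap[of _ X])
  moreover have "pd i (\<lambda>y. \<Sum>a\<in>X. \<phi> a c J y) y = (\<Sum>a\<in>X. pd i (\<phi> a c J) y)"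
    by (rule pd_sum) (use assms J smooth_comp_differentiable in blast)
  ultimately show ?thesis
    using J by (simp add: nabla_Cons sum_subtractf)
qed

lemma nabla_minus:
  assumes "smooth_comp c p \<phi>" "length I = Suc p" "y \<in> S"
  shows "nabla g (\<lambda>c I y. - \<phi> c I y) c I y = - nabla g \<phi> c I y"
proof -
  obtain i J where J: "I = i # J" "length J = p" using assms(2) by (auto simp: length_Suc_conv)
  then show ?thesis
    using assms
    by (simp add: nabla_Cons pd_minus smooth_comp_differentiable sum_negf)
qed

text \<open>A transposition of slots permutes the Christoffel corrections among themselves, so
  covariant differentiation commutes with it. The differentiation index stays in front.\<close>

lemma nabla_lswap:
  assumes "a < p" "b < p" "length I = p"
  shows "nabla g (\<lambda>c I. \<phi> c (lswap a b I)) c (i # I) y = nabla g \<phi> c (i # lswap a b I) y"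
proof -
  have "(\<Sum>k<p. \<Sum>m\<in>UNIV. christoffel g c m i (I ! k) y * \<phi> c (lswap a b (I[k := m])) y)
      = (\<Sum>k<p. \<Sum>m\<in>UNIV. christoffel g c m i (lswap a b I ! Transposition.transpose a b k) y
          * \<phi> c ((lswap a b I)[Transposition.transpose a b k := m]) y)"
    using assms by (intro sum.cong refl) (simp add: nth_lswap transpose_less lswap_update)
  also have "\<dots> = (\<Sum>k<p. \<Sum>m\<in>UNIV. christoffel g c m i (lswap a b I ! k) y * \<phi> c ((lswap a b I)[k := m]) y)"
    using assms(1,2) by (rule sum_transpose)
  finally show ?thesis using assms by (simp add: nabla_Cons)
qed

lemma smooth_comp_trace2: "smooth_comp c (Suc (Suc p)) \<psi> \<Longrightarrow> smooth_comp c p (trace2 g \<psi>)"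
  unfolding smooth_comp_def trace2_def[abs_def]
  by (auto intro!: smooth_on_intros smooth_H open_S)

text \<open>Traces commute with covariant differentiation because the inverse metric is parallel: by
  \<open>pd_H\<close> the derivative of \<open>ginv\<close> supplies exactly the Christoffel
  corrections of the two traced slots.\<close>

lemma nabla_trace2:
  assumes sm: "smooth_comp c (Suc (Suc p)) \<psi>" and I: "length I = p" and y: "y \<in> S"
  shows "nabla g (trace2 g \<psi>) c (l # I) y
     = (\<Sum>i\<in>UNIV. \<Sum>j\<in>UNIV. ginv g c i j y * nabla g \<psi> c (l # j # i # I) y)"
proof -
  have d: "\<psi> c (j # i # I) differentiable (at y)" for i j
    using smooth_comp_differentiable[OF sm] I y by simp
  have "pd l (trace2 g \<psi> c I) y = (\<Sum>i\<in>UNIV. \<Sum>j\<in>UNIV. pd l (ginv g c i j) y * \<psi> c (j # i # I) y)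
      + (\<Sum>i\<in>UNIV. \<Sum>j\<in>UNIV. ginv g c i j y * pd l (\<psi> c (j # i # I)) y)"
    unfolding trace2_def[abs_def]
    by (simp add: pd_sum pd_mult d differentiable_H y sum.distrib)
  moreover have "(\<Sum>i\<in>UNIV. \<Sum>j\<in>UNIV. pd l (ginv g c i j) y * \<psi> c (j # i # I) y)
      = - (\<Sum>i\<in>UNIV. \<Sum>j\<in>UNIV. ginv g c i j y * (\<Sum>m\<in>UNIV. christoffel g c m l i y * \<psi> c (j # m # I) y))
        - (\<Sum>i\<in>UNIV. \<Sum>j\<in>UNIV. ginv g c i j y * (\<Sum>m\<in>UNIV. christoffel g c m l j y * \<psi> c (m # i # I) y))"
  proof -
    have "(\<Sum>i\<in>UNIV. \<Sum>j\<in>UNIV. (\<Sum>m\<in>UNIV. christoffel g c i l m y * ginv g c m j y) * \<psi> c (j # i # I) y)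
        = (\<Sum>i\<in>UNIV. \<Sum>m\<in>UNIV. \<Sum>j\<in>UNIV. ginv g c m j y * (christoffel g c i l m y * \<psi> c (j # i # I) y))"
      by (rule sum.cong[OF refl], unfold sum_distrib_right, subst sum.swap) (simp add: mult_ac)
    also have "\<dots> = (\<Sum>m\<in>UNIV. \<Sum>i\<in>UNIV. \<Sum>j\<in>UNIV. ginv g c m j y * (christoffel g c i l m y * \<psi> c (j # i # I) y))"
      by (rule sum.swap)
    also have "\<dots> = (\<Sum>m\<in>UNIV. \<Sum>j\<in>UNIV. \<Sum>i\<in>UNIV. ginv g c m j y * (christoffel g c i l m y * \<psi> c (j # i # I) y))"
      by (intro sum.cong refl sum.swap)
    finally have 1: "(\<Sum>i\<in>UNIV. \<Sum>j\<in>UNIV. (\<Sum>m\<in>UNIV. christoffel g c i l m y * ginv g c m j y) * \<psi> c (j # i # I) y)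
      = (\<Sum>i\<in>UNIV. \<Sum>j\<in>UNIV. ginv g c i j y * (\<Sum>m\<in>UNIV. christoffel g c m l i y * \<psi> c (j # m # I) y))"
      by (simp add: sum_distrib_left)
    have "(\<Sum>i\<in>UNIV. \<Sum>j\<in>UNIV. (\<Sum>m\<in>UNIV. christoffel g c j l m y * ginv g c i m y) * \<psi> c (j # i # I) y)
        = (\<Sum>i\<in>UNIV. \<Sum>m\<in>UNIV. \<Sum>j\<in>UNIV. ginv g c i m y * (christoffel g c j l m y * \<psi> c (j # i # I) y))"
      by (rule sum.cong[OF refl], unfold sum_distrib_right, subst sum.swap) (simp add: mult_ac)
    then have 2: "(\<Sum>i\<in>UNIV. \<Sum>j\<in>UNIV. (\<Sum>m\<in>UNIV. christoffel g c j l m y * ginv g c i m y) * \<psi> c (j # i # I) y)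
      = (\<Sum>i\<in>UNIV. \<Sum>j\<in>UNIV. ginv g c i j y * (\<Sum>m\<in>UNIV. christoffel g c m l j y * \<psi> c (m # i # I) y))"
      by (simp add: sum_distrib_left)
    show ?thesis
      by (simp add: pd_H[OF y] left_diff_distrib sum_subtractf sum_negf 1 2)
  qed
  moreover have "(\<Sum>k<p. \<Sum>m\<in>UNIV. christoffel g c m l (I ! k) y * trace2 g \<psi> c (I[k := m]) y)
      = (\<Sum>i\<in>UNIV. \<Sum>j\<in>UNIV. ginv g c i j y *
          (\<Sum>k<p. \<Sum>m\<in>UNIV. christoffel g c m l (I ! k) y * \<psi> c (j # i # I[k := m]) y))"
    unfolding trace2_def sum_distrib_left by (subst sum_swap4) (simp add: mult_ac)
  ultimately show ?thesis
    using I
    by (simp add: nabla_Cons sum.lessThan_Suc_shift algebra_simps sum_subtractf sum.distrib sum_negf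
        del: sum.lessThan_Suc)
qed

end

section \<open>Full contraction of two tensors and its derivative\<close>

definition tdot ::
    "('a, 'n::finite) field \<Rightarrow> nat \<Rightarrow> ('a, 'n) field \<Rightarrow> ('a, 'n) field \<Rightarrow> ('a, 'n) chart \<Rightarrow> real^'n \<Rightarrow> real" where
  "tdot g p \<phi> \<psi> c y =
     (\<Sum>I | length I = p. \<Sum>J | length J = p. tpow p (\<lambda>i j. ginv g c i j y) I J * \<phi> c J y * \<psi> c I y)"

lemma raise_all: "length I = p \<Longrightarrow>
    raise g p \<phi> c I y = (\<Sum>J | length J = p. tpow p (\<lambda>i j. ginv g c i j y) I J * \<phi> c J y)"
  by (simp add: raise_def tpow_def)

lemma tdot_raise: "(\<Sum>I | length I = p. raise g p \<phi> c I y * \<psi> c I y) = tdot g p \<phi> \<psi> c y"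
  by (simp add: tdot_def raise_all sum_distrib_right)

lemma tdot_Suc:
  "tdot g (Suc p) \<phi> \<psi> c y
    = (\<Sum>i\<in>UNIV. \<Sum>j\<in>UNIV. ginv g c i j y * tdot g p (\<lambda>c J. \<phi> c (j # J)) (\<lambda>c J. \<psi> c (i # J)) c y)"
  unfolding tdot_def sum_idx_Suc tpow_Suc sum_distrib_left
  by (intro sum.cong[OF refl], subst sum.swap) (simp add: mult.assoc)

lemma tdot_add_left: "tdot g p (\<lambda>c J y. \<phi> c J y + \<phi>' c J y) \<psi> c y = tdot g p \<phi> \<psi> c y + tdot g p \<phi>' \<psi> c y"
  by (simp add: tdot_def algebra_simps sum.distrib)

lemma tdot_sum_left: "tdot g p (\<lambda>c J y. \<Sum>a\<in>X. \<phi> a c J y) \<psi> c y = (\<Sum>a\<in>X. tdot g p (\<phi> a) \<psi> c y)"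
  unfolding tdot_def sum_distrib_left sum_distrib_right by (rule sum_swap3)

lemma tdot_scale_left: "tdot g p (\<lambda>c J y. a c y * \<phi> c J y) \<psi> c y = a c y * tdot g p \<phi> \<psi> c y"
  unfolding tdot_def sum_distrib_left by (simp add: mult_ac)

lemma tdot_cong:
  "(\<And>J. length J = p \<Longrightarrow> \<phi> c J y = \<phi>' c J y) \<Longrightarrow> (\<And>J. length J = p \<Longrightarrow> \<psi> c J y = \<psi>' c J y)
    \<Longrightarrow> tdot g p \<phi> \<psi> c y = tdot g p \<phi>' \<psi>' c y"
  by (simp add: tdot_def)

lemma sum_offdiag_swap:
  "(\<Sum>r\<in>{..<p::nat}. \<Sum>s\<in>{..<p} - {r}. f r s) = (\<Sum>r\<in>{..<p}. \<Sum>s\<in>{..<p} - {r}. f s r :: real)"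
proof -
  have *: "(\<Sum>r\<in>{..<p}. \<Sum>s\<in>{..<p} - {r}. h r s) = (\<Sum>r\<in>{..<p}. \<Sum>s\<in>{..<p}. if r = s then 0 else h r s)"
    for h :: "nat \<Rightarrow> nat \<Rightarrow> real"
    by (rule sum.cong[OF refl], rule sum.mono_neutral_cong_left) auto
  show ?thesis
    unfolding * by (subst sum.swap) (simp add: eq_commute)
qed

context chart_metric
begin

lemma tdot_sym: "y \<in> S \<Longrightarrow> tdot g p \<phi> \<psi> c y = tdot g p \<psi> \<phi> c y"
  unfolding tdot_def by (subst sum.swap, subst tpow_flip) (simp add: H_sym mult_ac cong: sum.cong)

lemma pd_tpow:
  assumes y: "y \<in> S" and IJ: "length I = p" "length J = p"
  shows "pd k (\<lambda>y. tpow p (\<lambda>i j. ginv g c i j y) I J) y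
    = - (\<Sum>r<p. \<Sum>m\<in>UNIV. christoffel g c (I ! r) k m y * tpow p (\<lambda>i j. ginv g c i j y) (I[r := m]) J)
      - (\<Sum>r<p. \<Sum>m\<in>UNIV. christoffel g c (J ! r) k m y * tpow p (\<lambda>i j. ginv g c i j y) I (J[r := m]))"
    (is "?L = ?R")
proof -
  have "?L = (\<Sum>r<p. pd k (ginv g c (I ! r) (J ! r)) y * (\<Prod>l\<in>{..<p} - {r}. ginv g c (I ! l) (J ! l) y))"
    unfolding tpow_def by (rule pd_prod) (auto intro: differentiable_H y)
  also have "\<dots> = ?R"
    using IJ by (simp add: pd_H[OF y] tpow_update_left tpow_update_right left_diff_distrib
        sum_subtractf sum_negf sum_distrib_right mult.assoc)
  finally show ?thesis .
qed

lemma differentiable_tpow: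
  "y \<in> S \<Longrightarrow> (\<lambda>y. tpow p (\<lambda>i j. ginv g c i j y) I J) differentiable (at y)"
  unfolding tpow_def by (rule differentiable_prod) (auto intro: differentiable_H)

text \<open>Leibniz rule for a metric connection. Differentiating the inverse metrics gives
  Christoffel symbols on the slots of \<open>I\<close> and \<open>J\<close>; renaming dummies turns
  them into the corrections missing in the covariant derivatives of \<open>\<psi>\<close> and
  \<open>\<phi>\<close>.\<close>

lemma pd_tdot:
  assumes \<phi>: "smooth_comp c p \<phi>" and \<psi>: "smooth_comp c p \<psi>" and y: "y \<in> S"
  shows "pd k (tdot g p \<phi> \<psi> c) y
    = tdot g p (\<lambda>c J. nabla g \<phi> c (k # J)) \<psi> c y + tdot g p \<phi> (\<lambda>c J. nabla g \<psi> c (k # J)) c y"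
proof -
  let ?X = "{I::'n list. length I = p}"
  let ?T = "\<lambda>I J. tpow p (\<lambda>i j. ginv g c i j y) I J"
  let ?\<Gamma> = "\<lambda>m i. christoffel g c m k i y"
  have d: "\<phi> c J differentiable (at y)" "\<psi> c J differentiable (at y)" if "length J = p" for J
    using smooth_comp_differentiable that \<phi> \<psi> y by blast+
  have "pd k (tdot g p \<phi> \<psi> c) y
      = (\<Sum>I\<in>?X. \<Sum>J\<in>?X. pd k (\<lambda>y. tpow p (\<lambda>i j. ginv g c i j y) I J * \<phi> c J y * \<psi> c I y) y)"
    unfolding tdot_def[abs_def]
    by (subst pd_sum, force intro!: differentiable_sum differentiable_mult d differentiable_tpow y,
        rule sum.cong[OF refl], rule pd_sum, force intro!: differentiable_mult d differentiable_tpow y)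
  also have "\<dots> = (\<Sum>I\<in>?X. \<Sum>J\<in>?X. pd k (\<lambda>y. tpow p (\<lambda>i j. ginv g c i j y) I J) y * \<phi> c J y * \<psi> c I y)
        + (\<Sum>I\<in>?X. \<Sum>J\<in>?X. ?T I J * pd k (\<phi> c J) y * \<psi> c I y)
        + (\<Sum>I\<in>?X. \<Sum>J\<in>?X. ?T I J * \<phi> c J y * pd k (\<psi> c I) y)"
    by (simp add: pd_mult d differentiable_tpow y sum.distrib distrib_right)
  finally have "pd k (tdot g p \<phi> \<psi> c) y = \<dots>" .
  \<comment> \<open>\<open>sum_idx_slot\<close> exchanges \<open>m\<close> with the entry in slot
    \<open>r\<close> of \<open>J\<close>, which moves the Christoffel symbol from the inverse
    metrics to \<open>\<phi>\<close>. The next step does the same for \<open>I\<close> and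
    \<open>\<psi>\<close>.\<close>
  moreover have "(\<Sum>I\<in>?X. \<Sum>J\<in>?X. (\<Sum>r<p. \<Sum>m\<in>UNIV. ?\<Gamma> (J ! r) m * ?T I (J[r := m])) * \<phi> c J y * \<psi> c I y)
      = (\<Sum>I\<in>?X. \<Sum>J\<in>?X. ?T I J * (\<Sum>r<p. \<Sum>m\<in>UNIV. ?\<Gamma> m (J ! r) * \<phi> c (J[r := m]) y) * \<psi> c I y)"
  proof (rule sum.cong[OF refl])
    fix I
    have "(\<Sum>J\<in>?X. (\<Sum>r<p. \<Sum>m\<in>UNIV. ?\<Gamma> (J ! r) m * ?T I (J[r := m])) * \<phi> c J y * \<psi> c I y)
        = (\<Sum>r<p. \<Sum>J\<in>?X. \<Sum>m\<in>UNIV. ?\<Gamma> (J ! r) m * ?T I (J[r := m]) * \<phi> c J y * \<psi> c I y)"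
      by (simp add: sum_distrib_right sum.swap[of _ ?X])
    also have "\<dots> = (\<Sum>r<p. \<Sum>J\<in>?X. \<Sum>m\<in>UNIV. ?\<Gamma> m (J ! r) * ?T I J * \<phi> c (J[r := m]) y * \<psi> c I y)"
      by (rule sum.cong[OF refl], subst sum_idx_slot) auto
    also have "\<dots> = (\<Sum>J\<in>?X. ?T I J * (\<Sum>r<p. \<Sum>m\<in>UNIV. ?\<Gamma> m (J ! r) * \<phi> c (J[r := m]) y) * \<psi> c I y)"
      by (simp add: sum_distrib_right sum_distrib_left sum.swap[of _ ?X] mult_ac)
    finally show "(\<Sum>J\<in>?X. (\<Sum>r<p. \<Sum>m\<in>UNIV. ?\<Gamma> (J ! r) m * ?T I (J[r := m])) * \<phi> c J y * \<psi> c I y) = \<dots>" .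
  qed
  moreover have "(\<Sum>I\<in>?X. \<Sum>J\<in>?X. (\<Sum>r<p. \<Sum>m\<in>UNIV. ?\<Gamma> (I ! r) m * ?T (I[r := m]) J) * \<phi> c J y * \<psi> c I y)
      = (\<Sum>I\<in>?X. \<Sum>J\<in>?X. ?T I J * \<phi> c J y * (\<Sum>r<p. \<Sum>m\<in>UNIV. ?\<Gamma> m (I ! r) * \<psi> c (I[r := m]) y))"
    (is "?L = ?R")
  proof -
    have "?L = (\<Sum>J\<in>?X. \<Sum>I\<in>?X. (\<Sum>r<p. \<Sum>m\<in>UNIV. ?\<Gamma> (I ! r) m * ?T (I[r := m]) J) * \<phi> c J y * \<psi> c I y)"
      by (rule sum.swap)
    also have "\<dots> = (\<Sum>J\<in>?X. \<Sum>r<p. \<Sum>I\<in>?X. \<Sum>m\<in>UNIV. ?\<Gamma> (I ! r) m * ?T (I[r := m]) J * \<phi> c J y * \<psi> c I y)"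
      by (simp add: sum_distrib_right sum.swap[of _ "{..<p}" ?X])
    also have "\<dots> = (\<Sum>J\<in>?X. \<Sum>r<p. \<Sum>I\<in>?X. \<Sum>m\<in>UNIV. ?\<Gamma> m (I ! r) * ?T I J * \<phi> c J y * \<psi> c (I[r := m]) y)"
      by (rule sum.cong[OF refl], rule sum.cong[OF refl], subst sum_idx_slot) auto
    also have "\<dots> = (\<Sum>J\<in>?X. \<Sum>I\<in>?X. ?T I J * \<phi> c J y * (\<Sum>r<p. \<Sum>m\<in>UNIV. ?\<Gamma> m (I ! r) * \<psi> c (I[r := m]) y))"
      by (simp add: sum_distrib_right sum_distrib_left sum.swap[of _ "{..<p}" ?X] mult_ac)
    also have "\<dots> = ?R" by (rule sum.swap)
    finally show ?thesis .
  qed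
  moreover have "(\<Sum>I\<in>?X. \<Sum>J\<in>?X. pd k (\<lambda>y. tpow p (\<lambda>i j. ginv g c i j y) I J) y * \<phi> c J y * \<psi> c I y)
     = - (\<Sum>I\<in>?X. \<Sum>J\<in>?X. (\<Sum>r<p. \<Sum>m\<in>UNIV. ?\<Gamma> (I ! r) m * ?T (I[r := m]) J) * \<phi> c J y * \<psi> c I y)
       - (\<Sum>I\<in>?X. \<Sum>J\<in>?X. (\<Sum>r<p. \<Sum>m\<in>UNIV. ?\<Gamma> (J ! r) m * ?T I (J[r := m])) * \<phi> c J y * \<psi> c I y)"
    by (simp add: pd_tpow y left_diff_distrib sum_subtractf sum_negf)
  moreover have "tdot g p (\<lambda>c J. nabla g \<phi> c (k # J)) \<psi> c y = (\<Sum>I\<in>?X. \<Sum>J\<in>?X. ?T I J * pd k (\<phi> c J) y * \<psi> c I y)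
      - (\<Sum>I\<in>?X. \<Sum>J\<in>?X. ?T I J * (\<Sum>r<p. \<Sum>m\<in>UNIV. ?\<Gamma> m (J ! r) * \<phi> c (J[r := m]) y) * \<psi> c I y)"
    by (simp add: tdot_def nabla_Cons left_diff_distrib right_diff_distrib sum_subtractf)
  moreover have "tdot g p \<phi> (\<lambda>c J. nabla g \<psi> c (k # J)) c y = (\<Sum>I\<in>?X. \<Sum>J\<in>?X. ?T I J * \<phi> c J y * pd k (\<psi> c I) y)
      - (\<Sum>I\<in>?X. \<Sum>J\<in>?X. ?T I J * \<phi> c J y * (\<Sum>r<p. \<Sum>m\<in>UNIV. ?\<Gamma> m (I ! r) * \<psi> c (I[r := m]) y))"
    by (simp add: tdot_def nabla_Cons right_diff_distrib sum_subtractf)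
  ultimately show ?thesis by linarith
qed

section \<open>Ricci identity and symmetries of the curvature tensor\<close>

lemma pd_nabla:
  assumes \<phi>: "smooth_comp c p \<phi>" and I: "length I = p" and y: "y \<in> S"
  shows "pd k (nabla g \<phi> c (l # I)) y = pd k (pd l (\<phi> c I)) y
    - ((\<Sum>r<p. \<Sum>m\<in>UNIV. pd k (christoffel g c m l (I ! r)) y * \<phi> c (I[r := m]) y)
     + (\<Sum>r<p. \<Sum>m\<in>UNIV. christoffel g c m l (I ! r) y * pd k (\<phi> c (I[r := m])) y))"
proof -
  have d: "\<phi> c J differentiable (at y)" "pd l (\<phi> c J) differentiable (at y)" if "length J = p" for J
    using smooth_comp_differentiable[OF \<phi> that y] smooth_on_pd smooth_compD[OF \<phi> that]
      smooth_on_differentiable[OF _ open_S y] by blast+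
  have "nabla g \<phi> c (l # I) = (\<lambda>y. pd l (\<phi> c I) y
     - (\<Sum>r<p. \<Sum>m\<in>UNIV. christoffel g c m l (I ! r) y * \<phi> c (I[r := m]) y))"
    using I by (auto simp: nabla_Cons)
  then show ?thesis
    using I y by (simp add: pd_diff pd_sum pd_mult d differentiable_christoffel sum.distrib)
qed

text \<open>After expansion everything symmetric in \<open>k\<close> and \<open>l\<close> drops out:
  the second partial derivatives, the sum \<open>C k l + C l k\<close>, the term \<open>D\<close> by
  torsion-freeness, and the products of Christoffel symbols acting on two different slots. The
  derivatives of Christoffel symbols and their products within one slot remain, and these form
  \<open>riemann_up\<close>.\<close>

lemma ricci_identity:
  assumes \<phi>: "smooth_comp c p \<phi>" and I: "length I = p" and y: "y \<in> S"
  shows "nabla g (nabla g \<phi>) c (k # l # I) y - nabla g (nabla g \<phi>) c (l # k # I) y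
    = - (\<Sum>r<p. \<Sum>m\<in>UNIV. riemann_up g c m (I ! r) k l y * \<phi> c (I[r := m]) y)"
proof -
  let ?\<Gamma> = "\<lambda>m i j. christoffel g c m i j y"
  define B where "B k l = (\<Sum>r<p. \<Sum>m\<in>UNIV. pd k (christoffel g c m l (I ! r)) y * \<phi> c (I[r := m]) y)" for k l
  define C where "C k l = (\<Sum>r<p. \<Sum>m\<in>UNIV. ?\<Gamma> m l (I ! r) * pd k (\<phi> c (I[r := m])) y)" for k l
  define D where "D k l = (\<Sum>m\<in>UNIV. ?\<Gamma> m k l * nabla g \<phi> c (m # I) y)" for k l
  \<comment> \<open>\<open>Q1\<close> collects pairs of Christoffel symbols that act on the same
    slot, \<open>Q2\<close> those that act on distinct slots.\<close>
  define Q1 where "Q1 k l = (\<Sum>r<p. \<Sum>m\<in>UNIV. (\<Sum>s\<in>UNIV. ?\<Gamma> m l s * ?\<Gamma> s k (I ! r)) * \<phi> c (I[r := m]) y)" for k l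
  define Q2 where "Q2 k l = (\<Sum>r<p. \<Sum>s\<in>{..<p} - {r}. \<Sum>m\<in>UNIV. \<Sum>n\<in>UNIV.
      ?\<Gamma> m k (I ! r) * ?\<Gamma> n l (I ! s) * \<phi> c (I[r := m, s := n]) y)" for k l
  have Q: "(\<Sum>r<p. \<Sum>m\<in>UNIV. ?\<Gamma> m k (I ! r) * nabla g \<phi> c (l # I[r := m]) y) = C l k - Q1 k l - Q2 k l" for k l
  proof -
    \<comment> \<open>In \<open>I[r := m]\<close> slot \<open>r\<close> carries the dummy
      \<open>m\<close> and needs separate treatment: a second correction there overwrites
      \<open>m\<close>, whereas corrections in the other slots leave it in place.\<close>
    have n: "nabla g \<phi> c (l # I[r := m]) y = pd l (\<phi> c (I[r := m])) y
        - (\<Sum>n\<in>UNIV. ?\<Gamma> n l m * \<phi> c (I[r := n]) y)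
        - (\<Sum>s\<in>{..<p} - {r}. \<Sum>n\<in>UNIV. ?\<Gamma> n l (I ! s) * \<phi> c (I[r := m, s := n]) y)" if r: "r < p" for r m
    proof -
      have "(\<Sum>s<p. \<Sum>n\<in>UNIV. ?\<Gamma> n l (I[r := m] ! s) * \<phi> c (I[r := m, s := n]) y)
          = (\<Sum>n\<in>UNIV. ?\<Gamma> n l m * \<phi> c (I[r := n]) y)
            + (\<Sum>s\<in>{..<p} - {r}. \<Sum>n\<in>UNIV. ?\<Gamma> n l (I ! s) * \<phi> c (I[r := m, s := n]) y)"
        using r I by (subst sum.remove[of _ r]) auto
      then show ?thesis using I by (simp add: nabla_Cons)
    qed
    have "(\<Sum>m\<in>UNIV. ?\<Gamma> m k (I ! r) * (\<Sum>n\<in>UNIV. ?\<Gamma> n l m * \<phi> c (I[r := n]) y))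
        = (\<Sum>n\<in>UNIV. (\<Sum>m\<in>UNIV. ?\<Gamma> n l m * ?\<Gamma> m k (I ! r)) * \<phi> c (I[r := n]) y)" for r
      unfolding sum_distrib_left sum_distrib_right by (subst sum.swap) (simp add: mult_ac)
    moreover have "(\<Sum>m\<in>UNIV. ?\<Gamma> m k (I ! r) * (\<Sum>s\<in>{..<p} - {r}. \<Sum>n\<in>UNIV. ?\<Gamma> n l (I ! s) * \<phi> c (I[r := m, s := n]) y))
        = (\<Sum>s\<in>{..<p} - {r}. \<Sum>m\<in>UNIV. \<Sum>n\<in>UNIV. ?\<Gamma> m k (I ! r) * ?\<Gamma> n l (I ! s) * \<phi> c (I[r := m, s := n]) y)" for r
      unfolding sum_distrib_left by (subst sum.swap) (simp add: mult_ac)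
    ultimately show ?thesis
      by (simp add: n C_def Q1_def Q2_def right_diff_distrib sum_subtractf)
  qed
  have Q2: "Q2 k l = Q2 l k"
  proof -
    have "Q2 k l = (\<Sum>r<p. \<Sum>s\<in>{..<p} - {r}. \<Sum>m\<in>UNIV. \<Sum>n\<in>UNIV.
      ?\<Gamma> m k (I ! s) * ?\<Gamma> n l (I ! r) * \<phi> c (I[s := m, r := n]) y)"
      unfolding Q2_def by (rule sum_offdiag_swap)
    also have "\<dots> = Q2 l k"
      unfolding Q2_def
      by (rule sum.cong[OF refl], rule sum.cong[OF refl], subst sum.swap)
        (auto intro!: sum.cong simp: list_update_swap mult_ac)
    finally show ?thesis .
  qed
  have nn: "nabla g (nabla g \<phi>) c (k # l # I) y
      = pd k (pd l (\<phi> c I)) y - (B k l + C k l) - D k l - (C l k - Q1 k l - Q2 k l)" for k l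
    using I by (simp add: nabla_Cons[of g "nabla g \<phi>"] sum.lessThan_Suc_shift pd_nabla[OF \<phi> I y] Q
        flip: B_def C_def D_def del: sum.lessThan_Suc)
  have D: "D k l = D l k" by (simp add: D_def christoffel_sym[OF y])
  have "- (\<Sum>r<p. \<Sum>m\<in>UNIV. riemann_up g c m (I ! r) k l y * \<phi> c (I[r := m]) y)
      = - (B k l - B l k + (Q1 l k - Q1 k l))"
    unfolding B_def Q1_def riemann_up_def
    by (simp add: algebra_simps sum.distrib sum_subtractf)
  also have "\<dots> = nabla g (nabla g \<phi>) c (k # l # I) y - nabla g (nabla g \<phi>) c (l # k # I) y"
    unfolding nn Q2 D pd_commute[OF open_S smooth_compD[OF \<phi> I] y, of k l] by simp
  finally show ?thesis by simp
qed

lemma riemann_antisym34: "riemann g c i j k l y = - riemann g c i j l k y"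
  by (simp add: riemann_def riemann_up_def sum_subtractf flip: sum_negf, simp add: algebra_simps)

text \<open>The Ricci identity for the metric itself: its covariant derivative vanishes, so the two
  curvature terms, one for each slot of \<open>g\<close>, add up to zero.\<close>

lemma riemann_antisym12:
  assumes y: "y \<in> S"
  shows "riemann g c i j k l y = - riemann g c j i k l y"
proof -
  have "smooth_comp c 2 g"
    by (auto simp: smooth_comp_def length_Suc_conv numeral_2_eq_2 smooth_g)
  have z: "nabla g g c I y = 0" if "length I = Suc 2" "y \<in> S" for I y
  proof -
    obtain a b d where I: "I = [a, b, d]"
      using \<open>length I = Suc 2\<close> by (auto simp: length_Suc_conv numeral_2_eq_2)
    show ?thesis
      unfolding I by (simp add: nabla_Cons metric_compat[OF \<open>y \<in> S\<close>] mult.commute)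
  qed
  have "nabla g (nabla g g) c (a # b # [j, i]) y = nabla g (\<lambda>_ _ _. 0) c (a # b # [j, i]) y" for a b
    by (rule nabla_cong[of "Suc 2"]) (use z y in auto)
  then have "nabla g (nabla g g) c (a # b # [j, i]) y = 0" for a b
    by (simp add: nabla_Cons)
  with ricci_identity[OF \<open>smooth_comp c 2 g\<close> _ y, of "[j, i]" k l]
  have "(\<Sum>m\<in>UNIV. riemann_up g c m j k l y * g c [m, i] y) + (\<Sum>m\<in>UNIV. riemann_up g c m i k l y * g c [j, m] y) = 0"
    by (simp add: numeral_2_eq_2)
  then show ?thesis
    by (simp add: riemann_def mult.commute sym_g[OF y, of _ i])
qed

text \<open>Since the Christoffel symbols are symmetric below, the cyclic sum of
  \<open>riemann_up\<close> cancels term by term before the index is lowered.\<close>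

lemma riemann_bianchi:
  assumes y: "y \<in> S"
  shows "riemann g c i j k l y + riemann g c i k l j y + riemann g c i l j k y = 0"
proof -
  have "pd a (christoffel g c m b d) y = pd a (christoffel g c m d b) y" for a b d m
    by (rule pd_cong[OF open_S y christoffel_sym])
  note * = this[of _ _ j k] this[of _ _ j l] this[of _ _ k l]
    christoffel_sym[OF y, of _ j k] christoffel_sym[OF y, of _ j l] christoffel_sym[OF y, of _ k l]
  have "riemann_up g c m j k l y + riemann_up g c m k l j y + riemann_up g c m l j k y = 0" for m
    by (simp add: riemann_up_def * sum_subtractf)
  then have "(\<Sum>m\<in>UNIV. g c [i, m] y *
      (riemann_up g c m j k l y + riemann_up g c m k l j y + riemann_up g c m l j k y)) = 0"
    by simp
  then show ?thesis
    by (simp add: riemann_def distrib_left sum.distrib)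
qed

text \<open>The classical derivation: the four Bianchi identities, one for each choice of first
  index, together with the two antisymmetries form a linear system that implies the pair
  symmetry.\<close>

lemma riemann_pair_sym:
  assumes y: "y \<in> S"
  shows "riemann g c i j k l y = riemann g c k l i j y"
  using riemann_bianchi[OF y, of i j k l] riemann_bianchi[OF y, of j k l i]
    riemann_bianchi[OF y, of k l i j] riemann_bianchi[OF y, of l i j k]
    riemann_antisym12[OF y, of i j k l] riemann_antisym12[OF y, of i k l j] riemann_antisym12[OF y, of i l j k]
    riemann_antisym12[OF y, of j k l i] riemann_antisym12[OF y, of j l i k] riemann_antisym12[OF y, of k l i j]
    riemann_antisym34[of i j k l y] riemann_antisym34[of i k l j y] riemann_antisym34[of i l j k y]
    riemann_antisym34[of j i k l y] riemann_antisym34[of j k l i y] riemann_antisym34[of j l i k y]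
    riemann_antisym34[of k l i j y] riemann_antisym34[of k i j l y] riemann_antisym34[of k j l i y]
    riemann_antisym34[of l k i j y] riemann_antisym34[of l i j k y] riemann_antisym34[of l j k i y]
  by linarith

lemma ricci_sym:
  assumes y: "y \<in> S"
  shows "ricci g c i k y = ricci g c k i y"
  unfolding ricci_def
  by (subst sum.swap) (simp add: riemann_pair_sym[OF y, of i] H_sym[OF y])

end

section \<open>The Yano Laplacian of a symmetric tensor in one chart\<close>

definition sym_comp :: "('a, 'n::finite) chart \<Rightarrow> nat \<Rightarrow> ('a, 'n) field \<Rightarrow> bool" where
  "sym_comp c p \<phi> \<longleftrightarrow>
     (\<forall>I J. \<forall>y\<in>chart_image c. length I = p \<longrightarrow> mset I = mset J \<longrightarrow> \<phi> c I y = \<phi> c J y)"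

lemma sym_compD:
  "sym_comp c p \<phi> \<Longrightarrow> y \<in> chart_image c \<Longrightarrow> length I = p \<Longrightarrow> mset I = mset J \<Longrightarrow> \<phi> c I y = \<phi> c J y"
  by (simp add: sym_comp_def)

lemma sum_nth_mset: "(\<Sum>k<length I. f (I ! k)) = sum_mset (image_mset f (mset I))" for f :: "'n \<Rightarrow> real"
proof -
  have "sum_mset (image_mset f (mset I)) = sum_list (map f I)"
    by (metis mset_map sum_mset_sum_list)
  then show ?thesis by (simp add: sum_list_sum_nth atLeast0LessThan)
qed

lemma mset_update_remove:
  "k < length I \<Longrightarrow> mset (I[k := i]) = mset (i # take k I @ drop (Suc k) I)"
  by (simp add: upd_conv_take_nth_drop)

lemma smooth_comp_lswap:
  "smooth_comp c p \<psi> \<Longrightarrow> smooth_comp c p (\<lambda>c I. \<psi> c (lswap a b I))"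
  by (simp add: smooth_comp_def)

lemma delta_trace2: "delta g \<xi> = (\<lambda>c I y. - trace2 g (nabla g \<xi>) c I y)"
  by (simp add: fun_eq_iff delta_def trace2_def)

context chart_metric
begin

lemma nabla_sym:
  assumes \<phi>: "sym_comp c p \<phi>" and y: "y \<in> S" and I: "length I = p" and IJ: "mset I = mset J"
  shows "nabla g \<phi> c (i # I) y = nabla g \<phi> c (i # J) y"
proof -
  have J: "length J = p" using I IJ mset_eq_length by metis
  \<comment> \<open>\<open>\<phi> c (I[k := m])\<close> depends on \<open>I\<close> and \<open>k\<close> only through \<open>mset I\<close> and \<open>I ! k\<close>, so the sum over the
    slots \<open>k\<close> is a sum over the multiset \<open>mset I\<close>.\<close>
  define L where "L a m = (SOME L. mset L = add_mset m (mset I - {#a#}))" for a m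
  have L: "mset (L a m) = add_mset m (mset I - {#a#})" for a m
    unfolding L_def by (rule someI_ex) (rule ex_mset)
  define f where "f a = (\<Sum>m\<in>UNIV. christoffel g c m i a y * \<phi> c (L a m) y)" for a
  have "(\<Sum>k<p. \<Sum>m\<in>UNIV. christoffel g c m i (K ! k) y * \<phi> c (K[k := m]) y) = (\<Sum>k<p. f (K ! k))"
    if K: "length K = p" "mset K = mset I" for K
    unfolding f_def
  proof (intro sum.cong refl arg_cong2[where f="(*)"])
    fix k m assume "k \<in> {..<p}"
    then show "\<phi> c (K[k := m]) y = \<phi> c (L (K ! k) m) y"
      using K by (intro sym_compD[OF \<phi> y]) (auto simp: L mset_update)
  qed
  moreover have "(\<Sum>k<p. f (I ! k)) = (\<Sum>k<p. f (J ! k))"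
    using sum_nth_mset[of f I] sum_nth_mset[of f J] I J IJ by simp
  moreover have "pd i (\<phi> c I) y = pd i (\<phi> c J) y"
    by (rule pd_cong[OF open_S y]) (rule sym_compD[OF \<phi> _ I IJ])
  ultimately show ?thesis using I J IJ by (simp add: nabla_Cons)
qed

lemma nabla2_sym:
  assumes \<phi>: "sym_comp c p \<phi>" and y: "y \<in> S" and I: "length I = p" and IJ: "mset I = mset J"
  shows "nabla g (nabla g \<phi>) c (i # j # I) y = nabla g (nabla g \<phi>) c (i # j # J) y"
proof -
  have "sym_comp c p (\<lambda>c I. nabla g \<phi> c (j # I))"
    unfolding sym_comp_def using nabla_sym[OF \<phi>] by blast
  from nabla_sym[OF this y I IJ] show ?thesis
    using nabla_sym[OF \<phi> y I IJ] by (simp add: nabla_Cons_Cons)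
qed

text \<open>Moving entry \<open>k\<close> to the front and exchanging it with the front entry differ
  only in the order of the slots of \<open>\<phi>\<close>. The second form is the useful one because
  transpositions commute with \<open>nabla\<close>.\<close>

lemma delta_star_lswap:
  assumes \<phi>: "sym_comp c p \<phi>" and y: "y \<in> S" and K: "length K = Suc p"
  shows "delta_star g \<phi> c K y = (\<Sum>k<Suc p. nabla g \<phi> c (lswap 0 k K) y)"
  unfolding delta_star_def K
proof (rule sum.cong[OF refl])
  fix k assume "k \<in> {..<Suc p}"
  obtain i I where I: "K = i # I" "length I = p" using K by (auto simp: length_Suc_conv)
  show "nabla g \<phi> c (K ! k # take k K @ drop (Suc k) K) y = nabla g \<phi> c (lswap 0 k K) y"
  proof (cases k)
    case (Suc r)
    then have r: "r < p" using \<open>k \<in> _\<close> by simp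
    have "mset (i # take r I @ drop (Suc r) I) = mset (I[r := i])"
      using r I by (simp add: mset_update_remove)
    from nabla_sym[OF \<phi> y _ this] show ?thesis
      using r I by (simp add: Suc lswap_Cons)
  qed (simp add: I)
qed

lemma nabla_delta_star:
  assumes \<phi>: "smooth_comp c p \<phi>" "sym_comp c p \<phi>" and y: "y \<in> S" and I: "length I = p"
  shows "nabla g (delta_star g \<phi>) c (j # i # I) y = nabla g (nabla g \<phi>) c (j # i # I) y
    + (\<Sum>k<p. nabla g (nabla g \<phi>) c (j # I ! k # I[k := i]) y)"
proof -
  let ?N = "nabla g \<phi>"
  have "nabla g (delta_star g \<phi>) c (j # i # I) y
      = nabla g (\<lambda>c K y. \<Sum>k<Suc p. ?N c (lswap 0 k K) y) c (j # i # I) y"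
    by (rule nabla_cong[of "Suc p"]) (use delta_star_lswap[OF \<phi>(2)] y I in auto)
  also have "\<dots> = (\<Sum>k<Suc p. nabla g (\<lambda>c K. ?N c (lswap 0 k K)) c (j # i # I) y)"
    by (rule nabla_sum[of _ "Suc p"]) (use smooth_comp_lswap[OF smooth_comp_nabla[OF \<phi>(1)]] y I in auto)
  also have "\<dots> = (\<Sum>k<Suc p. nabla g ?N c (j # lswap 0 k (i # I)) y)"
    by (rule sum.cong[OF refl], rule nabla_lswap[of _ "Suc p"]) (use I in auto)
  finally show ?thesis
    using I by (simp add: sum.lessThan_Suc_shift lswap_Cons del: sum.lessThan_Suc)
qed

text \<open>Deleting slot \<open>k\<close> and tracing in a new front slot amounts, by symmetry of
  \<open>\<phi>\<close>, to tracing in slot \<open>k\<close> itself. This brings both halves of the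
  Yano Laplacian to the same index pattern \<open>I[k := i]\<close>.\<close>

lemma nabla_delta:
  assumes \<phi>: "smooth_comp c p \<phi>" "sym_comp c p \<phi>" and y: "y \<in> S" and I: "length I = p" and k: "k < p"
  shows "nabla g (delta g \<phi>) c (l # take k I @ drop (Suc k) I) y
    = - (\<Sum>i\<in>UNIV. \<Sum>j\<in>UNIV. ginv g c i j y * nabla g (nabla g \<phi>) c (l # j # I[k := i]) y)"
proof -
  obtain q where q: "p = Suc q" using k by (cases p) auto
  let ?K = "take k I @ drop (Suc k) I"
  have K: "length ?K = q" using I k q by simp
  have sm: "smooth_comp c (Suc (Suc q)) (nabla g \<phi>)" using smooth_comp_nabla[OF \<phi>(1)] q by simp
  have "nabla g (delta g \<phi>) c (l # ?K) y = - nabla g (trace2 g (nabla g \<phi>)) c (l # ?K) y"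
    unfolding delta_trace2 by (rule nabla_minus[OF smooth_comp_trace2[OF sm] _ y]) (simp only: length_Cons K)
  also have "\<dots> = - (\<Sum>i\<in>UNIV. \<Sum>j\<in>UNIV. ginv g c i j y * nabla g (nabla g \<phi>) c (l # j # i # ?K) y)"
    by (subst nabla_trace2[OF sm K y]) simp
  finally have "nabla g (delta g \<phi>) c (l # ?K) y
    = - (\<Sum>i\<in>UNIV. \<Sum>j\<in>UNIV. ginv g c i j y * nabla g (nabla g \<phi>) c (l # j # i # ?K) y)" .
  moreover have "nabla g (nabla g \<phi>) c (l # j # i # ?K) y = nabla g (nabla g \<phi>) c (l # j # I[k := i]) y" for i j
    by (rule nabla2_sym[OF \<phi>(2) y]) (use K q I k mset_update_remove[of k I i] in auto)
  ultimately show ?thesis by simp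
qed

text \<open>One summand of \<delta>* differentiates along the slot that \<delta> traces and yields
  the rough Laplacian. Each other summand meets a term of the opposite composition that differs only
  in the order of the two covariant derivatives.\<close>

lemma yano_commutator:
  assumes \<phi>: "smooth_comp c p \<phi>" "sym_comp c p \<phi>" and y: "y \<in> S" and I: "length I = p"
  shows "yano_laplacian g \<phi> c I y = - trace2 g (nabla g (nabla g \<phi>)) c I y
    - (\<Sum>k<p. \<Sum>i\<in>UNIV. \<Sum>j\<in>UNIV. ginv g c i j y * (nabla g (nabla g \<phi>) c (j # I ! k # I[k := i]) y
          - nabla g (nabla g \<phi>) c (I ! k # j # I[k := i]) y))"
proof -
  let ?W = "nabla g (nabla g \<phi>)"
  have "delta g (delta_star g \<phi>) c I y = - trace2 g ?W c I y
      - (\<Sum>i\<in>UNIV. \<Sum>j\<in>UNIV. \<Sum>k<p. ginv g c i j y * ?W c (j # I ! k # I[k := i]) y)"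
    by (simp add: delta_trace2 trace2_def nabla_delta_star[OF \<phi> y I] distrib_left sum.distrib sum_distrib_left)
  also have "(\<Sum>i\<in>UNIV. \<Sum>j\<in>UNIV. \<Sum>k<p. ginv g c i j y * ?W c (j # I ! k # I[k := i]) y)
      = (\<Sum>k<p. \<Sum>i\<in>UNIV. \<Sum>j\<in>UNIV. ginv g c i j y * ?W c (j # I ! k # I[k := i]) y)"
    by (rule sum_swap3)
  finally have "delta g (delta_star g \<phi>) c I y = - trace2 g ?W c I y
      - (\<Sum>k<p. \<Sum>i\<in>UNIV. \<Sum>j\<in>UNIV. ginv g c i j y * ?W c (j # I ! k # I[k := i]) y)" .
  moreover have "delta_star g (delta g \<phi>) c I y
      = - (\<Sum>k<p. \<Sum>i\<in>UNIV. \<Sum>j\<in>UNIV. ginv g c i j y * ?W c (I ! k # j # I[k := i]) y)"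
    using I by (simp add: delta_star_def nabla_delta[OF \<phi> y I] sum_negf)
  ultimately show ?thesis
    by (simp add: yano_laplacian_def right_diff_distrib sum_subtractf)
qed

lemma riemann_up_lower:
  "y \<in> S \<Longrightarrow> riemann_up g c m j k l y = (\<Sum>a\<in>UNIV. ginv g c m a y * riemann g c a j k l y)"
  unfolding riemann_def by (subst contract_delta[OF H_G]) auto

text \<open>The sign arises from \<open>riemann_antisym34\<close>, as the contracted pair here is
  the second and third index of the lowered tensor and \<open>ricci\<close> contracts the second and
  fourth.\<close>

lemma ricci_riemann_up:
  assumes y: "y \<in> S"
  shows "(\<Sum>i\<in>UNIV. \<Sum>j\<in>UNIV. ginv g c i j y * riemann_up g c m i j l y)
     = - (\<Sum>j\<in>UNIV. ginv g c j m y * ricci g c l j y)"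
proof -
  have "(\<Sum>i\<in>UNIV. \<Sum>j\<in>UNIV. ginv g c i j y * riemann_up g c m i j l y)
      = (\<Sum>i\<in>UNIV. \<Sum>j\<in>UNIV. \<Sum>a\<in>UNIV. ginv g c m a y * (ginv g c i j y * riemann g c a i j l y))"
    by (simp add: riemann_up_lower[OF y] sum_distrib_left mult_ac)
  also have "\<dots> = (\<Sum>a\<in>UNIV. ginv g c m a y * (\<Sum>i\<in>UNIV. \<Sum>j\<in>UNIV. ginv g c i j y * riemann g c a i j l y))"
    by (subst sum_swap3) (simp add: sum_distrib_left)
  also have "\<dots> = - (\<Sum>a\<in>UNIV. ginv g c m a y * ricci g c a l y)"
    by (simp add: ricci_def riemann_antisym34[of _ _ _ l] sum_negf)
  finally show ?thesis by (simp add: H_sym[OF y, of m] ricci_sym[OF y, of _ l])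
qed

text \<open>In the Ricci identity for \<open>I[k := i]\<close> the curvature acting on slot
  \<open>k\<close> is traced against its own index \<open>i\<close> and becomes the Ricci term;
  acting on any other slot it gives the Riemann term for that pair of slots.\<close>

lemma B_op_commutator:
  assumes \<phi>: "smooth_comp c p \<phi>" and y: "y \<in> S" and I: "length I = p"
  shows "B_op g \<phi> c I y
    = (\<Sum>k<p. \<Sum>i\<in>UNIV. \<Sum>j\<in>UNIV. ginv g c i j y * (nabla g (nabla g \<phi>) c (j # I ! k # I[k := i]) y
          - nabla g (nabla g \<phi>) c (I ! k # j # I[k := i]) y))"
proof -
  let ?R = "\<lambda>m i j l. riemann_up g c m i j l y"
  have "(\<Sum>i\<in>UNIV. \<Sum>j\<in>UNIV. ginv g c i j y * (nabla g (nabla g \<phi>) c (j # I ! k # I[k := i]) y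
          - nabla g (nabla g \<phi>) c (I ! k # j # I[k := i]) y))
      = (\<Sum>j\<in>UNIV. \<Sum>s\<in>UNIV. ginv g c j s y * ricci g c (I ! k) j y * \<phi> c (I[k := s]) y)
        - (\<Sum>l\<in>{..<p} - {k}. \<Sum>j\<in>UNIV. \<Sum>s\<in>UNIV. \<Sum>m\<in>UNIV. \<Sum>t\<in>UNIV.
            ginv g c j s y * ginv g c m t y * riemann g c (I ! k) j (I ! l) m y * \<phi> c (I[k := s, l := t]) y)"
    (is "?L = ?A - ?B") if k: "k < p" for k
  proof -
    have "nabla g (nabla g \<phi>) c (j # I ! k # I[k := i]) y - nabla g (nabla g \<phi>) c (I ! k # j # I[k := i]) y
        = - (\<Sum>m\<in>UNIV. ?R m i j (I ! k) * \<phi> c (I[k := m]) y)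
          - (\<Sum>r\<in>{..<p} - {k}. \<Sum>m\<in>UNIV. ?R m (I ! r) j (I ! k) * \<phi> c (I[k := i, r := m]) y)" for i j
      using k I by (subst ricci_identity[OF \<phi> _ y]) (auto simp: sum.remove[of _ k])
    then have "?L = - (\<Sum>i\<in>UNIV. \<Sum>j\<in>UNIV. \<Sum>m\<in>UNIV. (ginv g c i j y * ?R m i j (I ! k)) * \<phi> c (I[k := m]) y)
       - (\<Sum>i\<in>UNIV. \<Sum>j\<in>UNIV. \<Sum>r\<in>{..<p} - {k}. \<Sum>m\<in>UNIV. ginv g c i j y * ?R m (I ! r) j (I ! k) * \<phi> c (I[k := i, r := m]) y)"
      by (simp add: right_diff_distrib sum_subtractf sum_negf sum_distrib_left mult.assoc)
    moreover have "(\<Sum>i\<in>UNIV. \<Sum>j\<in>UNIV. \<Sum>m\<in>UNIV. (ginv g c i j y * ?R m i j (I ! k)) * \<phi> c (I[k := m]) y) = - ?A"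
    proof -
      have "(\<Sum>i\<in>UNIV. \<Sum>j\<in>UNIV. \<Sum>m\<in>UNIV. (ginv g c i j y * ?R m i j (I ! k)) * \<phi> c (I[k := m]) y)
          = (\<Sum>m\<in>UNIV. (\<Sum>i\<in>UNIV. \<Sum>j\<in>UNIV. ginv g c i j y * ?R m i j (I ! k)) * \<phi> c (I[k := m]) y)"
        by (subst sum_swap3) (simp add: sum_distrib_right)
      also have "\<dots> = - (\<Sum>m\<in>UNIV. \<Sum>j\<in>UNIV. ginv g c j m y * ricci g c (I ! k) j y * \<phi> c (I[k := m]) y)"
        by (simp add: ricci_riemann_up[OF y] sum_distrib_right sum_negf)
      also have "\<dots> = - ?A" by (subst sum.swap) simp
      finally show ?thesis .
    qed
    moreover have "(\<Sum>i\<in>UNIV. \<Sum>j\<in>UNIV. \<Sum>r\<in>{..<p} - {k}. \<Sum>m\<in>UNIV. ginv g c i j y * ?R m (I ! r) j (I ! k) * \<phi> c (I[k := i, r := m]) y) = ?B"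
    proof -
      have "ginv g c i j y * ?R t (I ! r) j (I ! k) * \<phi> c (I[k := i, r := t]) y
         = (\<Sum>m\<in>UNIV. ginv g c j i y * ginv g c m t y * riemann g c (I ! k) j (I ! r) m y * \<phi> c (I[k := i, r := t]) y)"
        for i j r t
      proof -
        \<comment> \<open>Exchange the two index pairs, then flip each pair; the two signs
          cancel.\<close>
        have "riemann g c a (I ! r) j (I ! k) y = riemann g c (I ! k) j (I ! r) a y" for a
          using riemann_pair_sym[OF y, of a "I ! r" j "I ! k"] riemann_antisym12[OF y, of j "I ! k" a "I ! r"]
            riemann_antisym34[of "I ! k" j "I ! r" a y] by linarith
        then show ?thesis
          by (simp add: riemann_up_lower[OF y] sum_distrib_left sum_distrib_right mult_ac
              H_sym[OF y, of t] H_sym[OF y, of i])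
      qed
      then have "(\<Sum>i\<in>UNIV. \<Sum>j\<in>UNIV. \<Sum>r\<in>{..<p} - {k}. \<Sum>m\<in>UNIV. ginv g c i j y * ?R m (I ! r) j (I ! k) * \<phi> c (I[k := i, r := m]) y)
         = (\<Sum>i\<in>UNIV. \<Sum>j\<in>UNIV. \<Sum>r\<in>{..<p} - {k}. \<Sum>t\<in>UNIV. \<Sum>m\<in>UNIV.
             ginv g c j i y * ginv g c m t y * riemann g c (I ! k) j (I ! r) m y * \<phi> c (I[k := i, r := t]) y)"
        by simp
      also have "\<dots> = (\<Sum>r\<in>{..<p} - {k}. \<Sum>i\<in>UNIV. \<Sum>j\<in>UNIV. \<Sum>t\<in>UNIV. \<Sum>m\<in>UNIV.
             ginv g c j i y * ginv g c m t y * riemann g c (I ! k) j (I ! r) m y * \<phi> c (I[k := i, r := t]) y)"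
        by (rule sum_swap3)
      also have "\<dots> = ?B"
        by (rule sum.cong[OF refl], subst sum.swap, rule sum.cong[OF refl], rule sum.cong[OF refl], rule sum.swap)
      finally show ?thesis .
    qed
    ultimately show ?thesis by simp
  qed
  then show ?thesis
    using I by (simp add: B_op_def sum_subtractf)
qed

lemma yano_pointwise:
  assumes \<phi>: "smooth_comp c p \<phi>" "sym_comp c p \<phi>" and y: "y \<in> S" and I: "length I = p"
  shows "yano_laplacian g \<phi> c I y = - trace2 g (nabla g (nabla g \<phi>)) c I y - B_op g \<phi> c I y"
  by (simp add: yano_commutator[OF \<phi> y I] B_op_commutator[OF \<phi>(1) y I])

section \<open>Divergence in a chart\<close>

abbreviation "vol \<equiv> \<lambda>y. sqrt (det (metric_matrix g c y))"

text \<open>Jacobi's formula for the determinant: the logarithmic derivative of det g is the trace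
  of \<open>ginv\<close> against \<open>pd k g\<close>, which metric compatibility turns into twice
  the contracted Christoffel symbol. The square root halves it.\<close>

lemma pd_vol:
  assumes y: "y \<in> S"
  shows "vol differentiable (at y)" "pd k vol y = vol y * (\<Sum>m\<in>UNIV. christoffel g c m k m y)"
proof -
  let ?det = "\<lambda>y. det (metric_matrix g c y)"
  have pos: "?det y > 0" using det_pos y by blast
  have d: "(\<lambda>y. metric_matrix g c y $ i $ j) differentiable (at y)" for i j
    unfolding metric_matrix_def using differentiable_g[OF y] by simp
  have dd: "?det differentiable (at y)"
    unfolding det_def
    by (intro differentiable_sum differentiable_mult) (auto intro!: differentiable_prod d)
  then have "(?det has_derivative frechet_derivative ?det (at y)) (at y)"
    using frechet_derivative_works by blast
  from has_derivative_real_sqrt[OF pos this]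
  have s: "(vol has_derivative (\<lambda>v. frechet_derivative ?det (at y) v * (inverse (vol y) / 2))) (at y)" .
  show "vol differentiable (at y)" using s differentiable_def by blast
  have "(\<Sum>i\<in>UNIV. \<Sum>j\<in>UNIV. ginv g c i j y * pd k (g c [j, i]) y) = 2 * (\<Sum>m\<in>UNIV. christoffel g c m k m y)"
  proof -
    have "(\<Sum>i\<in>UNIV. \<Sum>j\<in>UNIV. ginv g c i j y * (\<Sum>m\<in>UNIV. g c [m, i] y * christoffel g c m k j y))
        = (\<Sum>j\<in>UNIV. \<Sum>i\<in>UNIV. ginv g c j i y * (\<Sum>m\<in>UNIV. g c [i, m] y * christoffel g c m k j y))"
      by (subst sum.swap) (simp add: H_sym[OF y] sym_g[OF y])
    also have "\<dots> = (\<Sum>m\<in>UNIV. christoffel g c m k m y)"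
      by (simp add: contract_delta[OF H_G[OF y]])
    finally have "(\<Sum>i\<in>UNIV. \<Sum>j\<in>UNIV. ginv g c i j y * (\<Sum>m\<in>UNIV. g c [m, i] y * christoffel g c m k j y))
        = (\<Sum>m\<in>UNIV. christoffel g c m k m y)" .
    moreover have "(\<Sum>i\<in>UNIV. \<Sum>j\<in>UNIV. ginv g c i j y * (\<Sum>m\<in>UNIV. g c [j, m] y * christoffel g c m k i y))
        = (\<Sum>m\<in>UNIV. christoffel g c m k m y)"
      by (simp add: contract_delta[OF H_G[OF y]])
    ultimately show ?thesis
      by (simp add: metric_compat[OF y] distrib_left sum.distrib)
  qed
  moreover have "pd k ?det y = ?det y * (\<Sum>i\<in>UNIV. \<Sum>j\<in>UNIV. ginv g c i j y * pd k (g c [j, i]) y)"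
    using pd_det[OF d, of "matrix_inv (metric_matrix g c y)" k] matrix_inv_works[of "metric_matrix g c y"] pos
    by (simp add: ginv_def metric_matrix_def)
  ultimately have "pd k ?det y = 2 * ?det y * (\<Sum>m\<in>UNIV. christoffel g c m k m y)" by simp
  moreover have "pd k vol y = pd k ?det y * (inverse (vol y) / 2)"
    unfolding pd_eq[OF s] by (simp add: pd_def)
  moreover have "?det y * inverse (vol y) = vol y"
    using pos by (simp add: field_simps flip: power2_eq_square)
  ultimately show "pd k vol y = vol y * (\<Sum>m\<in>UNIV. christoffel g c m k m y)"
    by (simp add: mult_ac)
qed

text \<open>The derivative of \<open>vol\<close> is \<open>vol\<close> times a smooth function, so
  each order of differentiability yields the next.\<close>

lemma smooth_vol: "smooth_on S vol"
  unfolding smooth_on_def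
proof
  fix k show "Ck_on k S vol"
  proof (induction k)
    case 0
    show ?case using pd_vol(1)
      by (auto intro!: differentiable_imp_continuous_on simp: differentiable_on_def differentiable_at_withinI)
  next
    case (Suc k)
    have "Ck_on k S (\<lambda>y. vol y * (\<Sum>m\<in>UNIV. christoffel g c m i m y))" for i
      using smooth_christoffel unfolding smooth_on_def by (intro Ck_on_mult Ck_on_sum open_S Suc) auto
    then have "Ck_on k S (pd i vol)" for i
      by (subst Ck_on_cong[OF open_S pd_vol(2)])
    then show ?case
      using pd_vol(1) by (simp add: differentiable_on_def differentiable_at_withinI)
  qed
qed

text \<open>The divergence formula for a covector \<open>X\<close>, multiplied by the density. The
  contracted Christoffel symbol from \<open>pd k vol\<close> cancels against the derivative of the
  second index of \<open>ginv\<close>; the derivative of the first index is the connection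
  term.\<close>

lemma divergence:
  assumes y: "y \<in> S" and X: "\<And>j. X j differentiable (at y)"
  shows "vol y * (\<Sum>j\<in>UNIV. \<Sum>k\<in>UNIV. ginv g c j k y *
        (pd k (X j) y - (\<Sum>m\<in>UNIV. christoffel g c m k j y * X m y)))
     = (\<Sum>k\<in>UNIV. pd k (\<lambda>y. vol y * (\<Sum>j\<in>UNIV. ginv g c j k y * X j y)) y)"
proof -
  let ?\<Gamma> = "\<lambda>m i j. christoffel g c m i j y"
  let ?H = "\<lambda>i j. ginv g c i j y"
  have dH: "(\<lambda>y. ginv g c j k y * X j y) differentiable (at y)" for j k
    by (intro differentiable_mult differentiable_H y X)
  have "pd k (\<lambda>y. vol y * (\<Sum>j\<in>UNIV. ginv g c j k y * X j y)) y
      = vol y * ((\<Sum>m\<in>UNIV. ?\<Gamma> m k m) * (\<Sum>j\<in>UNIV. ?H j k * X j y)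
          - (\<Sum>j\<in>UNIV. (\<Sum>m\<in>UNIV. ?\<Gamma> j k m * ?H m k) * X j y)
          - (\<Sum>j\<in>UNIV. (\<Sum>m\<in>UNIV. ?\<Gamma> k k m * ?H j m) * X j y)
          + (\<Sum>j\<in>UNIV. ?H j k * pd k (X j) y))" for k
  proof -
    have e1: "pd k (\<lambda>y. vol y * (\<Sum>j\<in>UNIV. ginv g c j k y * X j y)) y
        = pd k vol y * (\<Sum>j\<in>UNIV. ?H j k * X j y) + vol y * pd k (\<lambda>y. \<Sum>j\<in>UNIV. ginv g c j k y * X j y) y"
      by (rule pd_mult) (use pd_vol(1)[OF y] dH in auto)
    have e2: "pd k (\<lambda>y. \<Sum>j\<in>UNIV. ginv g c j k y * X j y) y
        = (\<Sum>j\<in>UNIV. pd k (ginv g c j k) y * X j y) + (\<Sum>j\<in>UNIV. ?H j k * pd k (X j) y)"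
      by (simp add: pd_sum dH pd_mult differentiable_H y X sum.distrib)
    have e3: "(\<Sum>j\<in>UNIV. pd k (ginv g c j k) y * X j y)
        = - (\<Sum>j\<in>UNIV. (\<Sum>m\<in>UNIV. ?\<Gamma> j k m * ?H m k) * X j y)
          - (\<Sum>j\<in>UNIV. (\<Sum>m\<in>UNIV. ?\<Gamma> k k m * ?H j m) * X j y)"
      by (simp add: pd_H[OF y] left_diff_distrib sum_subtractf sum_negf)
    show ?thesis
      unfolding e1 e2 e3 pd_vol(2)[OF y] by (simp add: algebra_simps)
  qed
  moreover have "(\<Sum>k\<in>UNIV. (\<Sum>m\<in>UNIV. ?\<Gamma> m k m) * (\<Sum>j\<in>UNIV. ?H j k * X j y))
      = (\<Sum>k\<in>UNIV. \<Sum>j\<in>UNIV. (\<Sum>m\<in>UNIV. ?\<Gamma> k k m * ?H j m) * X j y)"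
  proof -
    have "(\<Sum>k\<in>UNIV. (\<Sum>m\<in>UNIV. ?\<Gamma> m k m) * (\<Sum>j\<in>UNIV. ?H j k * X j y))
        = (\<Sum>k\<in>UNIV. \<Sum>m\<in>UNIV. \<Sum>j\<in>UNIV. ?\<Gamma> m m k * ?H j k * X j y)"
      by (simp add: sum_product christoffel_sym[OF y, of _ _ _] mult.assoc)
    also have "\<dots> = (\<Sum>m\<in>UNIV. \<Sum>k\<in>UNIV. \<Sum>j\<in>UNIV. ?\<Gamma> m m k * ?H j k * X j y)"
      by (rule sum.swap)
    also have "\<dots> = (\<Sum>m\<in>UNIV. \<Sum>j\<in>UNIV. \<Sum>k\<in>UNIV. ?\<Gamma> m m k * ?H j k * X j y)"
      by (rule sum.cong[OF refl], rule sum.swap)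
    finally show ?thesis by (simp add: sum_distrib_right)
  qed
  moreover have "(\<Sum>k\<in>UNIV. \<Sum>j\<in>UNIV. (\<Sum>m\<in>UNIV. ?\<Gamma> j k m * ?H m k) * X j y)
      = (\<Sum>j\<in>UNIV. \<Sum>k\<in>UNIV. ?H j k * (\<Sum>m\<in>UNIV. ?\<Gamma> m k j * X m y))"
  proof -
    have "(\<Sum>k\<in>UNIV. \<Sum>j\<in>UNIV. (\<Sum>m\<in>UNIV. ?\<Gamma> j k m * ?H m k) * X j y)
        = (\<Sum>k\<in>UNIV. \<Sum>j\<in>UNIV. \<Sum>m\<in>UNIV. ?H m k * (?\<Gamma> j k m * X j y))"
      unfolding sum_distrib_right by (simp add: mult_ac)
    also have "\<dots> = (\<Sum>m\<in>UNIV. \<Sum>k\<in>UNIV. \<Sum>j\<in>UNIV. ?H m k * (?\<Gamma> j k m * X j y))"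
      by (rule sum_swap3)
    finally show ?thesis by (simp add: sum_distrib_left)
  qed
  moreover have "(\<Sum>k\<in>UNIV. \<Sum>j\<in>UNIV. ?H j k * pd k (X j) y) = (\<Sum>j\<in>UNIV. \<Sum>k\<in>UNIV. ?H j k * pd k (X j) y)"
    by (rule sum.swap)
  ultimately show ?thesis
    by (simp add: right_diff_distrib sum_subtractf sum.distrib flip: sum_distrib_left)
qed

text \<open>Here \<open>X\<close> is the gradient of half the squared norm of \<open>\<phi>\<close>.
  One more derivative falls on \<nabla>\<phi>, giving the trace term, or on \<open>\<phi>\<close>,
  giving the squared norm of \<nabla>\<phi>.\<close>

lemma rough_laplacian_divergence:
  assumes \<phi>: "smooth_comp c p \<phi>" and y: "y \<in> S"
  defines "X \<equiv> \<lambda>j. tdot g p (\<lambda>c J. nabla g \<phi> c (j # J)) \<phi> c"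
  shows "(\<Sum>j\<in>UNIV. \<Sum>k\<in>UNIV. ginv g c j k y * (pd k (X j) y - (\<Sum>m\<in>UNIV. christoffel g c m k j y * X m y)))
    = tdot g p (trace2 g (nabla g (nabla g \<phi>))) \<phi> c y + tdot g (Suc p) (nabla g \<phi>) (nabla g \<phi>) c y"
proof -
  let ?W = "nabla g (nabla g \<phi>)"
  have "pd k (X j) y - (\<Sum>m\<in>UNIV. christoffel g c m k j y * X m y)
      = tdot g p (\<lambda>c J. ?W c (k # j # J)) \<phi> c y
        + tdot g p (\<lambda>c J. nabla g \<phi> c (j # J)) (\<lambda>c J. nabla g \<phi> c (k # J)) c y" for j k
  proof -
    have "tdot g p (\<lambda>c J. nabla g (\<lambda>c I. nabla g \<phi> c (j # I)) c (k # J)) \<phi> c y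
        = tdot g p (\<lambda>c J y. ?W c (k # j # J) y + (\<Sum>m\<in>UNIV. christoffel g c m k j y * nabla g \<phi> c (m # J) y)) \<phi> c y"
      by (rule tdot_cong) (simp_all add: nabla_Cons_Cons)
    also have "\<dots> = tdot g p (\<lambda>c J. ?W c (k # j # J)) \<phi> c y + (\<Sum>m\<in>UNIV. christoffel g c m k j y * X m y)"
      unfolding X_def by (simp add: tdot_add_left tdot_sum_left tdot_scale_left)
    finally show ?thesis
      unfolding X_def using smooth_comp_Cons[OF smooth_comp_nabla[OF \<phi>]] \<phi> y by (subst pd_tdot) auto
  qed
  moreover have "tdot g p (trace2 g ?W) \<phi> c y
      = (\<Sum>i\<in>UNIV. \<Sum>j\<in>UNIV. ginv g c i j y * tdot g p (\<lambda>c J. ?W c (j # i # J)) \<phi> c y)"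
    unfolding trace2_def[abs_def] by (simp add: tdot_sum_left tdot_scale_left)
  moreover have "tdot g (Suc p) (nabla g \<phi>) (nabla g \<phi>) c y = (\<Sum>i\<in>UNIV. \<Sum>j\<in>UNIV. ginv g c i j y *
      tdot g p (\<lambda>c J. nabla g \<phi> c (i # J)) (\<lambda>c J. nabla g \<phi> c (j # J)) c y)"
    unfolding tdot_Suc by (simp add: tdot_sym[OF y])
  ultimately show ?thesis
    by (simp add: distrib_left sum.distrib)
qed

end

section \<open>Change of charts\<close>

text \<open>An abstract coordinate change on an open set \<open>U\<close>. The transformation law of
  the metric is the only law assumed; those of the inverse metric and the Christoffel symbols follow
  from it.\<close>

locale chart_change = C: chart_metric g c + D: chart_metric g d
  for g :: "('a, 'n::finite) field" and c d :: "('a, 'n) chart" +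
  fixes U :: "(real^'n) set" and T :: "real^'n \<Rightarrow> real^'n"
  assumes open_U: "open U" and U_c: "U \<subseteq> chart_image c" and T_d: "T ` U \<subseteq> chart_image d"
    and smooth_T: "\<And>a. smooth_on U (\<lambda>y. T y $ a)"
    and metric_law: "\<And>y i j. y \<in> U \<Longrightarrow> g c [i, j] y =
      (\<Sum>a\<in>UNIV. \<Sum>b\<in>UNIV. pd i (\<lambda>y. T y $ a) y * pd j (\<lambda>y. T y $ b) y * g d [a, b] (T y))"
begin

definition J :: "'n \<Rightarrow> 'n \<Rightarrow> real^'n \<Rightarrow> real" where
  "J a i y = pd i (\<lambda>y. T y $ a) y"

lemma in_c: "y \<in> U \<Longrightarrow> y \<in> chart_image c" and in_d: "y \<in> U \<Longrightarrow> T y \<in> chart_image d"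
  using U_c T_d by auto

lemma smooth_J: "smooth_on U (J a i)"
  unfolding J_def[abs_def] using smooth_on_pd[OF smooth_T] .

lemma differentiable_T: "y \<in> U \<Longrightarrow> (\<lambda>y. T y $ a) differentiable (at y)"
  and differentiable_J: "y \<in> U \<Longrightarrow> J a i differentiable (at y)"
  using smooth_on_differentiable[OF smooth_T open_U] smooth_on_differentiable[OF smooth_J open_U] by blast+

lemma pd_J_sym: "y \<in> U \<Longrightarrow> pd i (J a j) y = pd j (J a i) y"
  unfolding J_def[abs_def] by (rule pd_commute[OF open_U smooth_T])

lemma pd_comp_T:
  assumes "f differentiable (at (T y))" "y \<in> U"
  shows "pd i (\<lambda>y. f (T y)) y = (\<Sum>a\<in>UNIV. J a i y * pd a f (T y))"
    and "(\<lambda>y. f (T y)) differentiable (at y)"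
  unfolding J_def using pd_compose[OF differentiable_T[OF assms(2)] assms(1)] by auto

lemma metric_J: "y \<in> U \<Longrightarrow> g c [i, j] y = (\<Sum>a\<in>UNIV. \<Sum>b\<in>UNIV. J a i y * J b j y * g d [a, b] (T y))"
  unfolding J_def by (rule metric_law)

abbreviation "Jm y \<equiv> (\<chi> a i. J a i y) :: real^'n^'n"

lemma metric_matrix_J:
  assumes y: "y \<in> U"
  shows "metric_matrix g c y = Finite_Cartesian_Product.transpose (Jm y) ** metric_matrix g d (T y) ** Jm y"
proof -
  have "(\<Sum>a\<in>UNIV. \<Sum>b\<in>UNIV. J a i y * J b j y * g d [a, b] (T y))
     = (\<Sum>b\<in>UNIV. (\<Sum>a\<in>UNIV. J a i y * g d [a, b] (T y)) * J b j y)" for i j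
    unfolding sum_distrib_right by (subst sum.swap) (simp add: mult_ac)
  then show ?thesis
    by (simp add: vec_eq_iff metric_matrix_def matrix_matrix_mult_def transpose_def metric_J[OF y])
qed

lemma sqrt_det_J:
  assumes y: "y \<in> U"
  shows "sqrt (det (metric_matrix g c y)) = \<bar>det (Jm y)\<bar> * sqrt (det (metric_matrix g d (T y)))"
proof -
  have "det (metric_matrix g c y) = (det (Jm y))\<^sup>2 * det (metric_matrix g d (T y))"
    by (simp add: metric_matrix_J[OF y] det_mul power2_eq_square)
  then show ?thesis by (simp add: real_sqrt_mult)
qed

lemma ginv_J:
  assumes y: "y \<in> U"
  shows "(\<Sum>i\<in>UNIV. \<Sum>j\<in>UNIV. J a i y * ginv g c i j y * J b j y) = ginv g d a b (T y)"
proof -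
  let ?G = "metric_matrix g c y" and ?G' = "metric_matrix g d (T y)"
  let ?H = "matrix_inv ?G" and ?H' = "matrix_inv ?G'" and ?Jt = "Finite_Cartesian_Product.transpose (Jm y)"
  have G: "?G ** ?H = mat 1" and H': "?H' ** ?G' = mat 1"
    using C.det_pos[OF in_c[OF y]] D.det_pos[OF in_d[OF y]] matrix_inv_works by (metis less_irrefl)+
  have "?Jt ** (?G' ** Jm y ** ?H) = mat 1"
    using G unfolding metric_matrix_J[OF y] by (simp add: matrix_mul_assoc)
  then have "?G' ** Jm y ** ?H ** ?Jt = mat 1"
    by (rule matrix_left_right_inverse[THEN iffD1])
  then have "?H' ** (?G' ** (Jm y ** ?H ** ?Jt)) = ?H'"
    by (simp add: matrix_mul_assoc)
  then have "Jm y ** ?H ** ?Jt = ?H'"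
    by (simp add: matrix_mul_assoc H')
  then have "(Jm y ** ?H ** ?Jt) $ a $ b = ?H' $ a $ b" by simp
  then have "(\<Sum>j\<in>UNIV. (\<Sum>i\<in>UNIV. J a i y * ginv g c i j y) * J b j y) = ginv g d a b (T y)"
    by (simp add: matrix_matrix_mult_def transpose_def ginv_def)
  then show ?thesis by (subst sum.swap) (simp add: sum_distrib_right)
qed

lemma pd_metric_J:
  assumes y: "y \<in> U"
  shows "pd l (g c [i, j]) y =
      (\<Sum>a\<in>UNIV. \<Sum>b\<in>UNIV. pd l (J a i) y * J b j y * g d [a, b] (T y))
    + (\<Sum>a\<in>UNIV. \<Sum>b\<in>UNIV. J a i y * pd l (J b j) y * g d [a, b] (T y))
    + (\<Sum>a\<in>UNIV. \<Sum>b\<in>UNIV. \<Sum>e\<in>UNIV. J a i y * J b j y * J e l y * pd e (g d [a, b]) (T y))"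
proof -
  have dG: "(\<lambda>y. g d [a, b] (T y)) differentiable (at y)" for a b
    using pd_comp_T(2)[OF D.differentiable_g[OF in_d[OF y]] y] .
  have dJ: "(\<lambda>y. J a i y) differentiable (at y)" for a i
    using differentiable_J[OF y] .
  have "pd l (g c [i, j]) y = pd l (\<lambda>y. \<Sum>a\<in>UNIV. \<Sum>b\<in>UNIV. J a i y * J b j y * g d [a, b] (T y)) y"
    by (rule pd_cong[OF open_U y metric_J])
  also have "\<dots> = (\<Sum>a\<in>UNIV. \<Sum>b\<in>UNIV. pd l (J a i) y * J b j y * g d [a, b] (T y)
      + J a i y * pd l (J b j) y * g d [a, b] (T y)
      + J a i y * J b j y * pd l (\<lambda>y. g d [a, b] (T y)) y)"
    by (simp add: pd_sum pd_mult dG dJ distrib_right)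
  finally show ?thesis
    by (simp add: pd_comp_T(1)[OF D.differentiable_g[OF in_d[OF y]] y] sum.distrib sum_distrib_left mult.assoc)
qed

text \<open>The inhomogeneous law of the Christoffel symbols, solved for the second derivatives of
  \<open>T\<close>. It is proved with the index lowered, where it comes from differentiating the
  metric law, and then raised by \<open>ginv_J\<close>.\<close>

lemma christoffel_law:
  assumes y: "y \<in> U"
  shows "pd i (J a j) y = (\<Sum>m\<in>UNIV. christoffel g c m i j y * J a m y)
    - (\<Sum>b\<in>UNIV. \<Sum>e\<in>UNIV. christoffel g d a b e (T y) * J b i y * J e j y)"
proof -
  let ?\<Gamma>' = "\<lambda>a b e. christoffel g d a b e (T y)"
  let ?G' = "\<lambda>a b. g d [a, b] (T y)"
  \<comment> \<open>The value that the pushed-forward symbol of \<open>c\<close> must have: second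
    derivatives of \<open>T\<close> plus the symbol of \<open>d\<close> in transformed
    directions.\<close>
  define Z where "Z a = pd i (J a j) y + (\<Sum>b\<in>UNIV. \<Sum>e\<in>UNIV. ?\<Gamma>' a b e * J b i y * J e j y)" for a
  have low: "(pd i (g c [j, l]) y + pd j (g c [i, l]) y - pd l (g c [i, j]) y) / 2
      = (\<Sum>b\<in>UNIV. J b l y * (\<Sum>a\<in>UNIV. ?G' b a * Z a))" for l
  proof -
    let ?K = "\<lambda>i j l. \<Sum>a\<in>UNIV. \<Sum>b\<in>UNIV. pd i (J a j) y * J b l y * ?G' a b"
    let ?Q = "\<lambda>i j l F. \<Sum>a\<in>UNIV. \<Sum>b\<in>UNIV. \<Sum>e\<in>UNIV. J a i y * J b j y * J e l y * F a b e"
    have K: "(\<Sum>a\<in>UNIV. \<Sum>b\<in>UNIV. J a i y * pd l (J b j) y * ?G' a b) = ?K l j i" for i j l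
      by (subst sum.swap) (simp add: D.sym_g[OF in_d[OF y], of _ _] mult_ac)
    \<comment> \<open>Six terms contain second derivatives of \<open>T\<close>. Because these are
      symmetric, four cancel and the remaining two coincide, which absorbs the division by
      2.\<close>
    have K': "?K i j l = ?K j i l" for i j l by (simp add: pd_J_sym[OF y, of i _ j])
    note p = pd_metric_J[OF y, unfolded K]
    have Q1: "?Q j l i (\<lambda>a b e. pd e (g d [a, b]) (T y)) = ?Q i j l (\<lambda>a b e. pd a (g d [b, e]) (T y))"
      by (subst sum_swap3) (simp add: mult_ac)
    have Q2: "?Q i l j (\<lambda>a b e. pd e (g d [a, b]) (T y)) = ?Q i j l (\<lambda>a b e. pd b (g d [a, e]) (T y))"
      by (rule sum.cong[OF refl], subst sum.swap) (simp add: mult_ac)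
    have "(pd i (g c [j, l]) y + pd j (g c [i, l]) y - pd l (g c [i, j]) y) / 2
        = ?K i j l + ?Q i j l (\<lambda>a b e. (pd a (g d [b, e]) (T y) + pd b (g d [a, e]) (T y) - pd e (g d [a, b]) (T y)) / 2)"
    proof -
      have "?Q i j l (\<lambda>a b e. (pd a (g d [b, e]) (T y) + pd b (g d [a, e]) (T y) - pd e (g d [a, b]) (T y)) / 2)
         = (?Q i j l (\<lambda>a b e. pd a (g d [b, e]) (T y)) + ?Q i j l (\<lambda>a b e. pd b (g d [a, e]) (T y))
             - ?Q i j l (\<lambda>a b e. pd e (g d [a, b]) (T y))) / 2"
        by (simp add: sum_divide_distrib distrib_left right_diff_distrib sum.distrib sum_subtractf
            add_divide_distrib diff_divide_distrib)
      then show ?thesis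
        unfolding p Q1 Q2 using K'[of i j l] K'[of l i j] K'[of l j i] by (simp add: field_simps)
    qed
    also have "?Q i j l (\<lambda>a b e. (pd a (g d [b, e]) (T y) + pd b (g d [a, e]) (T y) - pd e (g d [a, b]) (T y)) / 2)
        = (\<Sum>a\<in>UNIV. \<Sum>b\<in>UNIV. \<Sum>e\<in>UNIV. J e l y * (\<Sum>m\<in>UNIV. ?G' e m * (?\<Gamma>' m a b * J a i y * J b j y)))"
      unfolding D.lower_christoffel[OF in_d[OF y], symmetric] by (simp add: sum_distrib_left mult_ac)
    also have "\<dots> = (\<Sum>e\<in>UNIV. \<Sum>a\<in>UNIV. \<Sum>b\<in>UNIV. J e l y * (\<Sum>m\<in>UNIV. ?G' e m * (?\<Gamma>' m a b * J a i y * J b j y)))"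
      by (rule sum_swap3)
    also have "\<dots> = (\<Sum>e\<in>UNIV. J e l y * (\<Sum>m\<in>UNIV. ?G' e m * (\<Sum>a\<in>UNIV. \<Sum>b\<in>UNIV. ?\<Gamma>' m a b * J a i y * J b j y)))"
      unfolding sum_distrib_left by (rule sum.cong[OF refl], rule sum_swap3)
    also have "?K i j l = (\<Sum>e\<in>UNIV. J e l y * (\<Sum>m\<in>UNIV. ?G' e m * pd i (J m j) y))"
      by (subst sum.swap) (simp add: sum_distrib_left mult_ac D.sym_g[OF in_d[OF y], of _ _])
    finally show ?thesis
      unfolding Z_def by (simp add: distrib_left sum.distrib)
  qed
  have chr: "christoffel g c m i j y = (\<Sum>l\<in>UNIV. ginv g c m l y *
      ((pd i (g c [j, l]) y + pd j (g c [i, l]) y - pd l (g c [i, j]) y) / 2))" for m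
    by (simp add: christoffel_def sum_divide_distrib)
  have "(\<Sum>m\<in>UNIV. christoffel g c m i j y * J a m y)
      = (\<Sum>m\<in>UNIV. \<Sum>l\<in>UNIV. J a m y * ginv g c m l y * (\<Sum>b\<in>UNIV. J b l y * (\<Sum>e\<in>UNIV. ?G' b e * Z e)))"
    unfolding chr low sum_distrib_right by (intro sum.cong refl) (simp only: mult_ac)
  also have "\<dots> = (\<Sum>m\<in>UNIV. \<Sum>l\<in>UNIV. \<Sum>b\<in>UNIV. (J a m y * ginv g c m l y * J b l y) * (\<Sum>e\<in>UNIV. ?G' b e * Z e))"
    by (intro sum.cong refl, subst sum_distrib_left) (simp only: mult.assoc)
  also have "\<dots> = (\<Sum>b\<in>UNIV. (\<Sum>m\<in>UNIV. \<Sum>l\<in>UNIV. J a m y * ginv g c m l y * J b l y) * (\<Sum>e\<in>UNIV. ?G' b e * Z e))"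
    by (subst sum_swap3) (simp only: sum_distrib_right)
  also have "\<dots> = Z a"
    unfolding ginv_J[OF y] by (rule contract_delta[OF D.H_G[OF in_d[OF y]]])
  finally show ?thesis by (simp add: Z_def)
qed

definition tlaw :: "nat \<Rightarrow> ('a, 'n) field \<Rightarrow> bool" where
  "tlaw p \<phi> \<longleftrightarrow> (\<forall>y\<in>U. \<forall>I. length I = p \<longrightarrow>
     \<phi> c I y = (\<Sum>K | length K = p. tpow p (\<lambda>i a. J a i y) I K * \<phi> d K (T y)))"

lemma tlawD: "tlaw p \<phi> \<Longrightarrow> y \<in> U \<Longrightarrow> length I = p \<Longrightarrow>
    \<phi> c I y = (\<Sum>K | length K = p. tpow p (\<lambda>i a. J a i y) I K * \<phi> d K (T y))"
  by (simp add: tlaw_def)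

text \<open>Substituting \<open>christoffel_law\<close> in each slot splits the derivative of the
  transformation matrix into symbols of \<open>c\<close> on the slots of \<open>I\<close> and
  symbols of \<open>d\<close> on the slots of \<open>K\<close>.\<close>

lemma pd_tpow_J:
  assumes y: "y \<in> U" and I: "length I = p" and K: "length K = p"
  shows "pd i (\<lambda>y. tpow p (\<lambda>i a. J a i y) I K) y
    = (\<Sum>r<p. \<Sum>m\<in>UNIV. christoffel g c m i (I ! r) y * tpow p (\<lambda>i a. J a i y) (I[r := m]) K)
      - (\<Sum>b\<in>UNIV. J b i y * (\<Sum>r<p. \<Sum>e\<in>UNIV. christoffel g d (K ! r) b e (T y) * tpow p (\<lambda>i a. J a i y) I (K[r := e])))"
proof -
  have "pd i (\<lambda>y. tpow p (\<lambda>i a. J a i y) I K) y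
      = (\<Sum>r<p. pd i (J (K ! r) (I ! r)) y * (\<Prod>l\<in>{..<p} - {r}. J (K ! l) (I ! l) y))"
    unfolding tpow_def by (rule pd_prod) (auto intro: differentiable_J y)
  also have "\<dots> = (\<Sum>r<p. (\<Sum>m\<in>UNIV. christoffel g c m i (I ! r) y * tpow p (\<lambda>i a. J a i y) (I[r := m]) K)
      - (\<Sum>b\<in>UNIV. \<Sum>e\<in>UNIV. J b i y * (christoffel g d (K ! r) b e (T y) * tpow p (\<lambda>i a. J a i y) I (K[r := e]))))"
  proof (rule sum.cong[OF refl])
    fix r assume "r \<in> {..<p}"
    then have r: "r < p" by simp
    show "pd i (J (K ! r) (I ! r)) y * (\<Prod>l\<in>{..<p} - {r}. J (K ! l) (I ! l) y)
      = (\<Sum>m\<in>UNIV. christoffel g c m i (I ! r) y * tpow p (\<lambda>i a. J a i y) (I[r := m]) K)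
      - (\<Sum>b\<in>UNIV. \<Sum>e\<in>UNIV. J b i y * (christoffel g d (K ! r) b e (T y) * tpow p (\<lambda>i a. J a i y) I (K[r := e])))"
      unfolding christoffel_law[OF y] tpow_update_left[OF r I] tpow_update_right[OF r K]
        left_diff_distrib sum_distrib_right by (simp add: mult_ac)
  qed
  also have "\<dots> = (\<Sum>r<p. \<Sum>m\<in>UNIV. christoffel g c m i (I ! r) y * tpow p (\<lambda>i a. J a i y) (I[r := m]) K)
      - (\<Sum>r<p. \<Sum>b\<in>UNIV. \<Sum>e\<in>UNIV. J b i y * (christoffel g d (K ! r) b e (T y) * tpow p (\<lambda>i a. J a i y) I (K[r := e])))"
    by (rule sum_subtractf)
  also have "(\<Sum>r<p. \<Sum>b\<in>UNIV. \<Sum>e\<in>UNIV. J b i y * (christoffel g d (K ! r) b e (T y) * tpow p (\<lambda>i a. J a i y) I (K[r := e])))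
      = (\<Sum>b\<in>UNIV. J b i y * (\<Sum>r<p. \<Sum>e\<in>UNIV. christoffel g d (K ! r) b e (T y) * tpow p (\<lambda>i a. J a i y) I (K[r := e])))"
    by (subst sum.swap) (simp add: sum_distrib_left)
  finally show ?thesis .
qed

text \<open>Differentiating the tensor law also differentiates its matrix. The resulting symbols of
  \<open>c\<close> are the corrections in \<nabla>\<phi> on the left; those of \<open>d\<close> pass
  to \<open>\<phi>\<close> by \<open>sum_idx_slot\<close> and complete the covariant derivative on
  the right.\<close>

lemma tlaw_nabla:
  assumes \<phi>: "tlaw p \<phi>" and sm: "smooth_comp d p \<phi>"
  shows "tlaw (Suc p) (nabla g \<phi>)"
  unfolding tlaw_def
proof (intro ballI allI impI)
  fix y and L :: "'n list" assume y: "y \<in> U" and "length L = Suc p"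
  then obtain i I where L: "L = i # I" and I: "length I = p" by (auto simp: length_Suc_conv)
  let ?X = "{K::'n list. length K = p}"
  let ?T = "\<lambda>I K. tpow p (\<lambda>i a. J a i y) I K"
  let ?\<Gamma>' = "\<lambda>a b e. christoffel g d a b e (T y)"
  have d\<phi>: "\<phi> d K differentiable (at (T y))" if "length K = p" for K
    using D.smooth_comp_differentiable[OF sm that in_d[OF y]] .
  have dT: "(\<lambda>y. tpow p (\<lambda>i a. J a i y) I K) differentiable (at y)" for K
    unfolding tpow_def by (rule differentiable_prod) (auto intro: differentiable_J y)
  have "pd i (\<phi> c I) y = pd i (\<lambda>y. \<Sum>K\<in>?X. tpow p (\<lambda>i a. J a i y) I K * \<phi> d K (T y)) y"
    by (rule pd_cong[OF open_U y tlawD[OF \<phi> _ I]])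
  also have "\<dots> = (\<Sum>K\<in>?X. pd i (\<lambda>y. tpow p (\<lambda>i a. J a i y) I K * \<phi> d K (T y)) y)"
    by (rule pd_sum, rule differentiable_mult, rule dT, rule pd_comp_T(2)[OF d\<phi> y], simp)
  also have "\<dots> = (\<Sum>K\<in>?X. pd i (\<lambda>y. tpow p (\<lambda>i a. J a i y) I K) y * \<phi> d K (T y)
      + ?T I K * (\<Sum>b\<in>UNIV. J b i y * pd b (\<phi> d K) (T y)))"
    by (rule sum.cong[OF refl]) (simp add: pd_mult dT pd_comp_T[OF d\<phi> y])
  also have "\<dots> = (\<Sum>K\<in>?X. (\<Sum>r<p. \<Sum>m\<in>UNIV. christoffel g c m i (I ! r) y * ?T (I[r := m]) K) * \<phi> d K (T y))
      - (\<Sum>K\<in>?X. (\<Sum>b\<in>UNIV. J b i y * (\<Sum>r<p. \<Sum>e\<in>UNIV. ?\<Gamma>' (K ! r) b e * ?T I (K[r := e]))) * \<phi> d K (T y))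
      + (\<Sum>K\<in>?X. ?T I K * (\<Sum>b\<in>UNIV. J b i y * pd b (\<phi> d K) (T y)))"
    using I by (simp add: pd_tpow_J y sum.distrib left_diff_distrib sum_subtractf)
  also have "(\<Sum>K\<in>?X. (\<Sum>r<p. \<Sum>m\<in>UNIV. christoffel g c m i (I ! r) y * ?T (I[r := m]) K) * \<phi> d K (T y))
      = (\<Sum>r<p. \<Sum>m\<in>UNIV. christoffel g c m i (I ! r) y * \<phi> c (I[r := m]) y)"
    unfolding sum_distrib_right
    by (subst sum_swap3[symmetric]) (use I in \<open>simp add: tlawD[OF \<phi> y] sum_distrib_left mult_ac\<close>)
  also have "(\<Sum>K\<in>?X. (\<Sum>b\<in>UNIV. J b i y * (\<Sum>r<p. \<Sum>e\<in>UNIV. ?\<Gamma>' (K ! r) b e * ?T I (K[r := e]))) * \<phi> d K (T y))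
      = (\<Sum>b\<in>UNIV. J b i y * (\<Sum>K\<in>?X. ?T I K * (\<Sum>r<p. \<Sum>e\<in>UNIV. ?\<Gamma>' e b (K ! r) * \<phi> d (K[r := e]) (T y))))"
  proof -
    let ?A = "\<lambda>K b. \<Sum>r<p. \<Sum>e\<in>UNIV. ?\<Gamma>' (K ! r) b e * ?T I (K[r := e])"
    have e: "(\<Sum>K\<in>?X. ?A K b * \<phi> d K (T y))
        = (\<Sum>K\<in>?X. ?T I K * (\<Sum>r<p. \<Sum>e\<in>UNIV. ?\<Gamma>' e b (K ! r) * \<phi> d (K[r := e]) (T y)))" for b
    proof -
      have "(\<Sum>K\<in>?X. (\<Sum>r<p. \<Sum>e\<in>UNIV. ?\<Gamma>' (K ! r) b e * ?T I (K[r := e])) * \<phi> d K (T y))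
          = (\<Sum>r<p. \<Sum>K\<in>?X. \<Sum>e\<in>UNIV. ?\<Gamma>' (K ! r) b e * ?T I (K[r := e]) * \<phi> d K (T y))"
        by (simp add: sum_distrib_right sum.swap[of _ ?X])
      also have "\<dots> = (\<Sum>r<p. \<Sum>K\<in>?X. \<Sum>e\<in>UNIV. ?\<Gamma>' e b (K ! r) * ?T I K * \<phi> d (K[r := e]) (T y))"
        by (rule sum.cong[OF refl], subst sum_idx_slot) auto
      also have "\<dots> = (\<Sum>K\<in>?X. ?T I K * (\<Sum>r<p. \<Sum>e\<in>UNIV. ?\<Gamma>' e b (K ! r) * \<phi> d (K[r := e]) (T y)))"
        by (simp add: sum_distrib_left sum.swap[of _ ?X] mult_ac)
      finally show ?thesis .
    qed
    have "(\<Sum>K\<in>?X. (\<Sum>b\<in>UNIV. J b i y * ?A K b) * \<phi> d K (T y))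
        = (\<Sum>K\<in>?X. \<Sum>b\<in>UNIV. J b i y * (?A K b * \<phi> d K (T y)))"
      by (rule sum.cong[OF refl], subst sum_distrib_right) (simp only: mult.assoc)
    also have "\<dots> = (\<Sum>b\<in>UNIV. \<Sum>K\<in>?X. J b i y * (?A K b * \<phi> d K (T y)))"
      by (rule sum.swap)
    also have "\<dots> = (\<Sum>b\<in>UNIV. J b i y * (\<Sum>K\<in>?X. ?A K b * \<phi> d K (T y)))"
      by (rule sum.cong[OF refl], rule sum_distrib_left[symmetric])
    finally show ?thesis unfolding e .
  qed
  also have "(\<Sum>K\<in>?X. ?T I K * (\<Sum>b\<in>UNIV. J b i y * pd b (\<phi> d K) (T y)))
      = (\<Sum>b\<in>UNIV. J b i y * (\<Sum>K\<in>?X. ?T I K * pd b (\<phi> d K) (T y)))"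
    unfolding sum_distrib_left by (subst sum.swap) (simp add: mult_ac)
  finally have "nabla g \<phi> c (i # I) y
      = (\<Sum>b\<in>UNIV. J b i y * (\<Sum>K\<in>?X. ?T I K * pd b (\<phi> d K) (T y)))
        - (\<Sum>b\<in>UNIV. J b i y * (\<Sum>K\<in>?X. ?T I K * (\<Sum>r<p. \<Sum>e\<in>UNIV. ?\<Gamma>' e b (K ! r) * \<phi> d (K[r := e]) (T y))))"
    using I by (simp add: nabla_Cons)
  also have "\<dots> = (\<Sum>b\<in>UNIV. J b i y * (\<Sum>K\<in>?X. ?T I K * nabla g \<phi> d (b # K) (T y)))"
    by (simp add: nabla_Cons right_diff_distrib sum_subtractf)
  also have "\<dots> = (\<Sum>K | length K = Suc p. tpow (Suc p) (\<lambda>i a. J a i y) L K * nabla g \<phi> d K (T y))"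
    by (simp add: sum_idx_Suc L sum_distrib_left mult_ac)
  finally show "nabla g \<phi> c L y = (\<Sum>K | length K = Suc p. tpow (Suc p) (\<lambda>i a. J a i y) L K * nabla g \<phi> d K (T y))"
    unfolding L .
qed

lemma tlaw_lswap:
  assumes \<phi>: "tlaw p \<phi>" and ab: "a < p" "b < p"
  shows "tlaw p (\<lambda>c I. \<phi> c (lswap a b I))"
  unfolding tlaw_def
proof (intro ballI allI impI)
  fix y and I :: "'n list" assume y: "y \<in> U" and I: "length I = p"
  have "\<phi> c (lswap a b I) y = (\<Sum>K | length K = p. tpow p (\<lambda>i a. J a i y) (lswap a b I) K * \<phi> d K (T y))"
    using I by (simp add: tlawD[OF \<phi> y])
  also have "\<dots> = (\<Sum>K | length K = p. tpow p (\<lambda>i a. J a i y) (lswap a b I) (lswap a b K) * \<phi> d (lswap a b K) (T y))"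
    by (rule sum_idx_lswap[OF ab, symmetric])
  also have "\<dots> = (\<Sum>K | length K = p. tpow p (\<lambda>i a. J a i y) I K * \<phi> d (lswap a b K) (T y))"
    using I by (simp add: tpow_lswap[OF ab])
  finally show "\<phi> c (lswap a b I) y = \<dots>" .
qed

lemma tlaw_trace2:
  assumes \<psi>: "tlaw (Suc (Suc p)) \<psi>"
  shows "tlaw p (trace2 g \<psi>)"
  unfolding tlaw_def
proof (intro ballI allI impI)
  fix y and I :: "'n list" assume y: "y \<in> U" and I: "length I = p"
  let ?X = "{K::'n list. length K = p}"
  let ?T = "\<lambda>I K. tpow p (\<lambda>i a. J a i y) I K"
  have "trace2 g \<psi> c I y = (\<Sum>i\<in>UNIV. \<Sum>j\<in>UNIV. ginv g c i j y *
      (\<Sum>b\<in>UNIV. \<Sum>a\<in>UNIV. \<Sum>K\<in>?X. J b j y * (J a i y * ?T I K) * \<psi> d (b # a # K) (T y)))"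
    using I by (simp add: trace2_def tlawD[OF \<psi> y] sum_idx_Suc)
  also have "\<dots> = (\<Sum>i\<in>UNIV. \<Sum>j\<in>UNIV. \<Sum>b\<in>UNIV. \<Sum>a\<in>UNIV.
      (J a i y * ginv g c i j y * J b j y) * (\<Sum>K\<in>?X. ?T I K * \<psi> d (b # a # K) (T y)))"
    by (simp add: sum_distrib_left mult_ac)
  also have "\<dots> = (\<Sum>b\<in>UNIV. \<Sum>a\<in>UNIV. ginv g d a b (T y) * (\<Sum>K\<in>?X. ?T I K * \<psi> d (b # a # K) (T y)))"
    by (subst sum_swap4) (simp add: ginv_J[OF y] flip: sum_distrib_right)
  also have "\<dots> = (\<Sum>a\<in>UNIV. \<Sum>b\<in>UNIV. \<Sum>K\<in>?X. ?T I K * (ginv g d a b (T y) * \<psi> d (b # a # K) (T y)))"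
    by (subst sum.swap) (simp add: sum_distrib_left mult_ac)
  also have "\<dots> = (\<Sum>K\<in>?X. ?T I K * trace2 g \<psi> d K (T y))"
    by (subst sum_swap3) (simp add: trace2_def sum_distrib_left)
  finally show "trace2 g \<psi> c I y = \<dots>" .
qed

lemma tlaw_sum: "(\<And>a. a \<in> X \<Longrightarrow> tlaw p (\<phi> a)) \<Longrightarrow> tlaw p (\<lambda>c I y. \<Sum>a\<in>X. \<phi> a c I y)"
  unfolding tlaw_def sum_distrib_left by (subst sum.swap) simp

lemma tlaw_diff: "tlaw p \<phi> \<Longrightarrow> tlaw p \<psi> \<Longrightarrow> tlaw p (\<lambda>c I y. \<phi> c I y - \<psi> c I y)"
  unfolding tlaw_def by (simp add: right_diff_distrib sum_subtractf)

lemma tlaw_cong: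
  assumes "tlaw p \<psi>" "\<And>I y. length I = p \<Longrightarrow> y \<in> chart_image c \<Longrightarrow> \<phi> c I y = \<psi> c I y"
    "\<And>I y. length I = p \<Longrightarrow> y \<in> chart_image d \<Longrightarrow> \<phi> d I y = \<psi> d I y"
  shows "tlaw p \<phi>"
  using assms unfolding tlaw_def by (simp add: in_c in_d)

text \<open>Inserting both tensor laws leaves the product of three tensor powers, from a transposed
  Jacobian, the inverse metric and a Jacobian. By \<open>tpow_mult\<close> it is the tensor power of
  the product matrix, which \<open>ginv_J\<close> identifies.\<close>

lemma tdot_law:
  assumes \<phi>: "tlaw p \<phi>" and \<psi>: "tlaw p \<psi>" and y: "y \<in> U"
  shows "tdot g p \<phi> \<psi> c y = tdot g p \<phi> \<psi> d (T y)"
proof -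
  let ?X = "{K::'n list. length K = p}"
  let ?T = "tpow p (\<lambda>i a. J a i y)"
  let ?H = "tpow p (\<lambda>i j. ginv g c i j y)"
  have "tdot g p \<phi> \<psi> c y = (\<Sum>I\<in>?X. \<Sum>J\<in>?X. \<Sum>K\<in>?X. \<Sum>L\<in>?X. ?T I L * ?H I J * ?T J K * (\<phi> d K (T y) * \<psi> d L (T y)))"
    by (simp add: tdot_def tlawD[OF \<phi> y] tlawD[OF \<psi> y] sum_distrib_left sum_distrib_right mult_ac)
  also have "\<dots> = (\<Sum>K\<in>?X. \<Sum>L\<in>?X. (\<Sum>I\<in>?X. \<Sum>J\<in>?X. ?T I L * ?H I J * ?T J K) * (\<phi> d K (T y) * \<psi> d L (T y)))"
    by (subst sum_swap4) (simp add: sum_distrib_right)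
  also have "\<dots> = (\<Sum>K\<in>?X. \<Sum>L\<in>?X. tpow p (\<lambda>i j. ginv g d i j (T y)) L K * (\<phi> d K (T y) * \<psi> d L (T y)))"
  proof (intro sum.cong refl arg_cong2[where f="(*)"])
    fix K L assume KL: "K \<in> ?X" "L \<in> ?X"
    have "(\<Sum>I\<in>?X. \<Sum>J\<in>?X. ?T I L * ?H I J * ?T J K) = (\<Sum>I\<in>?X. ?T I L * (\<Sum>J\<in>?X. ?H I J * ?T J K))"
      by (simp add: sum_distrib_left mult_ac)
    also have "\<dots> = (\<Sum>I\<in>?X. tpow p (\<lambda>a i. J a i y) L I * tpow p (\<lambda>i b. \<Sum>j\<in>UNIV. ginv g c i j y * J b j y) I K)"
      using KL by (simp add: tpow_mult tpow_flip[of p "\<lambda>i a. J a i y" _ L])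
    also have "\<dots> = tpow p (\<lambda>i j. ginv g d i j (T y)) L K"
      using KL by (simp add: tpow_mult sum_distrib_left flip: mult.assoc ginv_J[OF y])
    finally show "(\<Sum>I\<in>?X. \<Sum>J\<in>?X. ?T I L * ?H I J * ?T J K) = \<dots>" .
  qed
  also have "\<dots> = tdot g p \<phi> \<psi> d (T y)"
    unfolding tdot_def by (subst sum.swap) (simp add: mult_ac)
  finally show ?thesis .
qed

end

section \<open>The quadratic form of the curvature endomorphism\<close>

context chart_metric
begin

lemma raise_1: "raise g 1 \<phi> c (j # I) y = (\<Sum>s\<in>UNIV. ginv g c j s y * \<phi> c (s # I) y)"
  by (simp add: raise_def sum_idx_Suc)

lemma raise_2: "raise g 2 \<phi> c (j # l # I) y
    = (\<Sum>s\<in>UNIV. \<Sum>t\<in>UNIV. ginv g c j s y * ginv g c l t y * \<phi> c (s # t # I) y)"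
  by (simp add: raise_def sum_idx_Suc numeral_2_eq_2)

lemma raise_lswap:
  assumes \<phi>: "sym_comp c p \<phi>" and y: "y \<in> S" and ab: "a < p" "b < p" and I: "length I = p"
  shows "raise g p \<phi> c (lswap a b I) y = raise g p \<phi> c I y"
proof -
  let ?H = "tpow p (\<lambda>i j. ginv g c i j y)"
  have "raise g p \<phi> c (lswap a b I) y = (\<Sum>J | length J = p. ?H (lswap a b I) (lswap a b J) * \<phi> c (lswap a b J) y)"
    using I by (simp add: raise_all) (rule sum_idx_lswap[OF ab, symmetric])
  also have "\<dots> = raise g p \<phi> c I y"
    using I ab by (simp add: raise_all tpow_lswap)
      (intro sum.cong refl arg_cong2[where f="(*)"] sym_compD[OF \<phi> y], auto simp: mset_lswap)
  finally show ?thesis .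
qed

lemma transposed_update:
  assumes \<phi>: "sym_comp c p \<phi>" and y: "y \<in> S" and ab: "a < p" "b < p" and kl: "k < p" "l < p" and I: "length I = p"
  shows "\<phi> c ((lswap a b I)[k := s, l := t]) y
    = \<phi> c (I[Transposition.transpose a b k := s, Transposition.transpose a b l := t]) y"
proof -
  have "(lswap a b I)[k := s, l := t]
      = lswap a b (I[Transposition.transpose a b k := s, Transposition.transpose a b l := t])"
    using I ab kl by (simp add: lswap_update transpose_less)
  then show ?thesis
    using I ab by (intro sym_compD[OF \<phi> y]) (auto simp: mset_lswap)
qed

text \<open>Renaming the summation indices by the transposition of slots 0 and \<open>k\<close>
  shows that every slot contributes the same amount; hence the factor \<open>Suc q\<close>, the
  rank.\<close>

lemma ricci_contract:
  assumes \<phi>: "sym_comp c (Suc q) \<phi>" and y: "y \<in> S"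
  defines "P \<equiv> \<lambda>I. raise g (Suc q) \<phi> c I y"
  shows "(\<Sum>I | length I = Suc q. P I * (\<Sum>k<Suc q. \<Sum>j\<in>UNIV. \<Sum>s\<in>UNIV.
            ginv g c j s y * ricci g c (I ! k) j y * \<phi> c (I[k := s]) y))
     = real (Suc q) * (\<Sum>i\<in>UNIV. \<Sum>j\<in>UNIV. \<Sum>I | length I = q. ricci g c i j y * P (i # I) * raise g 1 \<phi> c (j # I) y)"
proof -
  define F where "F k I = P I * (\<Sum>j\<in>UNIV. \<Sum>s\<in>UNIV. ginv g c j s y * ricci g c (I ! k) j y * \<phi> c (I[k := s]) y)"
    for k I
  have F: "(\<Sum>I | length I = Suc q. F k I) = (\<Sum>I | length I = Suc q. F 0 I)" if k: "k < Suc q" for k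
  proof -
    have "(\<Sum>I | length I = Suc q. F k I) = (\<Sum>I | length I = Suc q. F k (lswap 0 k I))"
      using k by (intro sum_idx_lswap[symmetric]) auto
    also have "\<dots> = (\<Sum>I | length I = Suc q. F 0 I)"
    proof (rule sum.cong[OF refl])
      fix I :: "'n list" assume "I \<in> {I. length I = Suc q}"
      then have I: "length I = Suc q" by simp
      have "\<phi> c ((lswap 0 k I)[k := s]) y = \<phi> c (I[0 := s]) y" for s
        using transposed_update[OF \<phi> y _ k k k I, of 0 s s] by simp
      moreover have "lswap 0 k I ! k = I ! 0" using k I by (simp add: nth_lswap)
      ultimately show "F k (lswap 0 k I) = F 0 I"
        unfolding F_def P_def raise_lswap[OF \<phi> y zero_less_Suc k I] by simp
    qed
    finally show ?thesis .
  qed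
  have "(\<Sum>I | length I = Suc q. P I * (\<Sum>k<Suc q. \<Sum>j\<in>UNIV. \<Sum>s\<in>UNIV.
            ginv g c j s y * ricci g c (I ! k) j y * \<phi> c (I[k := s]) y))
      = (\<Sum>I | length I = Suc q. \<Sum>k<Suc q. F k I)"
    unfolding F_def by (subst sum_distrib_left) (rule refl)
  also have "\<dots> = (\<Sum>k<Suc q. \<Sum>I | length I = Suc q. F k I)"
    by (rule sum.swap)
  also have "\<dots> = (\<Sum>k<Suc q. \<Sum>I | length I = Suc q. F 0 I)"
    by (rule sum.cong[OF refl], rule F) simp
  also have "\<dots> = real (Suc q) * (\<Sum>I | length I = Suc q. F 0 I)"
    by (simp del: sum.lessThan_Suc)
  also have "(\<Sum>I | length I = Suc q. F 0 I)
      = (\<Sum>i\<in>UNIV. \<Sum>I | length I = q. \<Sum>j\<in>UNIV. ricci g c i j y * P (i # I) * raise g 1 \<phi> c (j # I) y)"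
    unfolding F_def sum_idx_Suc raise_1 sum_distrib_left by (simp add: mult_ac)
  also have "\<dots> = (\<Sum>i\<in>UNIV. \<Sum>j\<in>UNIV. \<Sum>I | length I = q. ricci g c i j y * P (i # I) * raise g 1 \<phi> c (j # I) y)"
    by (rule sum.cong[OF refl], rule sum.swap)
  finally show ?thesis .
qed

text \<open>All ordered pairs of distinct slots contribute equally, since transpositions carry any
  such pair to \<open>(0, 1)\<close>. The factor is the number of these pairs.\<close>

lemma riemann_contract:
  assumes \<phi>: "sym_comp c (Suc (Suc q)) \<phi>" and y: "y \<in> S"
  defines "P \<equiv> \<lambda>I. raise g (Suc (Suc q)) \<phi> c I y"
  shows "(\<Sum>I | length I = Suc (Suc q). P I * (\<Sum>k<Suc (Suc q). \<Sum>l\<in>{..<Suc (Suc q)} - {k}.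
          \<Sum>j\<in>UNIV. \<Sum>s\<in>UNIV. \<Sum>m\<in>UNIV. \<Sum>t\<in>UNIV.
            ginv g c j s y * ginv g c m t y * riemann g c (I ! k) j (I ! l) m y * \<phi> c (I[k := s, l := t]) y))
     = real (Suc (Suc q)) * real (Suc q) * (\<Sum>i\<in>UNIV. \<Sum>j\<in>UNIV. \<Sum>k\<in>UNIV. \<Sum>l\<in>UNIV. \<Sum>I | length I = q.
          riemann g c i j k l y * P (i # k # I) * raise g 2 \<phi> c (j # l # I) y)"
proof -
  let ?p = "Suc (Suc q)"
  define F where "F k l I = P I * (\<Sum>j\<in>UNIV. \<Sum>s\<in>UNIV. \<Sum>m\<in>UNIV. \<Sum>t\<in>UNIV.
      ginv g c j s y * ginv g c m t y * riemann g c (I ! k) j (I ! l) m y * \<phi> c (I[k := s, l := t]) y)" for k l I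
  have F: "(\<Sum>I | length I = ?p. F k l I)
      = (\<Sum>I | length I = ?p. F (Transposition.transpose a b k) (Transposition.transpose a b l) I)"
    if kl: "k < ?p" "l < ?p" and ab: "a < ?p" "b < ?p" for k l a b
  proof -
    have "(\<Sum>I | length I = ?p. F k l I) = (\<Sum>I | length I = ?p. F k l (lswap a b I))"
      using ab by (intro sum_idx_lswap[symmetric])
    also have "\<dots> = (\<Sum>I | length I = ?p. F (Transposition.transpose a b k) (Transposition.transpose a b l) I)"
    proof (rule sum.cong[OF refl])
      fix I :: "'n list" assume "I \<in> {I. length I = ?p}"
      then have I: "length I = ?p" by simp
      show "F k l (lswap a b I) = F (Transposition.transpose a b k) (Transposition.transpose a b l) I"
        unfolding F_def P_def transposed_update[OF \<phi> y ab kl I] raise_lswap[OF \<phi> y ab I]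
        using ab kl I by (simp add: nth_lswap)
    qed
    finally show ?thesis .
  qed
  have F01: "(\<Sum>I | length I = ?p. F k l I) = (\<Sum>I | length I = ?p. F 0 1 I)"
    if kl: "k < ?p" "l < ?p" "l \<noteq> k" for k l
  proof -
    \<comment> \<open>The transposition of 0 and \<open>k\<close> sends \<open>k\<close> to 0 and
      \<open>l\<close> to some \<open>l'\<close> different from 0. The transposition of 1 and
      \<open>l'\<close> then fixes 0 and sends \<open>l'\<close> to 1.\<close>
    define l' where "l' = Transposition.transpose 0 k l"
    have l': "l' < ?p" "l' \<noteq> 0" using kl by (auto simp: l'_def Transposition.transpose_def)
    have "(\<Sum>I | length I = ?p. F k l I) = (\<Sum>I | length I = ?p. F 0 l' I)"
      using F[OF kl(1,2), of 0 k] kl by (simp add: l'_def)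
    also have "\<dots> = (\<Sum>I | length I = ?p. F 0 1 I)"
      using F[of 0 l' 1 l'] l' by (simp add: Transposition.transpose_def)
    finally show ?thesis .
  qed
  have "(\<Sum>I | length I = ?p. P I * (\<Sum>k<?p. \<Sum>l\<in>{..<?p} - {k}.
          \<Sum>j\<in>UNIV. \<Sum>s\<in>UNIV. \<Sum>m\<in>UNIV. \<Sum>t\<in>UNIV.
            ginv g c j s y * ginv g c m t y * riemann g c (I ! k) j (I ! l) m y * \<phi> c (I[k := s, l := t]) y))
      = (\<Sum>I | length I = ?p. \<Sum>k<?p. \<Sum>l\<in>{..<?p} - {k}. F k l I)"
    unfolding F_def by (subst sum_distrib_left, subst sum_distrib_left) (rule refl)
  also have "\<dots> = (\<Sum>k<?p. \<Sum>I | length I = ?p. \<Sum>l\<in>{..<?p} - {k}. F k l I)"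
    by (rule sum.swap)
  also have "\<dots> = (\<Sum>k<?p. \<Sum>l\<in>{..<?p} - {k}. \<Sum>I | length I = ?p. F k l I)"
    by (rule sum.cong[OF refl], rule sum.swap)
  also have "\<dots> = (\<Sum>k<?p. \<Sum>l\<in>{..<?p} - {k}. \<Sum>I | length I = ?p. F 0 1 I)"
    by (rule sum.cong[OF refl], rule sum.cong[OF refl], rule F01) auto
  also have "\<dots> = real ?p * real (Suc q) * (\<Sum>I | length I = ?p. F 0 1 I)"
    by (simp add: card_Diff_singleton del: sum.lessThan_Suc)
  also have "(\<Sum>I | length I = ?p. F 0 1 I)
      = (\<Sum>i\<in>UNIV. \<Sum>k\<in>UNIV. \<Sum>I | length I = q. \<Sum>j\<in>UNIV. \<Sum>l\<in>UNIV.
          riemann g c i j k l y * P (i # k # I) * raise g 2 \<phi> c (j # l # I) y)"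
    unfolding sum_idx_Suc
  proof (intro sum.cong refl)
    fix i k I
    show "F 0 1 (i # k # I) = (\<Sum>j\<in>UNIV. \<Sum>l\<in>UNIV.
          riemann g c i j k l y * P (i # k # I) * raise g 2 \<phi> c (j # l # I) y)"
      unfolding F_def raise_2 sum_distrib_left
      by (rule sum.cong[OF refl], subst sum.swap) (simp add: mult_ac)
  qed
  also have "\<dots> = (\<Sum>i\<in>UNIV. \<Sum>j\<in>UNIV. \<Sum>k\<in>UNIV. \<Sum>l\<in>UNIV. \<Sum>I | length I = q.
          riemann g c i j k l y * P (i # k # I) * raise g 2 \<phi> c (j # l # I) y)"
    by (rule sum.cong[OF refl], subst sum_swap3, intro sum.cong refl sum.swap)
  finally show ?thesis .
qed

text \<open>The pairing is symmetric, so the raised indices can be put on \<open>\<phi>\<close>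
  instead of \<open>B_op g \<phi>\<close>. The counts \<open>p\<close> and
  \<open>p * (p - 1)\<close> of slots and of pairs then turn \<open>1 / fact p\<close> into the
  stated coefficients.\<close>

lemma B_op_contract:
  assumes \<phi>: "sym_comp c p \<phi>" and y: "y \<in> S" and p: "p \<ge> 1"
  shows "1 / fact p * (\<Sum>I | length I = p. raise g p (B_op g \<phi>) c I y * \<phi> c I y) = 1 / fact (p - 1) *
     ((\<Sum>i\<in>UNIV. \<Sum>j\<in>UNIV. \<Sum>I | length I = p - 1.
         ricci g c i j y * raise g p \<phi> c (i # I) y * raise g 1 \<phi> c (j # I) y)
      - (real p - 1) *
        (\<Sum>i\<in>UNIV. \<Sum>j\<in>UNIV. \<Sum>k\<in>UNIV. \<Sum>l\<in>UNIV. \<Sum>I | length I = p - 2.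
           riemann g c i j k l y * raise g p \<phi> c (i # k # I) y * raise g 2 \<phi> c (j # l # I) y))"
proof -
  obtain q where q: "p = Suc q" using p by (cases p) auto
  let ?A = "\<Sum>i\<in>UNIV. \<Sum>j\<in>UNIV. \<Sum>I | length I = p - 1.
         ricci g c i j y * raise g p \<phi> c (i # I) y * raise g 1 \<phi> c (j # I) y"
  let ?B = "\<Sum>i\<in>UNIV. \<Sum>j\<in>UNIV. \<Sum>k\<in>UNIV. \<Sum>l\<in>UNIV. \<Sum>I | length I = p - 2.
           riemann g c i j k l y * raise g p \<phi> c (i # k # I) y * raise g 2 \<phi> c (j # l # I) y"
  have "(\<Sum>I | length I = p. raise g p (B_op g \<phi>) c I y * \<phi> c I y)
      = (\<Sum>I | length I = p. raise g p \<phi> c I y * B_op g \<phi> c I y)"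
    unfolding tdot_raise by (rule tdot_sym[OF y])
  also have "\<dots> = real p * ?A - real p * (real p - 1) * ?B"
  proof -
    have "(\<Sum>I | length I = p. raise g p \<phi> c I y * (\<Sum>k<p. \<Sum>l\<in>{..<p} - {k}.
          \<Sum>j\<in>UNIV. \<Sum>s\<in>UNIV. \<Sum>m\<in>UNIV. \<Sum>t\<in>UNIV.
            ginv g c j s y * ginv g c m t y * riemann g c (I ! k) j (I ! l) m y * \<phi> c (I[k := s, l := t]) y))
        = real p * (real p - 1) * ?B"
    proof (cases q)
      \<comment> \<open>For \<open>p = 1\<close> there are no pairs of distinct slots. The truncated
        \<open>p - 2\<close> is 0, and the meaningless sum is multiplied by
        \<open>real p - 1 = 0\<close>.\<close>
      case 0
      then show ?thesis using q by (simp add: lessThan_Suc)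
    next
      case (Suc r)
      then show ?thesis
        using riemann_contract[of r \<phi> y] \<phi> y q by (simp del: sum.lessThan_Suc)
    qed
    moreover have "(\<Sum>I | length I = p. raise g p \<phi> c I y * (\<Sum>k<p. \<Sum>j\<in>UNIV. \<Sum>s\<in>UNIV.
            ginv g c j s y * ricci g c (I ! k) j y * \<phi> c (I[k := s]) y)) = real p * ?A"
      using ricci_contract[of q \<phi> y] \<phi> y q by (simp del: sum.lessThan_Suc)
    moreover have "(\<Sum>I | length I = p. raise g p \<phi> c I y * B_op g \<phi> c I y)
      = (\<Sum>I | length I = p. raise g p \<phi> c I y * (\<Sum>k<p. \<Sum>j\<in>UNIV. \<Sum>s\<in>UNIV.
            ginv g c j s y * ricci g c (I ! k) j y * \<phi> c (I[k := s]) y))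
        - (\<Sum>I | length I = p. raise g p \<phi> c I y * (\<Sum>k<p. \<Sum>l\<in>{..<p} - {k}.
          \<Sum>j\<in>UNIV. \<Sum>s\<in>UNIV. \<Sum>m\<in>UNIV. \<Sum>t\<in>UNIV.
            ginv g c j s y * ginv g c m t y * riemann g c (I ! k) j (I ! l) m y * \<phi> c (I[k := s, l := t]) y))"
      by (simp add: B_op_def right_diff_distrib sum_subtractf)
    ultimately show ?thesis by linarith
  qed
  finally have e: "(\<Sum>I | length I = p. raise g p (B_op g \<phi>) c I y * \<phi> c I y)
      = real p * ?A - real p * (real p - 1) * ?B" .
  have r: "1 / (n * f) * (n * a - n * m * b) = 1 / f * (a - m * b)" if "n \<noteq> 0" "f \<noteq> 0" for n f a m b :: real
    using that by (simp add: field_simps)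
  have f: "fact p = real p * fact (p - 1)" using p by (simp add: fact_reduce)
  show ?thesis
    unfolding e by (subst f, rule r) (use p in auto)
qed

end

section \<open>Change of variables over an arbitrary finite index type\<close>

text \<open>
  The change-of-variables theorems of the library need a well-ordered index type, so an arbitrary
  finite index type is copied to one that carries a well-order.
\<close>

typedef 'n widx = "UNIV :: 'n set" morphisms of_widx to_widx
  by auto

text \<open>The choice of the injection does not involve \<open>i\<close>, so it is one and the same
  for all indices.\<close>

definition widx_code :: "'n::finite widx \<Rightarrow> nat" where
  "widx_code i = (SOME f. inj (f :: 'n \<Rightarrow> nat)) (of_widx i)"

lemma inj_widx_code: "inj (widx_code :: 'n::finite widx \<Rightarrow> nat)"
proof -
  obtain f :: "'n \<Rightarrow> nat" and n where "f ` UNIV = {i. i < n} \<and> inj f"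
    using finite_imp_inj_to_nat_seg[OF finite[of "UNIV :: 'n set"]] by blast
  then have "inj f" by blast
  then have inj: "inj (SOME f. inj (f :: 'n \<Rightarrow> nat))"
    by (rule someI[where P="\<lambda>f. inj f"])
  show ?thesis
  proof (rule injI)
    fix i j :: "'n widx" assume "widx_code i = widx_code j"
    then have "of_widx i = of_widx j"
      unfolding widx_code_def by (rule injD[OF inj])
    then show "i = j" by (simp only: of_widx_inject)
  qed
qed

instance widx :: (finite) finite
proof
  have "inj (of_widx :: 'a widx \<Rightarrow> 'a)" by (simp add: inj_def of_widx_inject)
  then show "finite (UNIV :: 'a widx set)" by (rule finite_imageD[OF finite])
qed

instantiation widx :: (finite) wellorder
begin

definition less_eq_widx :: "'a widx \<Rightarrow> 'a widx \<Rightarrow> bool" where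
  "less_eq_widx i j \<longleftrightarrow> widx_code i \<le> widx_code j"

definition less_widx :: "'a widx \<Rightarrow> 'a widx \<Rightarrow> bool" where
  "less_widx i j \<longleftrightarrow> widx_code i < widx_code j"

instance
proof
  fix P :: "'a widx \<Rightarrow> bool" and a
  assume "\<And>i. (\<And>j. j < i \<Longrightarrow> P j) \<Longrightarrow> P i"
  then show "P a"
    unfolding less_widx_def by (induction "widx_code a" arbitrary: a rule: less_induct) blast
qed (auto simp: less_eq_widx_def less_widx_def dest: injD[OF inj_widx_code])

end

lemma of_to_widx [simp]: "of_widx (to_widx i) = i" and to_of_widx [simp]: "to_widx (of_widx j) = j"
  by (simp_all add: to_widx_inverse of_widx_inverse)

lemma bij_of_widx: "bij of_widx"
  by (rule bij_betw_byWitness[of _ to_widx]) auto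

lemma bij_to_widx: "bij to_widx"
  by (rule bij_betw_byWitness[of _ of_widx]) auto

lemma all_widx: "(\<forall>i. Q i) \<longleftrightarrow> (\<forall>j. Q (to_widx j))"
proof
  assume "\<forall>j. Q (to_widx j)"
  then have "Q (to_widx (of_widx i))" for i by blast
  then show "\<forall>i. Q i" by simp
qed blast

definition wvec :: "real^'n::finite \<Rightarrow> real^'n widx" where
  "wvec x = (\<chi> i. x $ of_widx i)"

definition unwvec :: "real^'n widx \<Rightarrow> real^'n::finite" where
  "unwvec z = (\<chi> i. z $ to_widx i)"

lemma wvec_inverse [simp]: "unwvec (wvec x) = x" and unwvec_inverse [simp]: "wvec (unwvec z) = z"
  by (simp_all add: wvec_def unwvec_def vec_eq_iff)

lemma mem_image_wvec: "z \<in> wvec ` X \<longleftrightarrow> unwvec z \<in> X"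
  by (auto intro: image_eqI[of _ _ "unwvec z"])

lemma bounded_linear_wvec: "bounded_linear wvec"
  unfolding linear_conv_bounded_linear[symmetric] by (rule linearI) (simp_all add: wvec_def vec_eq_iff)

lemma bounded_linear_unwvec: "bounded_linear unwvec"
  unfolding linear_conv_bounded_linear[symmetric] by (rule linearI) (simp_all add: unwvec_def vec_eq_iff)

lemma measurable_wvec [measurable]: "wvec \<in> borel_measurable borel"
  and measurable_unwvec [measurable]: "unwvec \<in> borel_measurable borel"
  by (auto intro!: borel_measurable_continuous_onI linear_continuous_on bounded_linear_wvec bounded_linear_unwvec)

lemma prod_Basis_vec:
  fixes x :: "real^'n::finite"
  shows "(\<Prod>b\<in>Basis. x \<bullet> b) = (\<Prod>i\<in>UNIV. x $ i)"
proof -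
  have "bij_betw (\<lambda>i. axis i 1) UNIV (Basis :: (real^'n) set)"
    by (auto simp: bij_betw_def inj_def axis_eq_axis Basis_vec_def)
  from prod.reindex_bij_betw[OF this, of "\<lambda>b. x \<bullet> b"] show ?thesis
    by (simp add: inner_axis)
qed

text \<open>Lebesgue measure is determined by its values on boxes, and renaming coordinates only
  permutes the factors of the volume of a box.\<close>

lemma lborel_wvec: "distr lborel borel wvec = (lborel :: (real^'n::finite widx) measure)"
proof (rule lborel_eqI[symmetric])
  fix l u :: "real^'n widx"
  assume lu: "\<And>b. b \<in> Basis \<Longrightarrow> l \<bullet> b \<le> u \<bullet> b"
  have lu': "l $ i \<le> u $ i" for i
    using lu[of "axis i 1"] by (simp add: inner_axis)
  have "wvec -` box l u = box (unwvec l) (unwvec u)"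
  proof -
    have "(\<forall>i. l $ i < x $ of_widx i \<and> x $ of_widx i < u $ i) \<longleftrightarrow>
        (\<forall>i. l $ to_widx i < x $ i \<and> x $ i < u $ to_widx i)" for x :: "real^'n"
      by (subst all_widx) (simp)
    then show ?thesis
      by (simp add: set_eq_iff mem_box_cart wvec_def unwvec_def)
  qed
  then have "emeasure (distr lborel borel wvec) (box l u) = emeasure lborel (box (unwvec l) (unwvec u))"
    by (subst emeasure_distr) auto
  also have "\<dots> = ennreal (\<Prod>b\<in>Basis. (unwvec u - unwvec l) \<bullet> b)"
  proof (rule emeasure_lborel_box)
    fix b :: "real^'n" assume "b \<in> Basis"
    then obtain i where "b = axis i 1" by (auto simp: Basis_vec_def)
    then show "unwvec l \<bullet> b \<le> unwvec u \<bullet> b" using lu' by (simp add: inner_axis unwvec_def)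
  qed
  also have "(\<Prod>b\<in>Basis. (unwvec u - unwvec l) \<bullet> b) = (\<Prod>b\<in>Basis. (u - l) \<bullet> b)"
    unfolding prod_Basis_vec
    by (rule prod.reindex_bij_witness[of _ of_widx to_widx])
      (auto simp: unwvec_def)
  finally show "emeasure (distr lborel borel wvec) (box l u) = ennreal (\<Prod>b\<in>Basis. (u - l) \<bullet> b)" .
qed simp

text \<open>Conjugation by the bijection of index types matches the permutations in the Leibniz
  formula and preserves signs.\<close>

lemma det_widx:
  fixes A :: "real^'n::finite^'n"
  shows "det (\<chi> i j. A $ of_widx i $ of_widx j) = det A"
proof -
  have "det A = (\<Sum>q | q permutes (UNIV :: 'n widx set). of_int (sign q) * (\<Prod>i\<in>UNIV. A $ of_widx i $ of_widx (q i)))"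
    unfolding det_def
  proof (rule sum.reindex_bij_witness[of _ "map_permutation UNIV of_widx" "map_permutation UNIV to_widx"])
    fix p :: "'n \<Rightarrow> 'n" assume p: "p \<in> {p. p permutes UNIV}"
    show "map_permutation UNIV of_widx (map_permutation UNIV to_widx p) = p"
      using p by (intro map_permutation_compose_inv[OF bij_to_widx]) (simp_all)
    show "map_permutation UNIV to_widx p \<in> {q. q permutes UNIV}"
      using p map_permutation_permutes[OF bij_to_widx] by simp
    have "sign (map_permutation UNIV to_widx p) = sign p"
      using p by (intro sign_map_permutation bij_is_inj[OF bij_to_widx]) simp_all
    moreover have "(\<Prod>i\<in>UNIV. A $ of_widx i $ of_widx (map_permutation UNIV to_widx p i)) = (\<Prod>i\<in>UNIV. A $ i $ p i)"
    proof (rule prod.reindex_bij_witness[of _ to_widx of_widx])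
      fix i :: "'n widx"
      have "map_permutation UNIV to_widx p (to_widx (of_widx i)) = to_widx (p (of_widx i))"
        by (intro map_permutation_apply bij_is_inj[OF bij_to_widx]) simp
      then show "A $ of_widx i $ p (of_widx i) = A $ of_widx i $ of_widx (map_permutation UNIV to_widx p i)"
        by simp
    qed auto
    ultimately show "of_int (sign (map_permutation UNIV to_widx p)) *
        (\<Prod>i\<in>UNIV. A $ of_widx i $ of_widx (map_permutation UNIV to_widx p i)) = of_int (sign p) * (\<Prod>i\<in>UNIV. A $ i $ p i)"
      by simp
  next
    fix q :: "'n widx \<Rightarrow> 'n widx" assume q: "q \<in> {q. q permutes UNIV}"
    show "map_permutation UNIV to_widx (map_permutation UNIV of_widx q) = q"
      using q by (intro map_permutation_compose_inv[OF bij_of_widx]) (simp_all)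
    show "map_permutation UNIV of_widx q \<in> {p. p permutes UNIV}"
      using q map_permutation_permutes[OF bij_of_widx] by simp
  qed
  then show ?thesis by (simp add: det_def)
qed

text \<open>Bridge between \<open>has_absolute_integral_change_of_variables\<close>, which is about
  absolutely integrable functions and gauge integrals, and the nonnegative integrals in which
  measures are expressed.\<close>

lemma absolutely_integrable_iff_nn_integral:
  fixes h :: "'b::euclidean_space \<Rightarrow> real"
  assumes meas: "(\<lambda>x. indicat_real S x * h x) \<in> borel_measurable borel"
    and nonneg: "\<And>x. x \<in> S \<Longrightarrow> 0 \<le> h x" and b: "0 \<le> b"
  shows "h absolutely_integrable_on S \<and> integral S h = b
    \<longleftrightarrow> (\<integral>\<^sup>+x. ennreal (indicat_real S x * h x) \<partial>lborel) = ennreal b"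
proof -
  have n: "0 \<le> indicat_real S x * h x" for x using nonneg by (auto simp: indicator_def)
  have eq: "(\<integral>\<^sup>+x. ennreal (indicat_real S x * h x) \<partial>lborel) = ennreal (integral S h)"
    if "h absolutely_integrable_on S"
  proof -
    have "integrable lebesgue (\<lambda>x. indicat_real S x * h x)"
      using that by (simp add: set_integrable_def)
    then have "(\<integral>\<^sup>+x. ennreal (indicat_real S x * h x) \<partial>lebesgue) = ennreal (LINT x|lebesgue. indicat_real S x * h x)"
      using n by (intro nn_integral_eq_integral) auto
    also have "(LINT x|lebesgue. indicat_real S x * h x) = integral S h"
      using set_lebesgue_integral_eq_integral(2)[OF that] by (simp add: set_lebesgue_integral_def)
    finally show ?thesis by (simp add: nn_integral_completion)
  qed
  have "h absolutely_integrable_on S" if "(\<integral>\<^sup>+x. ennreal (indicat_real S x * h x) \<partial>lborel) = ennreal b"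
  proof -
    have "integrable lborel (\<lambda>x. indicat_real S x * h x)"
      using meas n that by (intro integrableI_nn_integral_finite[where x=b]) auto
    then show ?thesis
      using meas by (simp add: set_integrable_def integrable_completion)
  qed
  moreover have "0 \<le> integral S h" if "h absolutely_integrable_on S"
    using that nonneg set_lebesgue_integral_eq_integral(1) by (intro integral_nonneg) auto
  ultimately show ?thesis
    using eq b by (auto simp: ennreal_inj)
qed

text \<open>The real-valued theorem says that one integral exists with value \<open>b\<close>
  exactly when the other does. Ranging over all \<open>b\<close> identifies the nonnegative
  integrals.\<close>

lemma nn_integral_change_of_variables_wellorder:
  fixes T :: "real^'n::{finite,wellorder} \<Rightarrow> real^'n::_"
  assumes S: "S \<in> sets borel"
    and der: "\<And>x. x \<in> S \<Longrightarrow> (T has_derivative T' x) (at x)"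
    and inj: "inj_on T S"
    and nonneg: "\<And>y. y \<in> T ` S \<Longrightarrow> 0 \<le> f y"
    and meas: "(\<lambda>y. indicat_real (T ` S) y * f y) \<in> borel_measurable borel"
      "(\<lambda>x. indicat_real S x * (\<bar>det (matrix (T' x))\<bar> * f (T x))) \<in> borel_measurable borel"
  shows "(\<integral>\<^sup>+y. ennreal (indicat_real (T ` S) y * f y) \<partial>lborel)
    = (\<integral>\<^sup>+x. ennreal (indicat_real S x * (\<bar>det (matrix (T' x))\<bar> * f (T x))) \<partial>lborel)"
    (is "?F = ?D")
proof -
  have "(\<lambda>x. \<bar>det (matrix (T' x))\<bar> *\<^sub>R vec (f (T x)) :: real^1) absolutely_integrable_on S \<and>
           integral S (\<lambda>x. \<bar>det (matrix (T' x))\<bar> *\<^sub>R vec (f (T x))) = (vec b :: real^1)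
         \<longleftrightarrow> (\<lambda>x. vec (f x) :: real^1) absolutely_integrable_on (T ` S) \<and>
           integral (T ` S) (\<lambda>x. vec (f x)) = (vec b :: real^1)" for b
    using S der inj by (intro has_absolute_integral_change_of_variables) (auto intro: has_derivative_at_withinI)
  then have "(\<lambda>x. \<bar>det (matrix (T' x))\<bar> * f (T x)) absolutely_integrable_on S \<and>
           integral S (\<lambda>x. \<bar>det (matrix (T' x))\<bar> * f (T x)) = b
         \<longleftrightarrow> f absolutely_integrable_on (T ` S) \<and> integral (T ` S) f = b" for b
    by (simp add: absolutely_integrable_on_1_iff integral_on_1_eq)
  then have *: "?D = ennreal b \<longleftrightarrow> ?F = ennreal b" if "0 \<le> b" for b
    using absolutely_integrable_iff_nn_integral[OF meas(1) nonneg that]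
      absolutely_integrable_iff_nn_integral[OF meas(2) _ that] nonneg by auto
  show ?thesis
  proof (cases ?D)
    case (real b)
    then show ?thesis using *[OF real(1)] by metis
  next
    case top
    \<comment> \<open>An infinite value is obtained by exclusion: a finite value of
      \<open>?F\<close> would be the value of \<open>?D\<close> too.\<close>
    have "?F \<noteq> ennreal b" if "0 \<le> b" for b
      using *[OF that] top by simp
    then show ?thesis using top by (cases ?F) auto
  qed
qed

text \<open>Conjugation with the relabelling of coordinates: \<open>wvec\<close> is a linear
  isomorphism that preserves Lebesgue measure, and the determinant of the derivative does not notice
  it.\<close>

lemma nn_integral_change_of_variables:
  fixes T :: "real^'n::finite \<Rightarrow> real^'n"
  assumes S: "S \<in> sets borel"
    and der: "\<And>x. x \<in> S \<Longrightarrow> (T has_derivative T' x) (at x)"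
    and inj: "inj_on T S"
    and nonneg: "\<And>y. y \<in> T ` S \<Longrightarrow> 0 \<le> f y"
    and meas: "(\<lambda>y. indicat_real (T ` S) y * f y) \<in> borel_measurable borel"
      "(\<lambda>x. indicat_real S x * (\<bar>det (matrix (T' x))\<bar> * f (T x))) \<in> borel_measurable borel"
  shows "(\<integral>\<^sup>+y. ennreal (indicat_real (T ` S) y * f y) \<partial>lborel)
    = (\<integral>\<^sup>+x. ennreal (indicat_real S x * (\<bar>det (matrix (T' x))\<bar> * f (T x))) \<partial>lborel)"
proof -
  define V where "V = wvec \<circ> T \<circ> unwvec"
  define V' where "V' z = wvec \<circ> T' (unwvec z) \<circ> unwvec" for z
  let ?S = "wvec ` S"
  have mem: "z \<in> ?S \<longleftrightarrow> unwvec z \<in> S" for z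
    by (rule mem_image_wvec)
  then have S_eq: "?S = unwvec -` S" by auto
  have VS: "V ` ?S = wvec ` T ` S" by (auto simp: V_def image_comp)
  have memV: "z \<in> V ` ?S \<longleftrightarrow> unwvec z \<in> T ` S" for z
    unfolding VS by (rule mem_image_wvec)
  have ind: "indicat_real ?S z = indicat_real S (unwvec z)" "indicat_real (V ` ?S) z = indicat_real (T ` S) (unwvec z)" for z
    using mem memV by (auto simp: indicator_def)
  have det: "det (matrix (V' z)) = det (matrix (T' (unwvec z)))" for z
  proof -
    have ax: "unwvec (axis j 1) = axis (of_widx j) 1" for j :: "'n widx"
      by (auto simp: unwvec_def axis_def vec_eq_iff)
    have "matrix (V' z) = (\<chi> i j. matrix (T' (unwvec z)) $ of_widx i $ of_widx j)"
      by (simp add: matrix_def V'_def wvec_def ax)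
    then show ?thesis by (simp add: det_widx)
  qed
  have tr: "(\<integral>\<^sup>+x. h x \<partial>(lborel :: (real^'n) measure)) = (\<integral>\<^sup>+z. h (unwvec z) \<partial>lborel)"
    if "h \<in> borel_measurable borel" for h
  proof -
    have "(\<integral>\<^sup>+z. h (unwvec z) \<partial>lborel) = (\<integral>\<^sup>+z. h (unwvec z) \<partial>distr (lborel :: (real^'n) measure) borel wvec)"
      by (subst lborel_wvec) (rule refl)
    also have "\<dots> = (\<integral>\<^sup>+x. h (unwvec (wvec x)) \<partial>lborel)"
      by (rule nn_integral_distr) (use that measurable_compose[OF measurable_unwvec] in auto)
    finally show ?thesis by simp
  qed
  have "(\<integral>\<^sup>+z. ennreal (indicat_real (V ` ?S) z * f (unwvec z)) \<partial>lborel)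
    = (\<integral>\<^sup>+z. ennreal (indicat_real ?S z * (\<bar>det (matrix (V' z))\<bar> * f (unwvec (V z)))) \<partial>lborel)"
  proof (rule nn_integral_change_of_variables_wellorder[where T=V and T'=V' and S="?S" and f="\<lambda>z. f (unwvec z)"])
    show "?S \<in> sets borel"
      unfolding S_eq using measurable_sets[OF measurable_unwvec S] by simp
    show "(V has_derivative V' z) (at z)" if "z \<in> ?S" for z
    proof -
      have "unwvec z \<in> S" using that mem by blast
      from diff_chain_at[OF bounded_linear_imp_has_derivative[OF bounded_linear_unwvec] der[OF this]]
      have "(T \<circ> unwvec has_derivative T' (unwvec z) \<circ> unwvec) (at z)" .
      from diff_chain_at[OF this bounded_linear_imp_has_derivative[OF bounded_linear_wvec]]
      show ?thesis by (simp add: V_def V'_def o_assoc)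
    qed
    show "inj_on V ?S"
    proof (rule inj_onI)
      fix z w assume *: "z \<in> ?S" "w \<in> ?S" "V z = V w"
      then have "T (unwvec z) = T (unwvec w)" unfolding V_def o_def by (metis wvec_inverse)
      then have "unwvec z = unwvec w" using inj * mem by (auto dest: inj_onD)
      then show "z = w" by (metis unwvec_inverse)
    qed
    show "0 \<le> f (unwvec z)" if "z \<in> V ` ?S" for z
      using that memV nonneg by blast
    show "(\<lambda>z. indicat_real (V ` ?S) z * f (unwvec z)) \<in> borel_measurable borel"
      unfolding ind using measurable_compose[OF measurable_unwvec meas(1)] by simp
    show "(\<lambda>z. indicat_real ?S z * (\<bar>det (matrix (V' z))\<bar> * f (unwvec (V z)))) \<in> borel_measurable borel"
      unfolding ind det using measurable_compose[OF measurable_unwvec meas(2)] by (simp add: V_def)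
  qed
  moreover have "(\<integral>\<^sup>+y. ennreal (indicat_real (T ` S) y * f y) \<partial>lborel)
      = (\<integral>\<^sup>+z. ennreal (indicat_real (V ` ?S) z * f (unwvec z)) \<partial>lborel)"
    unfolding ind by (rule tr) (use meas(1) in measurable)
  moreover have "(\<integral>\<^sup>+x. ennreal (indicat_real S x * (\<bar>det (matrix (T' x))\<bar> * f (T x))) \<partial>lborel)
      = (\<integral>\<^sup>+z. ennreal (indicat_real ?S z * (\<bar>det (matrix (V' z))\<bar> * f (unwvec (V z)))) \<partial>lborel)"
    unfolding ind det by (subst tr) (use meas(2) in \<open>auto simp: V_def\<close>)
  ultimately show ?thesis by simp
qed

context chart_change
begin

text \<open>The metric pairing of two differentials is the same in both charts. Only first
  derivatives at the point are involved, so differentiability of the functions there is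
  enough.\<close>

lemma gdot_law:
  assumes y: "y \<in> U" and u: "u d differentiable (at (T y))" "\<And>z. z \<in> U \<Longrightarrow> u c z = u d (T z)"
    and v: "v d differentiable (at (T y))" "\<And>z. z \<in> U \<Longrightarrow> v c z = v d (T z)"
  shows "(\<Sum>j\<in>UNIV. \<Sum>k\<in>UNIV. ginv g c j k y * pd j (v c) y * pd k (u c) y)
    = (\<Sum>j\<in>UNIV. \<Sum>k\<in>UNIV. ginv g d j k (T y) * pd j (v d) (T y) * pd k (u d) (T y))"
proof -
  have pu: "pd k (u c) y = (\<Sum>b\<in>UNIV. J b k y * pd b (u d) (T y))" for k
    using pd_cong[OF open_U y u(2)] pd_comp_T(1)[OF u(1) y] by simp
  have pv: "pd k (v c) y = (\<Sum>b\<in>UNIV. J b k y * pd b (v d) (T y))" for k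
    using pd_cong[OF open_U y v(2)] pd_comp_T(1)[OF v(1) y] by simp
  have "(\<Sum>j\<in>UNIV. \<Sum>k\<in>UNIV. ginv g c j k y * pd j (v c) y * pd k (u c) y)
      = (\<Sum>j\<in>UNIV. \<Sum>k\<in>UNIV. \<Sum>a\<in>UNIV. \<Sum>b\<in>UNIV. (J a j y * ginv g c j k y * J b k y) * (pd a (v d) (T y) * pd b (u d) (T y)))"
  proof (rule sum.cong[OF refl], rule sum.cong[OF refl])
    fix j k
    have "ginv g c j k y * pd j (v c) y * pd k (u c) y
        = ginv g c j k y * ((\<Sum>a\<in>UNIV. J a j y * pd a (v d) (T y)) * (\<Sum>b\<in>UNIV. J b k y * pd b (u d) (T y)))"
      by (simp add: pu pv)
    also have "\<dots> = (\<Sum>a\<in>UNIV. \<Sum>b\<in>UNIV. (J a j y * ginv g c j k y * J b k y) * (pd a (v d) (T y) * pd b (u d) (T y)))"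
      unfolding sum_product by (simp add: sum_distrib_left mult_ac)
    finally show "ginv g c j k y * pd j (v c) y * pd k (u c) y = \<dots>" .
  qed
  also have "\<dots> = (\<Sum>a\<in>UNIV. \<Sum>b\<in>UNIV. ginv g d a b (T y) * (pd a (v d) (T y) * pd b (u d) (T y)))"
    by (subst sum_swap4) (simp only: ginv_J[OF y] flip: sum_distrib_right)
  finally show ?thesis by (simp add: mult.assoc)
qed

end

section \<open>Closed Riemannian manifolds\<close>

definition overlap :: "('a, 'n::finite) chart \<Rightarrow> ('a, 'n) chart \<Rightarrow> (real^'n) set" where
  "overlap c d = snd c ` (fst c \<inter> fst d)"

definition tensor :: "('a, 'n::finite) chart set \<Rightarrow> nat \<Rightarrow> ('a, 'n) field \<Rightarrow> bool" where
  "tensor A p \<phi> \<longleftrightarrow> (\<forall>c\<in>A. smooth_comp c p \<phi>) \<and>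
     (\<forall>c\<in>A. \<forall>d\<in>A. chart_change.tlaw c d (overlap c d) (transition c d) p \<phi>)"

text \<open>Continuity is the right regularity for integrands: pairings of gradients with the
  partition functions are merely continuous.\<close>

definition scalar :: "('a, 'n::finite) chart set \<Rightarrow> (('a, 'n) chart \<Rightarrow> real^'n \<Rightarrow> real) \<Rightarrow> bool" where
  "scalar A f \<longleftrightarrow> (\<forall>c\<in>A. continuous_on (chart_image c) (f c)) \<and>
     (\<forall>c\<in>A. \<forall>d\<in>A. \<forall>x\<in>fst c \<inter> fst d. f c (snd c x) = f d (snd d x))"

lemma scalarI:
  assumes "\<And>c. c \<in> A \<Longrightarrow> continuous_on (chart_image c) (f c)"
    and "\<And>c d x. c \<in> A \<Longrightarrow> d \<in> A \<Longrightarrow> x \<in> fst c \<Longrightarrow> x \<in> fst d \<Longrightarrow> f c (snd c x) = f d (snd d x)"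
  shows "scalar A f"
  unfolding scalar_def
proof (intro conjI ballI)
  fix c d x assume "c \<in> A" "d \<in> A" "x \<in> fst c \<inter> fst d"
  then show "f c (snd c x) = f d (snd d x)" by (intro assms(2)) auto
qed (rule assms(1))

lemma scalar_continuous: "scalar A f \<Longrightarrow> c \<in> A \<Longrightarrow> continuous_on (chart_image c) (f c)"
  and scalar_law: "scalar A f \<Longrightarrow> c \<in> A \<Longrightarrow> d \<in> A \<Longrightarrow> x \<in> fst c \<Longrightarrow> x \<in> fst d \<Longrightarrow> f c (snd c x) = f d (snd d x)"
  unfolding scalar_def by (blast, blast)

lemma scalar_at_eq:
  assumes "scalar A f" "c \<in> A" "x \<in> fst c"
  shows "scalar_at A f x = f c (snd c x)"
proof -
  let ?d = "SOME d. d \<in> A \<and> x \<in> fst d"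
  have "?d \<in> A \<and> x \<in> fst ?d" by (rule someI[of _ c]) (use assms in simp)
  then have "f ?d (snd ?d x) = f c (snd c x)"
    using assms by (intro scalar_law[OF assms(1)]) auto
  then show ?thesis unfolding scalar_at_def Let_def .
qed

text \<open>The chart chosen at \<open>x\<close> depends on \<open>x\<close> but not on the
  integrand. A pointwise identity in every chart therefore passes to \<open>scalar_at\<close> for
  all functions involved simultaneously.\<close>

lemma scalar_at_chart:
  assumes "\<exists>c\<in>A. x \<in> fst c"
  shows "\<exists>c\<in>A. x \<in> fst c \<and> (\<forall>f. scalar_at A f x = f c (snd c x))"
proof -
  let ?d = "SOME d. d \<in> A \<and> x \<in> fst d"
  have d: "?d \<in> A \<and> x \<in> fst ?d"
    by (rule someI_ex) (use assms in blast)
  show ?thesis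
    by (rule bexI[of _ ?d]) (use d in \<open>simp_all add: scalar_at_def Let_def\<close>)
qed

locale closed_riemannian =
  fixes M :: "'a::t2_space set" and A :: "('a, 'n::finite) chart set" and g :: "('a, 'n) field"
  assumes compact_M: "compact M" and atlas: "smooth_atlas M A" and metric: "riemannian_metric A g"
begin

lemma charts_cover: "(\<Union>c\<in>A. fst c) = M"
  using atlas by (simp add: smooth_atlas_def)

context
  fixes c assumes c: "c \<in> A"
begin

lemma chart_openin: "openin (top_of_set M) (fst c)" and open_image: "open (chart_image c)"
  and chart_homeomorphism: "homeomorphism (fst c) (chart_image c) (snd c) (chart_inv c)"
proof -
  from atlas have "\<forall>c\<in>A. openin (top_of_set M) (fst c) \<and> open (chart_image c) \<and>
        homeomorphism (fst c) (chart_image c) (snd c) (chart_inv c)"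
    unfolding smooth_atlas_def by (elim conjE)
  from bspec[OF this c] show "openin (top_of_set M) (fst c)" "open (chart_image c)"
    "homeomorphism (fst c) (chart_image c) (snd c) (chart_inv c)" by simp_all
qed

lemma chart_subset: "fst c \<subseteq> M"
  by (rule openin_imp_subset[OF chart_openin])

lemma chart_inv_snd: "x \<in> fst c \<Longrightarrow> chart_inv c (snd c x) = x"
  and snd_in_image: "x \<in> fst c \<Longrightarrow> snd c x \<in> chart_image c"
  and snd_chart_inv: "y \<in> chart_image c \<Longrightarrow> snd c (chart_inv c y) = y"
  and chart_inv_in: "y \<in> chart_image c \<Longrightarrow> chart_inv c y \<in> fst c"
proof -
  note h = chart_homeomorphism
  show "x \<in> fst c \<Longrightarrow> chart_inv c (snd c x) = x" by (rule homeomorphism_apply1[OF h])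
  show "x \<in> fst c \<Longrightarrow> snd c x \<in> chart_image c" by (simp add: chart_image_def)
  show "y \<in> chart_image c \<Longrightarrow> snd c (chart_inv c y) = y" by (rule homeomorphism_apply2[OF h])
  show "y \<in> chart_image c \<Longrightarrow> chart_inv c y \<in> fst c"
    using homeomorphism_image2[OF h] imageI[of y "chart_image c" "chart_inv c"] by simp
qed

lemma continuous_chart_inv: "continuous_on (chart_image c) (chart_inv c)"
  and continuous_chart: "continuous_on (fst c) (snd c)"
  by (rule homeomorphism_cont2[OF chart_homeomorphism], rule homeomorphism_cont1[OF chart_homeomorphism])

lemma chart_metric: "chart_metric g c"
proof
  have "g \<in> sym_tensor_fields A 2"
    and pos: "\<forall>c\<in>A. \<forall>y\<in>chart_image c. \<forall>v. v \<noteq> 0 \<longrightarrow> v \<bullet> (metric_matrix g c y *v v) > 0"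
    using metric unfolding riemannian_metric_def by blast+
  then have sm: "\<forall>c\<in>A. \<forall>is. length is = 2 \<longrightarrow> smooth_on (chart_image c) (g c is)"
    and sym: "\<forall>c\<in>A. \<forall>is js. \<forall>y\<in>chart_image c. length is = 2 \<longrightarrow> mset is = mset js \<longrightarrow> g c is y = g c js y"
    unfolding sym_tensor_fields_def by blast+
  show "open (chart_image c)" by (rule open_image)
  show "smooth_on (chart_image c) (g c [i, j])" for i j
    using bspec[OF sm c] by simp
  show "g c [i, j] y = g c [j, i] y" if y: "y \<in> chart_image c" for i j y
  proof -
    have "length [i, j] = 2" "mset [i, j] = mset [j, i]" by simp_all
    then show ?thesis using bspec[OF sym c] y by blast
  qed
  show "0 < v \<bullet> (metric_matrix g c y *v v)" if "y \<in> chart_image c" "v \<noteq> 0" for y v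
    using bspec[OF pos c] that by blast
qed

lemma overlap_open: assumes d: "d \<in> A" shows "open (overlap c d)"
proof -
  have "openin (top_of_set M) (fst c \<inter> fst d)"
    by (rule openin_Int[OF chart_openin]) (use atlas d in \<open>unfold smooth_atlas_def, blast\<close>)
  then have "openin (top_of_set (fst c)) (fst c \<inter> fst d)"
    by (rule openin_subset_trans) (use chart_subset in auto)
  then have "openin (top_of_set (chart_image c)) (overlap c d)"
    unfolding overlap_def by (rule homeomorphism_imp_open_map[OF chart_homeomorphism])
  then show ?thesis using open_image openin_open_trans by blast
qed

end

lemma transition_snd: "c \<in> A \<Longrightarrow> x \<in> fst c \<Longrightarrow> transition c d (snd c x) = snd d x"
  by (simp add: transition_def chart_inv_snd)

lemma chart_change:
  assumes c: "c \<in> A" and d: "d \<in> A"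
  shows "chart_change g c d (overlap c d) (transition c d)"
proof (intro chart_change.intro chart_metric c d chart_change_axioms.intro)
  show "open (overlap c d)" by (rule overlap_open[OF c d])
  show "overlap c d \<subseteq> chart_image c" by (auto simp: overlap_def chart_image_def)
  show "transition c d ` overlap c d \<subseteq> chart_image d"
    by (auto simp: overlap_def transition_snd[OF c] snd_in_image[OF d])
  show sm: "smooth_on (overlap c d) (\<lambda>y. transition c d y $ a)" for a
    using atlas c d unfolding smooth_atlas_def overlap_def by blast
  fix y i j assume y: "y \<in> overlap c d"
  then obtain x where x: "x \<in> fst c \<inter> fst d" "y = snd c x" by (auto simp: overlap_def)
  have jac: "jacobian (transition c d) (at y) $ a $ k = pd k (\<lambda>y. transition c d y $ a) y" for a k
    by (rule jacobian_pd(1)) (rule smooth_on_differentiable[OF sm overlap_open[OF c d] y])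
  have "g \<in> sym_tensor_fields A 2" using metric by (simp add: riemannian_metric_def)
  then have "g c [i, j] (snd c x) = (\<Sum>js | length js = 2.
      (\<Prod>k<2. jacobian (transition c d) (at (snd c x)) $ (js ! k) $ ([i, j] ! k)) * g d js (snd d x))"
  proof -
    have "length [i, j] = 2" by simp
    with \<open>g \<in> _\<close> c d x show ?thesis unfolding sym_tensor_fields_def by blast
  qed
  then show "g c [i, j] y = (\<Sum>a\<in>UNIV. \<Sum>b\<in>UNIV. pd i (\<lambda>y. transition c d y $ a) y *
      pd j (\<lambda>y. transition c d y $ b) y * g d [a, b] (transition c d y))"
    using x by (simp add: numeral_2_eq_2 sum_idx_Suc jac[unfolded x] transition_snd[OF c])
qed

section \<open>Tensor fields on the manifold\<close>

lemma tensorD: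
  "tensor A p \<phi> \<Longrightarrow> c \<in> A \<Longrightarrow> smooth_comp c p \<phi>"
  "tensor A p \<phi> \<Longrightarrow> c \<in> A \<Longrightarrow> d \<in> A \<Longrightarrow> chart_change.tlaw c d (overlap c d) (transition c d) p \<phi>"
  by (simp_all add: tensor_def)

lemma sym_tensor_fieldsD:
  assumes "\<phi> \<in> sym_tensor_fields A p"
  shows "tensor A p \<phi>" and "\<And>c. c \<in> A \<Longrightarrow> sym_comp c p \<phi>"
proof -
  show "sym_comp c p \<phi>" if "c \<in> A" for c
    using assms that unfolding sym_tensor_fields_def sym_comp_def by blast
  have "chart_change.tlaw c d (overlap c d) (transition c d) p \<phi>" if c: "c \<in> A" and d: "d \<in> A" for c d
  proof -
    interpret chart_change g c d "overlap c d" "transition c d" using chart_change[OF c d] .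
    show ?thesis
      unfolding tlaw_def
    proof (intro ballI allI impI)
      fix y and I :: "'n list" assume y: "y \<in> overlap c d" and I: "length I = p"
      then obtain x where x: "x \<in> fst c \<inter> fst d" "y = snd c x" by (auto simp: overlap_def)
      have jac: "jacobian (transition c d) (at y) $ a $ k = J a k y" for a k
        unfolding J_def by (rule jacobian_pd(1)) (rule differentiable_T[OF y])
      have "\<phi> c I (snd c x) = (\<Sum>js | length js = p.
          (\<Prod>k<p. jacobian (transition c d) (at (snd c x)) $ (js ! k) $ (I ! k)) * \<phi> d js (snd d x))"
        using assms c d x I unfolding sym_tensor_fields_def by blast
      then show "\<phi> c I y = (\<Sum>K | length K = p. tpow p (\<lambda>i a. J a i y) I K * \<phi> d K (transition c d y))"
        using x by (simp add: tpow_def jac[unfolded x] transition_snd[OF c])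
    qed
  qed
  then show "tensor A p \<phi>"
    using assms unfolding tensor_def sym_tensor_fields_def smooth_comp_def by blast
qed

lemma tensor_nabla: assumes \<phi>: "tensor A p \<phi>" shows "tensor A (Suc p) (nabla g \<phi>)"
  unfolding tensor_def
proof (intro conjI ballI)
  show "smooth_comp c (Suc p) (nabla g \<phi>)" if c: "c \<in> A" for c
    by (rule chart_metric.smooth_comp_nabla[OF chart_metric[OF c] tensorD(1)[OF \<phi> c]])
  show "chart_change.tlaw c d (overlap c d) (transition c d) (Suc p) (nabla g \<phi>)"
    if c: "c \<in> A" and d: "d \<in> A" for c d
    by (rule chart_change.tlaw_nabla[OF chart_change[OF c d] tensorD(2)[OF \<phi> c d] tensorD(1)[OF \<phi> d]])
qed

lemma tensor_trace2: assumes \<phi>: "tensor A (Suc (Suc p)) \<phi>" shows "tensor A p (trace2 g \<phi>)"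
  unfolding tensor_def
proof (intro conjI ballI)
  show "smooth_comp c p (trace2 g \<phi>)" if c: "c \<in> A" for c
    by (rule chart_metric.smooth_comp_trace2[OF chart_metric[OF c] tensorD(1)[OF \<phi> c]])
  show "chart_change.tlaw c d (overlap c d) (transition c d) p (trace2 g \<phi>)"
    if c: "c \<in> A" and d: "d \<in> A" for c d
    by (rule chart_change.tlaw_trace2[OF chart_change[OF c d] tensorD(2)[OF \<phi> c d]])
qed

lemma tensor_lswap:
  assumes \<phi>: "tensor A p \<phi>" and ab: "a < p" "b < p"
  shows "tensor A p (\<lambda>c I. \<phi> c (lswap a b I))"
  unfolding tensor_def
proof (intro conjI ballI)
  show "smooth_comp c p (\<lambda>c I. \<phi> c (lswap a b I))" if c: "c \<in> A" for c
    by (rule smooth_comp_lswap[OF tensorD(1)[OF \<phi> c]])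
  show "chart_change.tlaw c d (overlap c d) (transition c d) p (\<lambda>c I. \<phi> c (lswap a b I))"
    if c: "c \<in> A" and d: "d \<in> A" for c d
    by (rule chart_change.tlaw_lswap[OF chart_change[OF c d] tensorD(2)[OF \<phi> c d] ab])
qed

lemma tensor_diff:
  assumes \<phi>: "tensor A p \<phi>" and \<psi>: "tensor A p \<psi>"
  shows "tensor A p (\<lambda>c I y. \<phi> c I y - \<psi> c I y)"
  unfolding tensor_def
proof (intro conjI ballI)
  show "smooth_comp c p (\<lambda>c I y. \<phi> c I y - \<psi> c I y)" if c: "c \<in> A" for c
    using tensorD(1)[OF \<phi> c] tensorD(1)[OF \<psi> c] unfolding smooth_comp_def
    by (intro allI impI smooth_on_diff open_image c) auto
  show "chart_change.tlaw c d (overlap c d) (transition c d) p (\<lambda>c I y. \<phi> c I y - \<psi> c I y)"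
    if c: "c \<in> A" and d: "d \<in> A" for c d
    by (rule chart_change.tlaw_diff[OF chart_change[OF c d] tensorD(2)[OF \<phi> c d] tensorD(2)[OF \<psi> c d]])
qed

lemma tensor_sum:
  assumes \<phi>: "\<And>a. a \<in> X \<Longrightarrow> tensor A p (\<phi> a)"
  shows "tensor A p (\<lambda>c I y. \<Sum>a\<in>X. \<phi> a c I y)"
  unfolding tensor_def
proof (intro conjI ballI)
  show "smooth_comp c p (\<lambda>c I y. \<Sum>a\<in>X. \<phi> a c I y)" if c: "c \<in> A" for c
    using tensorD(1)[OF \<phi> c] unfolding smooth_comp_def
    by (intro allI impI smooth_on_sum open_image c) auto
  show "chart_change.tlaw c d (overlap c d) (transition c d) p (\<lambda>c I y. \<Sum>a\<in>X. \<phi> a c I y)"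
    if c: "c \<in> A" and d: "d \<in> A" for c d
    by (rule chart_change.tlaw_sum[OF chart_change[OF c d] tensorD(2)[OF \<phi> c d]])
qed

lemma tensor_cong:
  assumes \<psi>: "tensor A p \<psi>"
    and eq: "\<And>c I y. c \<in> A \<Longrightarrow> length I = p \<Longrightarrow> y \<in> chart_image c \<Longrightarrow> \<phi> c I y = \<psi> c I y"
  shows "tensor A p \<phi>"
  unfolding tensor_def
proof (intro conjI ballI)
  show "smooth_comp c p \<phi>" if c: "c \<in> A" for c
    using tensorD(1)[OF \<psi> c] eq[OF c] smooth_on_cong[OF open_image[OF c]]
    unfolding smooth_comp_def by blast
  show "chart_change.tlaw c d (overlap c d) (transition c d) p \<phi>"
    if c: "c \<in> A" and d: "d \<in> A" for c d
    by (rule chart_change.tlaw_cong[OF chart_change[OF c d] tensorD(2)[OF \<psi> c d]]) (use eq c d in auto)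
qed

lemma smooth_on_tdot:
  assumes "tensor A p \<phi>" "tensor A p \<psi>" and c: "c \<in> A"
  shows "smooth_on (chart_image c) (tdot g p \<phi> \<psi> c)"
  unfolding tdot_def[abs_def] tpow_def
  using assms tensorD(1)[OF assms(1) c] tensorD(1)[OF assms(2) c]
  by (intro smooth_on_sum smooth_on_mult smooth_on_prod open_image c
      chart_metric.smooth_H[OF chart_metric[OF c]]) (auto simp: smooth_comp_def)

lemma scalar_tdot:
  assumes \<phi>: "tensor A p \<phi>" and \<psi>: "tensor A p \<psi>"
  shows "scalar A (tdot g p \<phi> \<psi>)"
proof (rule scalarI)
  show "continuous_on (chart_image c) (tdot g p \<phi> \<psi> c)" if "c \<in> A" for c
    by (rule smooth_on_continuous[OF smooth_on_tdot[OF \<phi> \<psi> that]])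
  fix c d x assume cd: "c \<in> A" "d \<in> A" and x: "x \<in> fst c" "x \<in> fst d"
  then have "snd c x \<in> overlap c d" by (auto simp: overlap_def)
  from chart_change.tdot_law[OF chart_change[OF cd] tensorD(2)[OF \<phi> cd] tensorD(2)[OF \<psi> cd] this]
  show "tdot g p \<phi> \<psi> c (snd c x) = tdot g p \<phi> \<psi> d (snd d x)"
    using x cd by (simp add: transition_snd)
qed

lemma tensor_yano:
  assumes \<phi>: "\<phi> \<in> sym_tensor_fields A p"
  shows "tensor A p (yano_laplacian g \<phi>)" "tensor A p (B_op g \<phi>)"
proof -
  note T = sym_tensor_fieldsD(1)[OF \<phi>]
  let ?W = "nabla g (nabla g \<phi>)"
  have W: "tensor A (Suc (Suc p)) ?W" by (intro tensor_nabla T)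
  \<comment> \<open>Slots 0 and 1 hold the two differentiation indices and slot \<open>k + 2\<close>
    the index of \<phi> at position \<open>k\<close>. Transposing slots 1 and \<open>k + 2\<close>
    yields one ordering of the commutator; a preceding transposition of 0 and \<open>k + 2\<close>
    yields the other. So the commutator is built from operations that preserve the tensor
    law.\<close>
  let ?V1 = "\<lambda>k c L. ?W c (lswap (Suc 0) (Suc (Suc k)) L)"
  have V1: "tensor A (Suc (Suc p)) (?V1 k)" if "k < p" for k
    using that by (intro tensor_lswap[OF W]) auto
  have "tensor A (Suc (Suc p)) (\<lambda>c L. ?V1 k c (lswap 0 (Suc (Suc k)) L))" if "k < p" for k
    using that by (intro tensor_lswap[OF V1]) auto
  then have V2: "tensor A (Suc (Suc p)) (\<lambda>c L. ?V1 k c (lswap 0 (Suc (Suc k)) L))" if "k < p" for k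
    using that by blast
  have sw1: "lswap (Suc 0) (Suc (Suc k)) (j # i # I) = j # I ! k # I[k := i]" if "k < length I" for i j k and I :: "'n list"
    using that by (simp add: lswap_def)
  have sw2: "lswap (Suc 0) (Suc (Suc k)) (lswap 0 (Suc (Suc k)) (j # i # I)) = I ! k # j # I[k := i]"
    if "k < length I" for i j k and I :: "'n list"
    using that by (simp add: lswap_def)
  define B where "B c I y = (\<Sum>k<p. trace2 g (\<lambda>c L y. ?V1 k c L y - ?V1 k c (lswap 0 (Suc (Suc k)) L) y) c I y)" for c I y
  have B: "tensor A p B"
    unfolding B_def[abs_def]
    by (intro tensor_sum tensor_trace2 tensor_diff V1 V2) simp_all
  have "B_op g \<phi> c I y = B c I y" if c: "c \<in> A" and I: "length I = p" and y: "y \<in> chart_image c" for c I y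
    unfolding chart_metric.B_op_commutator[OF chart_metric[OF c] tensorD(1)[OF T c] y I] B_def trace2_def
    using I by (intro sum.cong refl) (simp add: sw1 sw2)
  then show B': "tensor A p (B_op g \<phi>)"
    by (rule tensor_cong[OF B])
  \<comment> \<open>The empty sum is the zero tensor.\<close>
  have "tensor A p (\<lambda>c I y. (\<Sum>a\<in>{}. \<phi> c I y) - trace2 g ?W c I y - B_op g \<phi> c I y)"
    by (intro tensor_diff tensor_sum tensor_trace2 W B') simp
  then show "tensor A p (yano_laplacian g \<phi>)"
    by (rule tensor_cong)
      (simp add: chart_metric.yano_pointwise[OF chart_metric tensorD(1)[OF T] sym_tensor_fieldsD(2)[OF \<phi>]])
qed

text \<open>The chosen chart may jump from point to point, but on the domain of one fixed chart
  \<open>scalar_at\<close> equals the continuous expression in that chart.\<close>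

lemma continuous_on_scalar_at:
  assumes f: "scalar A f"
  shows "continuous_on M (scalar_at A f)"
  unfolding continuous_on_eq_continuous_within
proof
  fix x assume "x \<in> M"
  then obtain c where c: "c \<in> A" "x \<in> fst c" using charts_cover by blast
  obtain V where V: "open V" "fst c = M \<inter> V"
    using chart_openin[OF c(1)] by (auto simp: openin_open)
  have "continuous_on (fst c) (\<lambda>x. f c (snd c x))"
    by (rule continuous_on_compose2[OF scalar_continuous[OF f c(1)] continuous_chart[OF c(1)]])
      (use snd_in_image[OF c(1)] in auto)
  then have "continuous_on (fst c) (scalar_at A f)"
    by (rule continuous_on_eq) (simp add: scalar_at_eq[OF f c(1)])
  then have "continuous (at x within fst c) (scalar_at A f)"
    using c by (simp add: continuous_on_eq_continuous_within)
  moreover have "at x within M = at x within fst c"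
    by (rule at_within_nhd[of x V]) (use V c in auto)
  ultimately show "continuous (at x within M) (scalar_at A f)" by simp
qed

end

section \<open>The Riemannian measure\<close>

definition vol_density :: "('a, 'n::finite) field \<Rightarrow> ('a, 'n) chart \<Rightarrow> real^'n \<Rightarrow> real" where
  "vol_density g c y = sqrt (det (metric_matrix g c y))"

text \<open>The pushforward of the density to all of \<open>M\<close>, although it lives on the
  domain of \<open>c\<close>. All chart measures thus share one sigma-algebra and can be
  added.\<close>

definition chart_measure ::
    "'a::topological_space set \<Rightarrow> ('a, 'n::finite) field \<Rightarrow> ('a, 'n) chart \<Rightarrow> 'a measure" where
  "chart_measure M g c = distr (density (restrict_space lborel (chart_image c)) (\<lambda>y. ennreal (vol_density g c y)))
     (restrict_space borel M) (chart_inv c)"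

context closed_riemannian
begin

abbreviation "Bo \<equiv> restrict_space borel M"

lemma vol_nonneg: "c \<in> A \<Longrightarrow> y \<in> chart_image c \<Longrightarrow> 0 \<le> vol_density g c y"
  unfolding vol_density_def using chart_metric.det_pos[OF chart_metric, of c y] by simp

lemma smooth_vol_density: "c \<in> A \<Longrightarrow> smooth_on (chart_image c) (vol_density g c)"
  unfolding vol_density_def[abs_def] by (rule chart_metric.smooth_vol[OF chart_metric])

lemma measurable_chart_inv:
  assumes c: "c \<in> A"
  shows "chart_inv c \<in> measurable (restrict_space borel (chart_image c)) Bo"
proof (rule measurable_restrict_space2)
  show "chart_inv c \<in> space (restrict_space borel (chart_image c)) \<rightarrow> M"
    using chart_inv_in[OF c] chart_subset[OF c] by (auto simp: space_restrict_space)
  show "chart_inv c \<in> borel_measurable (restrict_space borel (chart_image c))"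
    by (rule borel_measurable_continuous_on_restrict[OF continuous_chart_inv[OF c]])
qed

lemma measurable_vol: "c \<in> A \<Longrightarrow> vol_density g c \<in> borel_measurable (restrict_space borel (chart_image c))"
  by (rule borel_measurable_continuous_on_restrict[OF smooth_on_continuous[OF smooth_vol_density]])

lemma sets_chart: assumes c: "c \<in> A" shows "fst c \<in> sets Bo"
proof -
  obtain V where "open V" "fst c = M \<inter> V"
    using chart_openin[OF c] by (auto simp: openin_open)
  then show ?thesis by (auto simp: sets_restrict_space)
qed

lemma image_chart_eq:
  assumes c: "c \<in> A"
  shows "snd c ` (X \<inter> fst c) = chart_inv c -` X \<inter> chart_image c"
proof (intro set_eqI iffI)
  fix y assume "y \<in> snd c ` (X \<inter> fst c)"
  then show "y \<in> chart_inv c -` X \<inter> chart_image c"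
    using chart_inv_snd[OF c] snd_in_image[OF c] by auto
next
  fix y assume y: "y \<in> chart_inv c -` X \<inter> chart_image c"
  then have "y = snd c (chart_inv c y)" "chart_inv c y \<in> X \<inter> fst c"
    using snd_chart_inv[OF c] chart_inv_in[OF c] by auto
  then show "y \<in> snd c ` (X \<inter> fst c)" by (rule image_eqI)
qed

lemma sets_image_chart:
  assumes c: "c \<in> A" and X: "X \<in> sets Bo"
  shows "snd c ` (X \<inter> fst c) \<in> sets borel"
proof -
  have "chart_inv c -` X \<inter> chart_image c \<in> sets (restrict_space borel (chart_image c))"
    using measurable_sets[OF measurable_chart_inv[OF c] X] by (simp add: space_restrict_space)
  then show ?thesis
    using open_image[OF c] by (simp add: image_chart_eq[OF c] sets_restrict_space_iff)
qed

lemma measurable_lborel_restrict: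
  "f \<in> measurable (restrict_space borel S) N \<Longrightarrow> f \<in> measurable (restrict_space lborel S) N"
  by (simp add: measurable_def space_restrict_space sets_restrict_space)

lemma emeasure_chart_measure:
  assumes c: "c \<in> A" and X: "X \<in> sets Bo"
  shows "emeasure (chart_measure M g c) X = (\<integral>\<^sup>+y\<in>snd c ` (X \<inter> fst c). ennreal (vol_density g c y) \<partial>lborel)"
proof -
  let ?R = "restrict_space lborel (chart_image c)"
  let ?Y = "chart_inv c -` X \<inter> chart_image c"
  have m: "chart_inv c \<in> measurable ?R Bo" "vol_density g c \<in> borel_measurable ?R"
    using measurable_chart_inv[OF c] measurable_vol[OF c] measurable_lborel_restrict by blast+
  have Y: "?Y \<in> sets ?R"
    using measurable_sets[OF m(1) X] by (simp add: space_restrict_space)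
  have "emeasure (chart_measure M g c) X = emeasure (density ?R (\<lambda>y. ennreal (vol_density g c y))) ?Y"
    unfolding chart_measure_def using m X by (subst emeasure_distr) (auto simp: space_restrict_space)
  also have "\<dots> = (\<integral>\<^sup>+y. ennreal (vol_density g c y) * indicator ?Y y \<partial>?R)"
    using m Y by (subst emeasure_density) auto
  also have "\<dots> = (\<integral>\<^sup>+y. ennreal (vol_density g c y) * indicator ?Y y * indicator (chart_image c) y \<partial>lborel)"
    using open_image[OF c] by (subst nn_integral_restrict_space) auto
  also have "\<dots> = (\<integral>\<^sup>+y\<in>?Y. ennreal (vol_density g c y) \<partial>lborel)"
    by (intro nn_integral_cong) (auto simp: indicator_def)
  finally show ?thesis by (simp add: image_chart_eq[OF c])
qed

text \<open>The change of variables formula for the transition map: its Jacobian determinant is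
  exactly the ratio of the two volume densities, by \<open>sqrt_det_J\<close>.\<close>

lemma emeasure_chart_measure_eq:
  assumes c: "c \<in> A" and d: "d \<in> A" and X: "X \<in> sets Bo" "X \<subseteq> fst c" "X \<subseteq> fst d"
  shows "emeasure (chart_measure M g c) X = emeasure (chart_measure M g d) X"
proof -
  interpret chart_change g c d "overlap c d" "transition c d" by (rule chart_change[OF c d])
  let ?T = "transition c d" and ?S = "snd c ` X"
  have Xc: "X \<inter> fst c = X" and Xd: "X \<inter> fst d = X" using X by auto
  have S: "?S \<in> sets borel" and S': "snd d ` X \<in> sets borel"
    using sets_image_chart[OF c X(1)] sets_image_chart[OF d X(1)] by (simp_all add: Xc Xd)
  have SU: "?S \<subseteq> overlap c d" using X by (auto simp: overlap_def)
  have TS: "?T ` ?S = snd d ` X"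
  proof -
    have "?T (snd c x) = snd d x" if "x \<in> X" for x using that X transition_snd[OF c] by blast
    then show ?thesis by (simp add: image_image)
  qed
  have jac: "\<bar>det (matrix (frechet_derivative ?T (at y)))\<bar> * vol_density g d (?T y) = vol_density g c y"
    if "y \<in> overlap c d" for y
  proof -
    have "matrix (frechet_derivative ?T (at y)) = Jm y"
      using jacobian_pd(1)[OF differentiable_T[OF that]]
      by (simp add: vec_eq_iff J_def jacobian_def)
    then show ?thesis using sqrt_det_J[OF that] by (simp add: vol_density_def)
  qed
  have pt: "indicat_real ?S x * (\<bar>det (matrix (frechet_derivative ?T (at x)))\<bar> * vol_density g d (?T x))
      = indicat_real ?S x * vol_density g c x" for x
    using jac[of x] SU by (cases "x \<in> ?S") auto
  have ind: "(\<lambda>y. indicat_real B y * vol_density g e y) \<in> borel_measurable borel"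
    if "e \<in> A" "B \<in> sets borel" "B \<subseteq> chart_image e" for e B
    using borel_measurable_continuous_on_indicator[OF that(2)
        continuous_on_subset[OF smooth_on_continuous[OF smooth_vol_density[OF that(1)]] that(3)]]
    by simp
  have "(\<integral>\<^sup>+y. ennreal (indicat_real (?T ` ?S) y * vol_density g d y) \<partial>lborel)
     = (\<integral>\<^sup>+x. ennreal (indicat_real ?S x * (\<bar>det (matrix (frechet_derivative ?T (at x)))\<bar> * vol_density g d (?T x))) \<partial>lborel)"
  proof (rule nn_integral_change_of_variables[OF S])
    show "(?T has_derivative frechet_derivative ?T (at x)) (at x)" if "x \<in> ?S" for x
      using that SU by (intro jacobian_pd(2) differentiable_T) auto
    show "inj_on ?T ?S"
    proof (rule inj_onI)
      fix y z assume "y \<in> ?S" "z \<in> ?S" "?T y = ?T z"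
      then obtain x w where xw: "x \<in> X" "w \<in> X" "y = snd c x" "z = snd c w" by blast
      then have "snd d x = snd d w"
        using \<open>?T y = ?T z\<close> transition_snd[OF c] X by (metis subsetD)
      then have "x = w" using xw X chart_inv_snd[OF d] by (metis subsetD)
      then show "y = z" by (simp add: xw)
    qed
    show "0 \<le> vol_density g d y" if "y \<in> ?T ` ?S" for y
      using that X snd_in_image[OF d] unfolding TS by (auto intro!: vol_nonneg[OF d])
    show "(\<lambda>y. indicat_real (?T ` ?S) y * vol_density g d y) \<in> borel_measurable borel"
      unfolding TS using X snd_in_image[OF d] by (intro ind d S') auto
    show "(\<lambda>x. indicat_real ?S x * (\<bar>det (matrix (frechet_derivative ?T (at x)))\<bar> * vol_density g d (?T x)))
        \<in> borel_measurable borel"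
      unfolding pt using X snd_in_image[OF c] by (intro ind c S) auto
  qed
  also have "\<dots> = (\<integral>\<^sup>+x. ennreal (indicat_real ?S x * vol_density g c x) \<partial>lborel)"
    unfolding pt ..
  finally have eq: "(\<integral>\<^sup>+y. ennreal (indicat_real (snd d ` X) y * vol_density g d y) \<partial>lborel) = \<dots>"
    unfolding TS .
  have e: "ennreal (vol_density g e y) * indicator B y = ennreal (indicat_real B y * vol_density g e y)" for e B y
    by (auto simp: indicator_def)
  show ?thesis
    unfolding emeasure_chart_measure[OF c X(1)] emeasure_chart_measure[OF d X(1)] Xc Xd e eq ..
qed

section \<open>Existence and finiteness of the Riemannian measure\<close>

text \<open>Open balls cover \<open>M\<close>, while the closed balls still lie inside the chart
  images. The closed ones bound the density and support the partition functions.\<close>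

lemma finite_ball_cover:
  "\<exists>I c r. finite I \<and> I \<subseteq> M \<and>
    (\<forall>x\<in>I. c x \<in> A \<and> x \<in> fst (c x) \<and> r x > 0 \<and> cball (snd (c x) x) (r x) \<subseteq> chart_image (c x)) \<and>
    M \<subseteq> (\<Union>x\<in>I. chart_inv (c x) ` ball (snd (c x) x) (r x))"
proof -
  have "\<exists>c r V. c \<in> A \<and> x \<in> fst c \<and> r > 0 \<and> cball (snd c x) r \<subseteq> chart_image c \<and> open V \<and> x \<in> V \<and>
      M \<inter> V \<subseteq> chart_inv c ` ball (snd c x) r" if x: "x \<in> M" for x
  proof -
    obtain c where c: "c \<in> A" "x \<in> fst c" using charts_cover x by blast
    obtain r where r: "r > 0" "cball (snd c x) r \<subseteq> chart_image c"
      using open_contains_cball open_image[OF c(1)] snd_in_image[OF c] by blast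
    have "openin (top_of_set (fst c)) (chart_inv c ` ball (snd c x) r)"
    proof (rule homeomorphism_imp_open_map)
      show "homeomorphism (chart_image c) (fst c) (chart_inv c) (snd c)"
        using chart_homeomorphism[OF c(1)] homeomorphism_symD by blast
      show "openin (top_of_set (chart_image c)) (ball (snd c x) r)"
        using r by (intro open_subset) auto
    qed
    then have "openin (top_of_set M) (chart_inv c ` ball (snd c x) r)"
      by (rule openin_trans[OF _ chart_openin[OF c(1)]])
    then obtain V where V: "open V" "chart_inv c ` ball (snd c x) r = M \<inter> V"
      by (auto simp: openin_open)
    have "x = chart_inv c (snd c x)" by (simp add: chart_inv_snd[OF c])
    then have "x \<in> chart_inv c ` ball (snd c x) r" by (rule image_eqI) (use r in simp)
    then have "x \<in> V" using V by blast
    then show ?thesis using c r V by blast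
  qed
  then obtain c r V where *: "\<And>x. x \<in> M \<Longrightarrow> c x \<in> A \<and> x \<in> fst (c x) \<and> r x > 0 \<and>
      cball (snd (c x) x) (r x) \<subseteq> chart_image (c x) \<and> open (V x) \<and> x \<in> V x \<and>
      M \<inter> V x \<subseteq> chart_inv (c x) ` ball (snd (c x) x) (r x)"
    by metis
  obtain I where I: "I \<subseteq> M" "finite I" "M \<subseteq> (\<Union>x\<in>I. V x)"
    by (rule compactE_image[OF compact_M, of M V]) (use * in blast)+
  show ?thesis
    by (intro exI[of _ I] exI[of _ c] exI[of _ r] conjI ballI) (use I * in blast)+
qed

text \<open>Cut \<open>M\<close> into finitely many disjoint Borel pieces, each inside one chart,
  and measure each piece in its chart. For a set inside another chart, agreement on overlaps allows
  every piece to be measured in that chart instead.\<close>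

lemma ex_riemannian_measure: "\<exists>\<mu>. is_riemannian_measure M A g \<mu>"
proof -
  obtain I c r where I: "finite I" "I \<subseteq> M"
    "\<forall>x\<in>I. c x \<in> A \<and> x \<in> fst (c x) \<and> r x > 0 \<and> cball (snd (c x) x) (r x) \<subseteq> chart_image (c x)"
    "M \<subseteq> (\<Union>x\<in>I. chart_inv (c x) ` ball (snd (c x) x) (r x))"
    using finite_ball_cover by (elim exE conjE) (rule that)
  note I3 = bspec[OF I(3)]
  obtain h where h: "bij_betw h {0..<card I} I"
    using ex_bij_betw_nat_finite[OF I(1)] by blast
  define N where "N = card I"
  define C where "C i = c (h i)" for i
  have hI: "h i \<in> I" if "i < N" for i
    using that bij_betw_apply[OF h, of i] by (simp add: N_def)
  have C: "C i \<in> A" if "i < N" for i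
    unfolding C_def using I3[OF hI[OF that]] by blast
  have cover: "M \<subseteq> (\<Union>i\<in>{0..<N}. fst (C i))"
  proof
    fix z assume "z \<in> M"
    then obtain x where x: "x \<in> I" "z \<in> chart_inv (c x) ` ball (snd (c x) x) (r x)" using I(4) by blast
    then have "z \<in> fst (c x)" using I3[OF x(1)] chart_inv_in[of "c x"] ball_subset_cball by blast
    moreover have "x \<in> h ` {0..<N}"
      using bij_betw_imp_surj_on[OF h] x(1) by (simp add: N_def)
    ultimately show "z \<in> (\<Union>i\<in>{0..<N}. fst (C i))" by (auto simp: C_def)
  qed
  \<comment> \<open>\<open>disjointed\<close> acts on sequences, which is why the finite cover was
    enumerated; the first \<open>N\<close> pieces exhaust \<open>M\<close>.\<close>
  define D where "D = disjointed (\<lambda>i. fst (C i))"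
  have D_sub: "D i \<subseteq> fst (C i)" for i unfolding D_def by (rule disjointed_subset)
  have D_disj: "disjoint_family D" unfolding D_def by (rule disjoint_family_disjointed)
  have D_cover: "M \<subseteq> (\<Union>i\<in>{0..<N}. D i)"
    using cover unfolding D_def finite_UN_disjointed_eq .
  have D_sets: "D i \<in> sets Bo" if "i < N" for i
    unfolding D_def disjointed_def using that C sets_chart by (intro sets.Diff sets.finite_UN) auto
  define f where "f X = (\<Sum>i<N. emeasure (chart_measure M g (C i)) (X \<inter> D i))" for X
  define \<mu> where "\<mu> = measure_of (space Bo) (sets Bo) f"
  have sets_cm: "sets (chart_measure M g d) = sets Bo" for d by (simp add: chart_measure_def)
  have "countably_additive (sets Bo) f"
  proof (rule countably_additiveI)
    fix F :: "nat \<Rightarrow> 'a set"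
    assume F: "range F \<subseteq> sets Bo" "disjoint_family F" "(\<Union>i. F i) \<in> sets Bo"
    have "(\<Sum>n. f (F n)) = (\<Sum>i<N. \<Sum>n. emeasure (chart_measure M g (C i)) (F n \<inter> D i))"
      unfolding f_def by (rule suminf_sum) (rule summableI)
    also have "\<dots> = (\<Sum>i<N. emeasure (chart_measure M g (C i)) (\<Union>n. F n \<inter> D i))"
    proof (rule sum.cong[OF refl], rule suminf_emeasure)
      fix i assume "i \<in> {..<N}"
      then show "range (\<lambda>n. F n \<inter> D i) \<subseteq> sets (chart_measure M g (C i))"
        using F(1) D_sets[of i] by (auto simp: sets_cm)
      show "disjoint_family (\<lambda>n. F n \<inter> D i)" using F(2) by (auto simp: disjoint_family_on_def)
    qed
    also have "\<dots> = f (\<Union>i. F i)" unfolding f_def by (simp add: Int_UN_distrib2)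
    finally show "(\<Sum>n. f (F n)) = f (\<Union>i. F i)" .
  qed
  moreover have "positive (sets Bo) f" by (simp add: positive_def f_def)
  ultimately have em: "emeasure \<mu> X = f X" if "X \<in> sets Bo" for X
    unfolding \<mu>_def using that sets.sigma_algebra_axioms by (intro emeasure_measure_of_sigma)
  have "emeasure \<mu> X = (\<integral>\<^sup>+y\<in>snd d ` X. ennreal (sqrt (det (metric_matrix g d y))) \<partial>lborel)"
    if d: "d \<in> A" and X: "X \<in> sets Bo" "X \<subseteq> fst d" for d X
  proof -
    have "f X = (\<Sum>i<N. emeasure (chart_measure M g d) (X \<inter> D i))"
      unfolding f_def
    proof (rule sum.cong[OF refl])
      fix i assume i: "i \<in> {..<N}"
      show "emeasure (chart_measure M g (C i)) (X \<inter> D i) = emeasure (chart_measure M g d) (X \<inter> D i)"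
        using i X D_sub[of i] D_sets[of i] C[of i] by (intro emeasure_chart_measure_eq d) auto
    qed
    also have "\<dots> = emeasure (chart_measure M g d) (\<Union>i\<in>{..<N}. X \<inter> D i)"
    proof (rule sum_emeasure)
      show "(\<lambda>i. X \<inter> D i) ` {..<N} \<subseteq> sets (chart_measure M g d)"
        using X D_sets by (auto simp: sets_cm)
      show "disjoint_family_on (\<lambda>i. X \<inter> D i) {..<N}"
        using D_disj by (auto simp: disjoint_family_on_def)
    qed simp
    also have "(\<Union>i\<in>{..<N}. X \<inter> D i) = X"
      using D_cover X chart_subset[OF d] by (auto simp: atLeast0LessThan)
    finally have "emeasure \<mu> X = emeasure (chart_measure M g d) X" using em X by simp
    moreover have "X \<inter> fst d = X" using X by blast
    ultimately show ?thesis
      using emeasure_chart_measure[OF d X(1)] by (simp add: vol_density_def)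
  qed
  moreover have "space \<mu> = M"
    unfolding \<mu>_def sets.space_measure_of_eq by (simp add: space_restrict_space)
  moreover have "sets \<mu> = sets Bo"
    unfolding \<mu>_def by (rule sets.sets_measure_of_eq)
  ultimately show ?thesis unfolding is_riemannian_measure_def by blast
qed

abbreviation "\<mu> \<equiv> riemannian_measure M A g"

lemma riemannian_measure: "is_riemannian_measure M A g \<mu>"
  unfolding riemannian_measure_def by (rule someI_ex) (rule ex_riemannian_measure)

lemma space_riemannian: "space \<mu> = M" and sets_riemannian: "sets \<mu> = sets Bo"
  using riemannian_measure unfolding is_riemannian_measure_def by blast+

lemma emeasure_riemannian:
  assumes c: "c \<in> A" and X: "X \<in> sets Bo" "X \<subseteq> fst c"
  shows "emeasure \<mu> X = emeasure (chart_measure M g c) X"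
proof -
  have "emeasure \<mu> X = (\<integral>\<^sup>+y\<in>snd c ` X. ennreal (sqrt (det (metric_matrix g c y))) \<partial>lborel)"
    using riemannian_measure c X unfolding is_riemannian_measure_def by auto
  moreover have "X \<inter> fst c = X" using X by blast
  ultimately show ?thesis
    using emeasure_chart_measure[OF c X(1)] by (simp add: vol_density_def)
qed

text \<open>\<open>M\<close> is covered by finitely many coordinate balls, each of finite measure
  because the density is bounded on a compact ball.\<close>

lemma finite_riemannian: "finite_measure \<mu>"
proof
  obtain I c r where I: "finite I" "I \<subseteq> M"
    "\<forall>x\<in>I. c x \<in> A \<and> x \<in> fst (c x) \<and> r x > 0 \<and> cball (snd (c x) x) (r x) \<subseteq> chart_image (c x)"
    "M \<subseteq> (\<Union>x\<in>I. chart_inv (c x) ` ball (snd (c x) x) (r x))"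
    using finite_ball_cover by (elim exE conjE) (rule that)
  note I3 = bspec[OF I(3)]
  \<comment> \<open>The part of the chart domain mapped into the closed ball, written as a preimage
    so that measurability follows from continuity of the chart.\<close>
  define W where "W x = M \<inter> fst (c x) \<inter> (snd (c x) -` cball (snd (c x) x) (r x))" for x
  have W: "W x \<in> sets Bo \<and> W x \<subseteq> fst (c x) \<and> emeasure \<mu> (W x) < \<infinity>" if x: "x \<in> I" for x
  proof -
    let ?K = "cball (snd (c x) x) (r x)"
    have cx: "c x \<in> A" and K: "?K \<subseteq> chart_image (c x)" using I3[OF x] by auto
    have "snd (c x) \<in> borel_measurable (restrict_space borel (fst (c x)))"
      by (rule borel_measurable_continuous_on_restrict[OF continuous_chart[OF cx]])
    then have "snd (c x) -` ?K \<inter> space (restrict_space borel (fst (c x))) \<in> sets (restrict_space borel (fst (c x)))"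
      by (rule measurable_sets) (simp add: borel_closed)
    then have "snd (c x) -` ?K \<inter> fst (c x) \<in> sets (restrict_space borel (fst (c x)))"
      by (simp add: space_restrict_space)
    then obtain B where B: "B \<in> sets borel" "snd (c x) -` ?K \<inter> fst (c x) = fst (c x) \<inter> B"
      by (auto simp: sets_restrict_space)
    obtain B' where B': "B' \<in> sets borel" "fst (c x) = M \<inter> B'"
      using sets_chart[OF cx] by (auto simp: sets_restrict_space)
    have "W x = M \<inter> (B' \<inter> B)" using B B' by (auto simp: W_def)
    then have sets: "W x \<in> sets Bo" using B(1) B'(1) by (auto simp: sets_restrict_space)
    have sub: "W x \<subseteq> fst (c x)" by (auto simp: W_def)
    have "bounded (vol_density g (c x) ` ?K)"
      by (intro compact_imp_bounded compact_continuous_image compact_cball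
          continuous_on_subset[OF smooth_on_continuous[OF smooth_vol_density[OF cx]] K])
    then obtain b where "\<forall>v\<in>vol_density g (c x) ` ?K. norm v \<le> b"
      unfolding bounded_iff by blast
    then have b: "\<bar>vol_density g (c x) y\<bar> \<le> b" if "y \<in> ?K" for y
      using that by auto
    have "emeasure \<mu> (W x) = (\<integral>\<^sup>+y\<in>snd (c x) ` (W x \<inter> fst (c x)). ennreal (vol_density g (c x) y) \<partial>lborel)"
      using emeasure_riemannian[OF cx sets sub] emeasure_chart_measure[OF cx sets] by simp
    also have "\<dots> \<le> (\<integral>\<^sup>+y. ennreal b * indicator ?K y \<partial>lborel)"
      by (rule nn_integral_mono) (use b in \<open>force simp: W_def indicator_def intro!: ennreal_leI\<close>)
    also have "\<dots> = ennreal b * emeasure lborel ?K"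
      by (rule nn_integral_cmult_indicator) simp
    also have "\<dots> < \<infinity>"
      using emeasure_bounded_finite[of ?K] by (simp add: ennreal_mult_less_top)
    finally show ?thesis using sets sub by blast
  qed
  have "M \<subseteq> (\<Union>x\<in>I. W x)"
  proof
    fix z assume "z \<in> M"
    then obtain x y where x: "x \<in> I" "y \<in> ball (snd (c x) x) (r x)" "z = chart_inv (c x) y" using I(4) by blast
    have cx: "c x \<in> A" and y: "y \<in> chart_image (c x)" using I3[OF x(1)] x(2) ball_subset_cball by blast+
    have "z \<in> W x"
      using chart_inv_in[OF cx y] snd_chart_inv[OF cx y] x \<open>z \<in> M\<close> by (simp add: W_def)
    then show "z \<in> (\<Union>x\<in>I. W x)" using x(1) by blast
  qed
  moreover have "(\<Union>x\<in>I. W x) \<subseteq> M" by (auto simp: W_def)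
  ultimately have "M = (\<Union>x\<in>I. W x)" by blast
  then have "emeasure \<mu> M = emeasure \<mu> (\<Union>x\<in>I. W x)" by (rule arg_cong)
  also have "\<dots> \<le> (\<Sum>x\<in>I. emeasure \<mu> (W x))"
    by (rule emeasure_subadditive_finite[OF I(1)]) (use W in \<open>auto simp: sets_riemannian\<close>)
  also have "\<dots> < \<infinity>" using W I(1) by (simp add: ennreal_sum_less_top less_top)
  finally show "emeasure \<mu> (space \<mu>) \<noteq> \<infinity>" by (simp add: space_riemannian)
qed

text \<open>For an integrand that vanishes outside one chart the Riemannian measure can be replaced
  by the measure of that chart, since the two agree on subsets of its domain.\<close>

lemma integral_in_chart:
  assumes c: "c \<in> A" and F: "F \<in> borel_measurable Bo" and supp: "\<And>x. x \<in> M \<Longrightarrow> x \<notin> fst c \<Longrightarrow> F x = (0::real)"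
  shows "(\<integral>x. F x \<partial>\<mu>) = (\<integral>y. indicat_real (chart_image c) y * (vol_density g c y * F (chart_inv c y)) \<partial>lborel)"
proof -
  let ?\<nu> = "chart_measure M g c" and ?R = "restrict_space lborel (chart_image c)"
  have sets_\<nu>: "sets ?\<nu> = sets Bo" and space_\<nu>: "space ?\<nu> = M"
    by (simp_all add: chart_measure_def space_restrict_space)
  have m: "chart_inv c \<in> measurable ?R Bo" "vol_density g c \<in> borel_measurable ?R"
    using measurable_chart_inv[OF c] measurable_vol[OF c] measurable_lborel_restrict by blast+
  have sub: "fst c \<subseteq> M" and fc: "fst c \<in> sets Bo" by (rule chart_subset[OF c], rule sets_chart[OF c])
  have eq: "restrict_space \<mu> (fst c) = restrict_space ?\<nu> (fst c)"
  proof (rule measure_eqI)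
    show "sets (restrict_space \<mu> (fst c)) = sets (restrict_space ?\<nu> (fst c))"
      by (simp add: sets_restrict_space sets_\<nu> sets_riemannian)
    fix X assume "X \<in> sets (restrict_space \<mu> (fst c))"
    then have X: "X \<in> sets Bo" "X \<subseteq> fst c"
      using fc sub by (auto simp: sets_restrict_space_iff space_riemannian sets_riemannian Int_absorb2)
    then show "emeasure (restrict_space \<mu> (fst c)) X = emeasure (restrict_space ?\<nu> (fst c)) X"
      using fc sub by (simp add: emeasure_restrict_space space_riemannian space_\<nu> sets_\<nu> sets_riemannian
          Int_absorb2 emeasure_riemannian[OF c])
  qed
  have "(\<integral>x. F x \<partial>\<mu>) = (\<integral>x. indicat_real (fst c) x *\<^sub>R F x \<partial>\<mu>)"
    by (rule Bochner_Integration.integral_cong) (use supp in \<open>auto simp: indicator_def space_riemannian\<close>)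
  also have "\<dots> = (\<integral>x. F x \<partial>restrict_space \<mu> (fst c))"
    using fc sub by (subst integral_restrict_space) (auto simp: space_riemannian sets_riemannian Int_absorb2)
  also have "\<dots> = (\<integral>x. indicat_real (fst c) x *\<^sub>R F x \<partial>?\<nu>)"
    unfolding eq using fc sub by (subst integral_restrict_space) (auto simp: space_\<nu> sets_\<nu> Int_absorb2)
  also have "\<dots> = (\<integral>x. F x \<partial>?\<nu>)"
    by (rule Bochner_Integration.integral_cong) (use supp in \<open>auto simp: indicator_def space_\<nu>\<close>)
  also have "\<dots> = (\<integral>y. F (chart_inv c y) \<partial>density ?R (\<lambda>y. ennreal (vol_density g c y)))"
    unfolding chart_measure_def using m F by (subst integral_distr) auto
  also have "\<dots> = (\<integral>y. vol_density g c y *\<^sub>R F (chart_inv c y) \<partial>?R)"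
  proof (rule integral_density)
    show "(\<lambda>y. F (chart_inv c y)) \<in> borel_measurable ?R" by (rule measurable_compose[OF m(1) F])
    show "AE y in ?R. 0 \<le> vol_density g c y"
      by (rule AE_I2) (simp add: space_restrict_space vol_nonneg[OF c])
  qed (rule m(2))
  also have "\<dots> = (\<integral>y. indicat_real (chart_image c) y * (vol_density g c y * F (chart_inv c y)) \<partial>lborel)"
    using open_image[OF c] by (subst integral_restrict_space) auto
  finally show ?thesis .
qed

lemma measurable_scalar_at: "scalar A f \<Longrightarrow> scalar_at A f \<in> borel_measurable Bo"
  by (rule borel_measurable_continuous_on_restrict[OF continuous_on_scalar_at])

lemma integrable_continuous:
  assumes "continuous_on M (F :: 'a \<Rightarrow> real)"
  shows "integrable \<mu> F"
proof -
  interpret finite_measure \<mu> by (rule finite_riemannian)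
  have "bounded (F ` M)"
    by (intro compact_imp_bounded compact_continuous_image assms compact_M)
  then obtain b where "\<And>x. x \<in> M \<Longrightarrow> norm (F x) \<le> b" by (auto simp: bounded_iff)
  moreover have "F \<in> borel_measurable \<mu>"
    using borel_measurable_continuous_on_restrict[OF assms]
    by (simp add: measurable_cong_sets[OF sets_riemannian refl])
  ultimately show ?thesis
    by (intro integrable_const_bound[of _ b]) (auto simp: space_riemannian)
qed

end

section \<open>Integration of divergences\<close>

text \<open>Differentiability on open sets is local, so a function can be glued from two open
  pieces. This is how extensions by zero are handled.\<close>

lemma Ck_on_Un:
  assumes "open U" "open V" "Ck_on k U f" "Ck_on k V f"
  shows "Ck_on k (U \<union> V) f"
  using assms(3,4)
proof (induction k arbitrary: f)
  case 0
  then show ?case using assms(1,2) by (simp add: continuous_on_open_Un)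
next
  case (Suc k)
  then show ?case
    using assms(1,2) by (auto simp: differentiable_on_eq_differentiable_at open_Un)
qed

lemma Ck_on_1_compose:
  fixes T :: "real^'n::finite \<Rightarrow> real^'n"
  assumes U: "open U" and T: "\<And>a. smooth_on U (\<lambda>y. T y $ a)"
    and V: "open V" and TV: "T ` U \<subseteq> V" and b: "Ck_on (Suc 0) V b"
  shows "Ck_on (Suc 0) U (\<lambda>y. b (T y))"
proof -
  have dT: "(\<lambda>y. T y $ a) differentiable (at y)" if "y \<in> U" for a y
    by (rule smooth_on_differentiable[OF T U that])
  have db: "b differentiable (at (T y))" if "y \<in> U" for y
    by (rule Ck_on_differentiable[OF V b]) (use that TV in blast)
  have contT: "continuous_on U T"
    using jacobian_pd(3)[OF dT] by (simp add: continuous_at_imp_continuous_on)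
  have cb: "continuous_on U (\<lambda>y. pd a b (T y))" for a
    by (rule continuous_on_compose2[OF _ contT TV]) (use b in simp)
  have "continuous_on U (\<lambda>y. \<Sum>a\<in>UNIV. pd i (\<lambda>y. T y $ a) y * pd a b (T y))" for i
    by (intro continuous_on_sum continuous_on_mult smooth_on_continuous smooth_on_pd T cb)
  then have "continuous_on U (pd i (\<lambda>y. b (T y)))" for i
    by (rule continuous_on_eq) (simp add: pd_compose(1)[OF dT db])
  then show ?thesis
    using pd_compose(2)[OF dT db] U by (simp add: differentiable_on_eq_differentiable_at)
qed

text \<open>The square removes the corner of the positive part: at 0 the difference quotient is
  bounded by the size of the step.\<close>

lemma DERIV_sq_pos_part: "((\<lambda>t::real. (max 0 t)\<^sup>2) has_real_derivative 2 * max 0 t) (at t)"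
proof -
  consider "t > 0" | "t < 0" | "t = 0" by linarith
  then show ?thesis
  proof cases
    case 1
    have "((\<lambda>t::real. t\<^sup>2) has_real_derivative 2 * max 0 t) (at t)"
      using 1 by (auto intro!: derivative_eq_intros)
    then show ?thesis
      by (rule has_field_derivative_transform_within_open[of _ _ _ "{0<..}"]) (use 1 in auto)
  next
    case 2
    have "((\<lambda>t::real. 0) has_real_derivative 2 * max 0 t) (at t)"
      using 2 by simp
    then show ?thesis
      by (rule has_field_derivative_transform_within_open[of _ _ _ "{..<0}"]) (use 2 in auto)
  next
    case 3
    have "((\<lambda>h::real. (max 0 h)\<^sup>2 / h) \<longlongrightarrow> 0) (at 0)"
    proof (rule Lim_null_comparison)
      show "\<forall>\<^sub>F h::real in at 0. norm ((max 0 h)\<^sup>2 / h) \<le> \<bar>h\<bar>"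
        by (rule always_eventually) (auto simp: max_def power2_eq_square)
      show "((\<lambda>h::real. \<bar>h\<bar>) \<longlongrightarrow> 0) (at 0)"
        by (auto intro!: tendsto_eq_intros)
    qed
    then show ?thesis using 3 by (simp add: has_field_derivative_iff)
  qed
qed

text \<open>The square of the positive part of a polynomial: positive on the open ball, zero outside
  the closed ball, and continuously differentiable across the sphere.\<close>

definition bump :: "real^'n::finite \<Rightarrow> real \<Rightarrow> real^'n \<Rightarrow> real" where
  "bump y\<^sub>0 r y = (max 0 (r\<^sup>2 - (y - y\<^sub>0) \<bullet> (y - y\<^sub>0)))\<^sup>2"

lemma bump_eq_0: "r > 0 \<Longrightarrow> y \<notin> cball y\<^sub>0 r \<Longrightarrow> bump y\<^sub>0 r y = 0"
proof -
  assume r: "r > 0" and "y \<notin> cball y\<^sub>0 r"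
  then have "r < norm (y - y\<^sub>0)" by (simp add: dist_norm norm_minus_commute)
  then have "r\<^sup>2 < (norm (y - y\<^sub>0))\<^sup>2" using r by (intro power_strict_mono) auto
  then show ?thesis by (simp add: bump_def power2_norm_eq_inner)
qed

lemma bump_pos: "y \<in> ball y\<^sub>0 r \<Longrightarrow> bump y\<^sub>0 r y > 0"
proof -
  assume "y \<in> ball y\<^sub>0 r"
  then have "norm (y - y\<^sub>0) < r" by (simp add: dist_norm norm_minus_commute)
  then have "(norm (y - y\<^sub>0))\<^sup>2 < r\<^sup>2" by (intro power_strict_mono) auto
  then show ?thesis by (simp add: bump_def power2_norm_eq_inner)
qed

lemma bump_nonneg: "0 \<le> bump y\<^sub>0 r y"
  by (simp add: bump_def)

lemma Ck_on_1_bump: "Ck_on (Suc 0) UNIV (bump y\<^sub>0 r)"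
proof -
  have d: "(bump y\<^sub>0 r has_derivative
      (\<lambda>v. (- ((y - y\<^sub>0) \<bullet> v + v \<bullet> (y - y\<^sub>0))) * (2 * max 0 (r\<^sup>2 - (y - y\<^sub>0) \<bullet> (y - y\<^sub>0))))) (at y)" for y
    unfolding bump_def[abs_def]
    by (rule DERIV_compose_FDERIV[OF DERIV_sq_pos_part]) (auto intro!: derivative_eq_intros)
  then have "pd i (bump y\<^sub>0 r)
      = (\<lambda>y. (- ((y - y\<^sub>0) \<bullet> axis i 1 + axis i 1 \<bullet> (y - y\<^sub>0))) * (2 * max 0 (r\<^sup>2 - (y - y\<^sub>0) \<bullet> (y - y\<^sub>0))))" for i
    using pd_eq by blast
  moreover have "bump y\<^sub>0 r differentiable_on UNIV"
    using d by (auto simp: differentiable_on_def differentiable_def)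
  ultimately show ?thesis
    by (simp, intro allI continuous_intros)
qed

lemma integral_pd_compact_support:
  fixes w :: "real^'n::finite \<Rightarrow> real"
  assumes w: "Ck_on (Suc 0) UNIV w" and K: "compact K" and w0: "\<And>y. y \<notin> K \<Longrightarrow> w y = 0"
  shows "integrable lborel (pd k w)" and "(\<integral>y. pd k w y \<partial>lborel) = 0"
proof -
  let ?e = "axis k (1::real) :: real^'n"
  have dw: "w differentiable (at y)" for y
    by (rule Ck_on_differentiable[OF open_UNIV w]) simp
  have cw: "continuous_on UNIV w" and cpd: "continuous_on UNIV (pd k w)"
    using w Ck_on_Suc_imp[OF w] by auto
  have pd0: "pd k w y = 0" if "y \<notin> K" for y
  proof -
    have "pd k w y = pd k (\<lambda>_. 0) y"
      by (rule pd_cong[of "- K"]) (use that w0 compact_imp_closed[OF K] in auto)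
    then show ?thesis by simp
  qed
  have int: "integrable lborel h" if "continuous_on UNIV h" "\<And>y. y \<notin> K \<Longrightarrow> h y = 0" for h :: "real^'n \<Rightarrow> real"
  proof -
    have i: "integrable lborel (\<lambda>y. indicator K y *\<^sub>R h y)"
      by (rule borel_integrable_compact[OF K continuous_on_subset[OF that(1)]]) simp
    have e: "indicator K y *\<^sub>R h y = h y" for y using that(2)[of y] by (cases "y \<in> K") auto
    from i show ?thesis by (simp only: e)
  qed
  show "integrable lborel (pd k w)" by (rule int[OF cpd pd0])
  have "bounded (pd k w ` K)"
    by (intro compact_imp_bounded compact_continuous_image continuous_on_subset[OF cpd] K) simp
  then obtain B where "\<forall>v\<in>pd k w ` K. norm v \<le> B" unfolding bounded_iff by blast
  \<comment> \<open>The maximum with 0 covers points outside \<open>K\<close>, where the derivative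
    is 0, and an empty \<open>K\<close>, for which \<open>B\<close> may be negative.\<close>
  then have B: "\<bar>pd k w y\<bar> \<le> max B 0" for y
    using pd0[of y] by (cases "y \<in> K") auto
  obtain R where R: "\<And>y. y \<in> K \<Longrightarrow> norm y \<le> R"
    using compact_imp_bounded[OF K] unfolding bounded_iff by blast
  \<comment> \<open>The difference quotients of \<open>w\<close> have integral zero by translation invariance and converge dominatedly.\<close>
  define D where "D m y = (w (y + (1 / real (Suc m)) *\<^sub>R ?e) - w y) * real (Suc m)" for m y
  have D: "\<exists>t. 0 < t \<and> t < 1 / real (Suc m) \<and> D m y = pd k w (y + t *\<^sub>R ?e)" for m y
  proof -
    have "(0::real) < 1 / real (Suc m)" by simp
    from MVT2[OF this pd_line[OF dw], of y k] obtain t where "0 < t" "t < 1 / real (Suc m)"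
      "w (y + (1 / real (Suc m)) *\<^sub>R ?e) - w (y + 0 *\<^sub>R ?e) = (1 / real (Suc m) - 0) * pd k w (y + t *\<^sub>R ?e)"
      by blast
    then show ?thesis by (intro exI[of _ t]) (simp add: D_def)
  qed
  have "(\<lambda>m. \<integral>y. D m y \<partial>lborel) \<longlonglongrightarrow> (\<integral>y. pd k w y \<partial>lborel)"
  \<comment> \<open>By the mean value theorem \<open>D m y\<close> is a value of
    \<open>pd k w\<close> at a point less than 1 away from \<open>y\<close>. It vanishes unless that
    point lies in \<open>K\<close>, hence the radius \<open>R + 1\<close>.\<close>
  proof (rule integral_dominated_convergence[where w="\<lambda>y. max B 0 * indicator (cball 0 (R + 1)) y"])
    show "pd k w \<in> borel_measurable lborel"
      using borel_measurable_continuous_onI[OF cpd] by simp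
    show "D m \<in> borel_measurable lborel" for m
    proof -
      have "continuous_on UNIV (D m)"
        unfolding D_def[abs_def]
        by (intro continuous_intros continuous_on_compose2[OF cw]) auto
      then show ?thesis using borel_measurable_continuous_onI by simp
    qed
    show "integrable lborel (\<lambda>y. max B 0 * indicator (cball (0::real^'n) (R + 1)) y)"
      using emeasure_bounded_finite[of "cball (0::real^'n) (R + 1)"]
      by (intro integrable_mult_right integrable_real_indicator) auto
    show "AE y in lborel. (\<lambda>m. D m y) \<longlonglongrightarrow> pd k w y"
    proof (rule AE_I2)
      fix y
      have "\<forall>m. \<exists>t. 0 < t \<and> t < 1 / real (Suc m) \<and> D m y = pd k w (y + t *\<^sub>R ?e)"
        using D by blast
      then obtain t where t: "\<forall>m. 0 < t m \<and> t m < 1 / real (Suc m) \<and> D m y = pd k w (y + t m *\<^sub>R ?e)"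
        by (rule choice[THEN exE])
      have "t \<longlonglongrightarrow> 0"
        by (rule real_tendsto_sandwich[OF _ _ tendsto_const LIMSEQ_Suc[OF lim_1_over_n]])
          (use t less_imp_le in \<open>auto intro!: always_eventually\<close>)
      then have "(\<lambda>m. y + t m *\<^sub>R ?e) \<longlonglongrightarrow> y + 0 *\<^sub>R ?e"
        by (intro tendsto_add tendsto_scaleR tendsto_const)
      then have "(\<lambda>m. y + t m *\<^sub>R ?e) \<longlonglongrightarrow> y"
        by simp
      moreover have "isCont (pd k w) y"
        using cpd by (simp add: continuous_on_eq_continuous_at)
      ultimately have "(\<lambda>m. pd k w (y + t m *\<^sub>R ?e)) \<longlonglongrightarrow> pd k w y"
        using isCont_tendsto_compose by blast
      then show "(\<lambda>m. D m y) \<longlonglongrightarrow> pd k w y" using t by simp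
    qed
    show "AE y in lborel. norm (D m y) \<le> max B 0 * indicator (cball 0 (R + 1)) y" for m
    proof (rule AE_I2)
      fix y :: "real^'n"
      obtain t where t: "0 < t" "t < 1 / real (Suc m)" "D m y = pd k w (y + t *\<^sub>R ?e)" using D by blast
      show "norm (D m y) \<le> max B 0 * indicator (cball 0 (R + 1)) y"
      proof (cases "y + t *\<^sub>R ?e \<in> K")
        case True
        have "1 / real (Suc m) \<le> 1" by simp
        then have "t \<le> 1" using t(2) by linarith
        then have "norm (t *\<^sub>R ?e) \<le> 1" using t(1) by simp
        moreover have "norm y \<le> norm (y + t *\<^sub>R ?e) + norm (t *\<^sub>R ?e)"
          using norm_triangle_ineq4[of "y + t *\<^sub>R ?e" "t *\<^sub>R ?e"] by simp
        ultimately have "y \<in> cball 0 (R + 1)" using R[OF True] by simp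
        then show ?thesis using B t by simp
      next
        case False
        then show ?thesis using pd0 t by simp
      qed
    qed
  qed
  moreover have "(\<integral>y. D m y \<partial>lborel) = 0" for m
  proof -
    let ?c = "(1 / real (Suc m)) *\<^sub>R ?e"
    have iw: "integrable lborel w" by (rule int[OF cw w0])
    have mw: "w \<in> borel_measurable borel" by (rule borel_measurable_continuous_onI[OF cw])
    have "integrable (distr lborel borel ((+) ?c)) w" by (simp add: lborel_distr_plus iw)
    then have it: "integrable lborel (\<lambda>y. w (?c + y))"
      using mw by (subst (asm) integrable_distr_eq) auto
    have "(\<integral>y. w y \<partial>lborel) = (\<integral>y. w y \<partial>distr lborel borel ((+) ?c))" by (simp add: lborel_distr_plus)
    also have "\<dots> = (\<integral>y. w (?c + y) \<partial>lborel)" using mw by (subst integral_distr) auto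
    finally have eq: "(\<integral>y. w (?c + y) \<partial>lborel) = (\<integral>y. w y \<partial>lborel)" by simp
    have "(\<integral>y. D m y \<partial>lborel) = (\<integral>y. (w (?c + y) - w y) \<partial>lborel) * real (Suc m)"
      unfolding D_def by (simp only: add.commute[of _ ?c] Bochner_Integration.integral_mult_left_zero)
    also have "\<dots> = 0"
      unfolding Bochner_Integration.integral_diff[OF it iw] eq by simp
    finally show ?thesis .
  qed
  ultimately show "(\<integral>y. pd k w y \<partial>lborel) = 0"
    by (simp add: LIMSEQ_const_iff)
qed

section \<open>Partition of unity and the divergence theorem\<close>

context closed_riemannian
begin

text \<open>Cut-off functions are functions on the manifold rather than families of coordinate
  expressions, so that their supports are subsets of \<open>M\<close> and extension by zero makes
  sense.\<close>

definition C1_fun :: "('a \<Rightarrow> real) \<Rightarrow> bool" where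
  "C1_fun u \<longleftrightarrow> (\<forall>c\<in>A. Ck_on (Suc 0) (chart_image c) (\<lambda>y. u (chart_inv c y)))"

text \<open>The metric pairing of the gradients of \<open>f\<close> and \<open>u\<close>.\<close>

definition gdot :: "('a \<Rightarrow> real) \<Rightarrow> (('a, 'n) chart \<Rightarrow> real^'n \<Rightarrow> real) \<Rightarrow> ('a, 'n) chart \<Rightarrow> real^'n \<Rightarrow> real" where
  "gdot u f c y = (\<Sum>j\<in>UNIV. \<Sum>k\<in>UNIV. ginv g c j k y * pd j (f c) y * pd k (\<lambda>y. u (chart_inv c y)) y)"

lemma C1_funD: "C1_fun u \<Longrightarrow> c \<in> A \<Longrightarrow> Ck_on (Suc 0) (chart_image c) (\<lambda>y. u (chart_inv c y))"
  by (simp add: C1_fun_def)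

lemma chart_inv_transition:
  assumes c: "c \<in> A" and d: "d \<in> A" and z: "z \<in> overlap c d"
  shows "chart_inv d (transition c d z) = chart_inv c z"
proof -
  obtain x where x: "x \<in> fst c" "x \<in> fst d" "z = snd c x" using z by (auto simp: overlap_def)
  show ?thesis
    using chart_inv_snd[OF c x(1)] chart_inv_snd[OF d x(2)] transition_snd[OF c x(1), of d] x(3) by simp
qed

lemma scalar_C1_fun:
  assumes u: "C1_fun u"
  shows "scalar A (\<lambda>c y. u (chart_inv c y))"
proof (rule scalarI)
  show "continuous_on (chart_image c) (\<lambda>y. u (chart_inv c y))" if "c \<in> A" for c
    using Ck_on_Suc_imp[OF C1_funD[OF u that]] by simp
  show "u (chart_inv c (snd c x)) = u (chart_inv d (snd d x))"
    if "c \<in> A" "d \<in> A" "x \<in> fst c" "x \<in> fst d" for c d x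
    using that by (simp only: chart_inv_snd)
qed

lemma scalar_add: "scalar A f \<Longrightarrow> scalar A h \<Longrightarrow> scalar A (\<lambda>c y. f c y + h c y)"
  by (rule scalarI) (auto intro: continuous_on_add scalar_continuous arg_cong2[where f="(+)"] scalar_law)

lemma scalar_mult: "scalar A f \<Longrightarrow> scalar A h \<Longrightarrow> scalar A (\<lambda>c y. f c y * h c y)"
  by (rule scalarI) (auto intro: continuous_on_mult scalar_continuous arg_cong2[where f="(*)"] scalar_law)

lemma scalar_gdot:
  assumes u: "C1_fun u" and f: "scalar A f" "\<And>c. c \<in> A \<Longrightarrow> smooth_on (chart_image c) (f c)"
  shows "scalar A (gdot u f)"
proof (rule scalarI)
  show "continuous_on (chart_image c) (gdot u f c)" if c: "c \<in> A" for c
  proof -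
    have "continuous_on (chart_image c) (pd k (\<lambda>y. u (chart_inv c y)))" for k
      using C1_funD[OF u c] by simp
    then show ?thesis
      unfolding gdot_def[abs_def]
      by (intro continuous_on_sum continuous_on_mult smooth_on_continuous[OF smooth_on_pd[OF f(2)[OF c]]]
          smooth_on_continuous[OF chart_metric.smooth_H[OF chart_metric[OF c]]])
  qed
  fix c d x assume c: "c \<in> A" and d: "d \<in> A" and x: "x \<in> fst c" "x \<in> fst d"
  interpret chart_change g c d "overlap c d" "transition c d" by (rule chart_change[OF c d])
  have y: "snd c x \<in> overlap c d" using x by (auto simp: overlap_def)
  note T = transition_snd[OF c x(1), of d]
  have "gdot u f c (snd c x) = gdot u f d (transition c d (snd c x))"
    unfolding gdot_def
  proof (rule gdot_law[OF y, of "\<lambda>c y. u (chart_inv c y)" f])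
    show "(\<lambda>y. u (chart_inv d y)) differentiable at (transition c d (snd c x))"
      by (rule Ck_on_differentiable[OF open_image[OF d] C1_funD[OF u d]]) (rule in_d[OF y])
    show "f d differentiable at (transition c d (snd c x))"
      by (rule smooth_on_differentiable[OF f(2)[OF d] open_image[OF d]]) (rule in_d[OF y])
    fix z assume z: "z \<in> overlap c d"
    show "u (chart_inv c z) = u (chart_inv d (transition c d z))"
      by (simp only: chart_inv_transition[OF c d z])
    obtain w where w: "w \<in> fst c" "w \<in> fst d" "z = snd c w" using z by (auto simp: overlap_def)
    show "f c z = f d (transition c d z)"
      unfolding w(3) transition_snd[OF c w(1)] by (rule scalar_law[OF f(1) c d w(1,2)])
  qed
  then show "gdot u f c (snd c x) = gdot u f d (snd d x)" unfolding T .
qed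

lemma C1_fun_local:
  assumes "\<And>c. c \<in> A \<Longrightarrow> \<exists>U V. open U \<and> open V \<and> chart_image c = U \<union> V \<and>
      Ck_on (Suc 0) U (\<lambda>y. u (chart_inv c y)) \<and> Ck_on (Suc 0) V (\<lambda>y. u (chart_inv c y))"
  shows "C1_fun u"
  unfolding C1_fun_def
proof
  fix c assume "c \<in> A"
  from assms[OF this] obtain U V where "open U" "open V" "chart_image c = U \<union> V"
    "Ck_on (Suc 0) U (\<lambda>y. u (chart_inv c y))" "Ck_on (Suc 0) V (\<lambda>y. u (chart_inv c y))" by blast
  then show "Ck_on (Suc 0) (chart_image c) (\<lambda>y. u (chart_inv c y))"
    by (simp only: Ck_on_Un)
qed

lemma open_complement_chart:
  assumes c: "c \<in> A" and K: "compact (K :: 'a set)"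
  shows "open {y \<in> chart_image c. chart_inv c y \<notin> K}"
proof -
  have "open (- K)" using compact_imp_closed[OF K] by (simp add: open_Compl)
  from continuous_open_preimage[OF continuous_chart_inv[OF c] open_image[OF c] this]
  have "open (chart_image c \<inter> chart_inv c -` (- K))" .
  moreover have "chart_image c \<inter> chart_inv c -` (- K) = {y \<in> chart_image c. chart_inv c y \<notin> K}"
    by blast
  ultimately show ?thesis by (simp only:)
qed

definition bump_fun :: "('a, 'n) chart \<Rightarrow> 'a \<Rightarrow> real \<Rightarrow> 'a \<Rightarrow> real" where
  "bump_fun c x r z = (if z \<in> fst c then bump (snd c x) r (snd c z) else 0)"

definition chart_ball :: "('a, 'n) chart \<Rightarrow> 'a \<Rightarrow> real \<Rightarrow> 'a set" where
  "chart_ball c x r = chart_inv c ` cball (snd c x) r"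

context
  fixes c x r assumes c: "c \<in> A" and r: "r > 0" and sub: "cball (snd c x) r \<subseteq> chart_image c"
begin

lemma compact_chart_ball: "compact (chart_ball c x r)"
  unfolding chart_ball_def
  by (intro compact_continuous_image continuous_on_subset[OF continuous_chart_inv[OF c] sub] compact_cball)

lemma chart_ball_subset: "chart_ball c x r \<subseteq> fst c"
  unfolding chart_ball_def using sub chart_inv_in[OF c] by blast

lemma bump_fun_eq_0:
  assumes z: "z \<notin> chart_ball c x r"
  shows "bump_fun c x r z = 0"
proof (cases "z \<in> fst c")
  case True
  have "snd c z \<notin> cball (snd c x) r"
  proof
    assume "snd c z \<in> cball (snd c x) r"
    then have "chart_inv c (snd c z) \<in> chart_ball c x r" unfolding chart_ball_def by (rule imageI)
    then show False using z chart_inv_snd[OF c True] by simp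
  qed
  then show ?thesis using bump_eq_0[OF r] True by (simp add: bump_fun_def)
qed (simp add: bump_fun_def)

text \<open>Any chart image is the union of two open sets: the overlap with \<open>c\<close>, where
  the function is a bump composed with a transition, and the complement of the compact coordinate
  ball, where it is 0. Compact sets are closed because the space is Hausdorff.\<close>

lemma C1_bump_fun: "C1_fun (bump_fun c x r)"
proof (rule C1_fun_local)
  fix d assume d: "d \<in> A"
  interpret chart_change g d c "overlap d c" "transition d c" by (rule chart_change[OF d c])
  define V where "V = {y \<in> chart_image d. chart_inv d y \<notin> chart_ball c x r}"
  have V: "open V" unfolding V_def by (rule open_complement_chart[OF d compact_chart_ball])
  have "chart_image d \<subseteq> overlap d c \<union> V"
  proof
    fix y assume y: "y \<in> chart_image d"
    show "y \<in> overlap d c \<union> V"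
    proof (cases "chart_inv d y \<in> fst c")
      case True
      have "y = snd d (chart_inv d y)" using snd_chart_inv[OF d y] by simp
      then have "y \<in> overlap d c"
        unfolding overlap_def using True chart_inv_in[OF d y] by (intro image_eqI[of _ _ "chart_inv d y"]) auto
      then show ?thesis by simp
    next
      case False
      then show ?thesis using y chart_ball_subset by (auto simp: V_def)
    qed
  qed
  then have eq: "chart_image d = overlap d c \<union> V" using U_c by (auto simp: V_def)
  have 1: "Ck_on (Suc 0) (overlap d c) (\<lambda>y. bump_fun c x r (chart_inv d y))"
  proof -
    have "Ck_on (Suc 0) (overlap d c) (\<lambda>y. bump (snd c x) r (transition d c y))"
      by (rule Ck_on_1_compose[OF open_U smooth_T open_UNIV _ Ck_on_1_bump]) simp
    moreover have "bump (snd c x) r (transition d c y) = bump_fun c x r (chart_inv d y)" if oy: "y \<in> overlap d c" for y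
    proof -
      obtain w where w: "w \<in> fst d" "w \<in> fst c" "y = snd d w" using oy by (auto simp: overlap_def)
      show ?thesis
        unfolding w(3) transition_snd[OF d w(1)] chart_inv_snd[OF d w(1)] using w(2) by (simp add: bump_fun_def)
    qed
    ultimately show ?thesis by (rule iffD1[OF Ck_on_cong[OF open_U], rotated])
  qed
  have 2: "Ck_on (Suc 0) V (\<lambda>y. bump_fun c x r (chart_inv d y))"
    by (rule iffD1[OF Ck_on_cong[OF V] Ck_on_const[OF V]]) (simp add: V_def bump_fun_eq_0)
  show "\<exists>U V. open U \<and> open V \<and> chart_image d = U \<union> V \<and>
      Ck_on (Suc 0) U (\<lambda>y. bump_fun c x r (chart_inv d y)) \<and> Ck_on (Suc 0) V (\<lambda>y. bump_fun c x r (chart_inv d y))"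
    using open_U V eq 1 2 by blast
qed

end

text \<open>\<open>F\<close> is the divergence of \<open>u\<close> times the gradient of
  \<open>f\<close>. It vanishes outside the chart \<open>c\<close>, and in that chart its product
  with the density is a sum of partial derivatives of compactly supported functions on Euclidean
  space.\<close>

lemma integral_by_parts:
  assumes c: "c \<in> A" and u: "C1_fun u" and K: "compact K" "K \<subseteq> fst c" and u0: "\<And>z. z \<notin> K \<Longrightarrow> u z = 0"
    and f: "scalar A f" "\<And>c. c \<in> A \<Longrightarrow> smooth_on (chart_image c) (f c)"
    and L: "scalar A L" "\<And>c y. c \<in> A \<Longrightarrow> y \<in> chart_image c \<Longrightarrow> vol_density g c y * L c y
        = (\<Sum>k\<in>UNIV. pd k (\<lambda>y. vol_density g c y * (\<Sum>j\<in>UNIV. ginv g c j k y * pd j (f c) y)) y)"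
  defines "F \<equiv> \<lambda>c y. u (chart_inv c y) * L c y + gdot u f c y"
  shows "scalar A F" and "manifold_integral M A g F = 0"
proof -
  show F: "scalar A F"
    unfolding F_def by (intro scalar_add scalar_mult scalar_C1_fun u L(1) scalar_gdot f)
  let ?S = "chart_image c"
  define v where "v y = u (chart_inv c y)" for y
  define W where "W k y = vol_density g c y * (\<Sum>j\<in>UNIV. ginv g c j k y * pd j (f c) y)" for k y
  \<comment> \<open>Outside the chart image \<open>W\<close> is an arbitrary expression, so the
    product is set to 0 there. It is already 0 on the image outside \<open>K'\<close>, which makes
    the extension of class C1.\<close>
  define w where "w k y = (if y \<in> ?S then v y * W k y else 0)" for k y
  define K' where "K' = snd c ` K"
  have S: "open ?S" by (rule open_image[OF c])
  have K': "compact K'" "K' \<subseteq> ?S"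
    unfolding K'_def using K snd_in_image[OF c]
    by (auto intro!: compact_continuous_image continuous_on_subset[OF continuous_chart[OF c]])
  have v0: "v y = 0" if "y \<in> ?S" "y \<notin> K'" for y
  proof -
    have "chart_inv c y \<notin> K"
    proof
      assume "chart_inv c y \<in> K"
      then have "snd c (chart_inv c y) \<in> K'" unfolding K'_def by (rule imageI)
      then show False using that snd_chart_inv[OF c] by simp
    qed
    then show ?thesis unfolding v_def by (rule u0)
  qed
  have w0: "w k y = 0" if "y \<notin> K'" for k y
    using v0 that by (auto simp: w_def)
  have v1: "Ck_on (Suc 0) ?S v" unfolding v_def[abs_def] by (rule C1_funD[OF u c])
  have W1: "smooth_on ?S (W k)" for k
    unfolding W_def[abs_def]
    by (intro smooth_on_mult smooth_on_sum smooth_on_pd smooth_vol_density S c f(2)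
        chart_metric.smooth_H[OF chart_metric[OF c]])
  have vW: "Ck_on (Suc 0) ?S (\<lambda>y. v y * W k y)" for k
    using W1[of k] unfolding smooth_on_def by (intro Ck_on_mult S v1) blast
  have wS: "Ck_on (Suc 0) ?S (w k)" for k
    by (rule iffD1[OF Ck_on_cong[OF S, of "\<lambda>y. v y * W k y"] vW]) (simp add: w_def)
  have oK: "open (- K')" using compact_imp_closed[OF K'(1)] by (simp add: open_Compl)
  have "Ck_on (Suc 0) (- K') (w k)" for k
    by (rule iffD1[OF Ck_on_cong[OF oK] Ck_on_const[OF oK]]) (simp add: w0)
  from Ck_on_Un[OF S oK wS this] have wU: "Ck_on (Suc 0) UNIV (w k)" for k
  proof -
    have "?S \<union> - K' = UNIV" using K'(2) by blast
    then show ?thesis using Ck_on_Un[OF S oK wS \<open>Ck_on (Suc 0) (- K') (w k)\<close>] by simp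
  qed
  note I = integral_pd_compact_support[OF wU K'(1) w0]
  have "manifold_integral M A g F = (\<integral>y. indicat_real ?S y * (vol_density g c y * scalar_at A F (chart_inv c y)) \<partial>lborel)"
    unfolding manifold_integral_def
  proof (rule integral_in_chart[OF c measurable_scalar_at[OF F]])
    fix z assume "z \<in> M" "z \<notin> fst c"
    then obtain d where d: "d \<in> A" "z \<in> fst d" using charts_cover by blast
    \<comment> \<open>For \<open>gdot\<close> to vanish at \<open>z\<close> the derivatives of
      \<open>u\<close> must vanish, which requires \<open>u\<close> to be 0 on a neighbourhood of
      \<open>z\<close> and not just at \<open>z\<close>.\<close>
    define V where "V = {y \<in> chart_image d. chart_inv d y \<notin> K}"
    have V: "open V" unfolding V_def by (rule open_complement_chart[OF d(1) K(1)])
    have zK: "z \<notin> K" using K(2) \<open>z \<notin> fst c\<close> by blast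
    have zV: "snd d z \<in> V"
      using snd_in_image[OF d] chart_inv_snd[OF d] zK by (simp add: V_def)
    have "pd k (\<lambda>y. u (chart_inv d y)) (snd d z) = pd k (\<lambda>y. 0) (snd d z)" for k
      by (rule pd_cong[OF V zV]) (simp add: V_def u0)
    then have "gdot u f d (snd d z) = 0" by (simp add: gdot_def)
    moreover have "u (chart_inv d (snd d z)) = 0" unfolding chart_inv_snd[OF d] by (rule u0[OF zK])
    ultimately show "scalar_at A F z = 0"
      unfolding scalar_at_eq[OF F d] by (simp add: F_def)
  qed
  also have "\<dots> = (\<integral>y. (\<Sum>k\<in>UNIV. pd k (w k) y) \<partial>lborel)"
  proof (rule Bochner_Integration.integral_cong[OF refl])
    fix y
    show "indicat_real ?S y * (vol_density g c y * scalar_at A F (chart_inv c y)) = (\<Sum>k\<in>UNIV. pd k (w k) y)"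
    proof (cases "y \<in> ?S")
      case True
      have "scalar_at A F (chart_inv c y) = F c y"
        unfolding scalar_at_eq[OF F c chart_inv_in[OF c True]] snd_chart_inv[OF c True] ..
      then have "vol_density g c y * scalar_at A F (chart_inv c y)
          = v y * (vol_density g c y * L c y) + vol_density g c y * gdot u f c y"
        by (simp add: F_def v_def algebra_simps)
      also have "v y * (vol_density g c y * L c y) = (\<Sum>k\<in>UNIV. v y * pd k (W k) y)"
        unfolding L(2)[OF c True] W_def[abs_def] by (simp add: sum_distrib_left)
      also have "vol_density g c y * gdot u f c y = (\<Sum>k\<in>UNIV. pd k v y * W k y)"
        unfolding gdot_def W_def v_def[abs_def, symmetric]
        by (subst sum.swap) (simp add: sum_distrib_left mult_ac)
      also have "(\<Sum>k\<in>UNIV. v y * pd k (W k) y) + (\<Sum>k\<in>UNIV. pd k v y * W k y)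
          = (\<Sum>k\<in>UNIV. pd k (\<lambda>y. v y * W k y) y)"
        using Ck_on_differentiable[OF S v1 True] smooth_on_differentiable[OF W1 S True]
        by (simp add: pd_mult sum.distrib)
      also have "\<dots> = (\<Sum>k\<in>UNIV. pd k (w k) y)"
        by (intro sum.cong refl pd_cong[OF S True]) (simp add: w_def)
      finally show ?thesis using True by simp
    next
      case False
      have "pd k (w k) y = pd k (\<lambda>y. 0) y" for k
        by (rule pd_cong[OF oK]) (use False K'(2) w0 in auto)
      then show ?thesis using False by simp
    qed
  qed
  also have "\<dots> = (\<Sum>k\<in>UNIV. \<integral>y. pd k (w k) y \<partial>lborel)"
    by (rule Bochner_Integration.integral_sum) (rule I(1))
  also have "\<dots> = 0" using I(2) by simp
  finally show "manifold_integral M A g F = 0" .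
qed

lemma integrable_scalar_at: "scalar A f \<Longrightarrow> integrable \<mu> (scalar_at A f)"
  by (rule integrable_continuous[OF continuous_on_scalar_at])

text \<open>With functions \<eta> adding up to 1, the fields \<eta> grad f add up to grad f and each
  has its support in one chart. Summed over the partition the terms with grad \<eta> disappear, and
  the terms with \<open>L\<close> add up to \<open>L\<close>.\<close>

theorem integral_divergence:
  assumes f: "scalar A f" "\<And>c. c \<in> A \<Longrightarrow> smooth_on (chart_image c) (f c)"
    and L: "scalar A L" "\<And>c y. c \<in> A \<Longrightarrow> y \<in> chart_image c \<Longrightarrow> vol_density g c y * L c y
        = (\<Sum>k\<in>UNIV. pd k (\<lambda>y. vol_density g c y * (\<Sum>j\<in>UNIV. ginv g c j k y * pd j (f c) y)) y)"
  shows "manifold_integral M A g L = 0"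
proof -
  obtain I c r where I: "finite I" "I \<subseteq> M"
    "\<forall>x\<in>I. c x \<in> A \<and> x \<in> fst (c x) \<and> r x > 0 \<and> cball (snd (c x) x) (r x) \<subseteq> chart_image (c x)"
    "M \<subseteq> (\<Union>x\<in>I. chart_inv (c x) ` ball (snd (c x) x) (r x))"
    using finite_ball_cover by (elim exE conjE) (rule that)
  have cx: "c x \<in> A" "r x > 0" "cball (snd (c x) x) (r x) \<subseteq> chart_image (c x)" if "x \<in> I" for x
    using bspec[OF I(3) that] by auto
  define \<psi> where "\<psi> x = bump_fun (c x) x (r x)" for x
  define \<Psi> where "\<Psi> z = (\<Sum>x\<in>I. \<psi> x z)" for z
  define \<eta> where "\<eta> x z = \<psi> x z * inverse (\<Psi> z)" for x z
  have \<psi>1: "C1_fun (\<psi> x)" if "x \<in> I" for x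
    unfolding \<psi>_def by (rule C1_bump_fun[OF cx[OF that]])
  have \<Psi>_pos: "\<Psi> z > 0" if zM: "z \<in> M" for z
  proof -
    obtain x y where x: "x \<in> I" "y \<in> ball (snd (c x) x) (r x)" "z = chart_inv (c x) y" using I(4) zM by blast
    then have y: "y \<in> chart_image (c x)" using cx(3)[OF x(1)] ball_subset_cball by blast
    have "\<psi> x z > 0"
      using chart_inv_in[OF cx(1)[OF x(1)] y] snd_chart_inv[OF cx(1)[OF x(1)] y] bump_pos[OF x(2)]
      by (simp add: \<psi>_def bump_fun_def x(3))
    moreover have "\<psi> x' z \<ge> 0" for x' by (simp add: \<psi>_def bump_fun_def bump_nonneg)
    ultimately show ?thesis
      unfolding \<Psi>_def using I(1) x(1) by (intro sum_pos2[of I x]) auto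
  qed
  have in_M: "chart_inv d y \<in> M" if "d \<in> A" "y \<in> chart_image d" for d y
    using chart_inv_in[OF that] chart_subset[OF that(1)] by blast
  have \<eta>1: "C1_fun (\<eta> x)" if x: "x \<in> I" for x
    unfolding C1_fun_def
  proof
    fix d assume d: "d \<in> A"
    have "Ck_on (Suc 0) (chart_image d) (\<lambda>y. \<Psi> (chart_inv d y))"
      unfolding \<Psi>_def by (rule Ck_on_sum[OF open_image[OF d] C1_funD[OF \<psi>1 d]])
    then show "Ck_on (Suc 0) (chart_image d) (\<lambda>y. \<eta> x (chart_inv d y))"
      unfolding \<eta>_def using \<Psi>_pos[OF in_M[OF d]]
      by (intro Ck_on_mult Ck_on_inverse open_image[OF d] C1_funD[OF \<psi>1[OF x] d]) force+
  qed
  have \<eta>_sum: "(\<Sum>x\<in>I. \<eta> x z) = 1" if "z \<in> M" for z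
    using \<Psi>_pos[OF that] by (simp add: \<eta>_def \<Psi>_def flip: sum_distrib_right)
  define F where "F x c y = \<eta> x (chart_inv c y) * L c y + gdot (\<eta> x) f c y" for x c y
  have F: "scalar A (F x)" "manifold_integral M A g (F x) = 0" if x: "x \<in> I" for x
  proof -
    have z: "\<eta> x z = 0" if "z \<notin> chart_ball (c x) x (r x)" for z
      using bump_fun_eq_0[OF cx[OF x] that] by (simp add: \<eta>_def \<psi>_def)
    note ibp = integral_by_parts[OF cx(1)[OF x] \<eta>1[OF x] compact_chart_ball[OF cx[OF x]]
        chart_ball_subset[OF cx[OF x]] z f L]
    show "scalar A (F x)" "manifold_integral M A g (F x) = 0"
      unfolding F_def[abs_def] by (rule ibp; assumption)+
  qed
  have sumF: "(\<Sum>x\<in>I. F x d y) = L d y" if d: "d \<in> A" and y: "y \<in> chart_image d" for d y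
  proof -
    \<comment> \<open>The partition functions add up to the constant 1, so their derivatives add up
      to 0.\<close>
    have "(\<Sum>x\<in>I. pd k (\<lambda>y. \<eta> x (chart_inv d y)) y) = 0" for k
    proof -
      have "(\<Sum>x\<in>I. pd k (\<lambda>y. \<eta> x (chart_inv d y)) y) = pd k (\<lambda>y. \<Sum>x\<in>I. \<eta> x (chart_inv d y)) y"
        by (rule pd_sum[symmetric]) (rule Ck_on_differentiable[OF open_image[OF d] C1_funD[OF \<eta>1 d] y])
      also have "\<dots> = pd k (\<lambda>y. 1) y"
        by (rule pd_cong[OF open_image[OF d] y]) (rule \<eta>_sum[OF in_M[OF d]])
      finally show ?thesis by simp
    qed
    moreover have "(\<Sum>x\<in>I. gdot (\<eta> x) f d y) = (\<Sum>j\<in>UNIV. \<Sum>k\<in>UNIV. ginv g d j k y * pd j (f d) y *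
        (\<Sum>x\<in>I. pd k (\<lambda>y. \<eta> x (chart_inv d y)) y))"
      unfolding gdot_def sum_distrib_left by (rule sum_swap3[symmetric])
    ultimately have "(\<Sum>x\<in>I. gdot (\<eta> x) f d y) = 0" by simp
    moreover have "(\<Sum>x\<in>I. \<eta> x (chart_inv d y) * L d y) = L d y"
      using \<eta>_sum[OF in_M[OF d y]] by (simp flip: sum_distrib_right)
    ultimately show ?thesis by (simp add: F_def sum.distrib)
  qed
  have "manifold_integral M A g L = (\<integral>z. (\<Sum>x\<in>I. scalar_at A (F x) z) \<partial>\<mu>)"
    unfolding manifold_integral_def
  proof (rule Bochner_Integration.integral_cong[OF refl])
    fix z assume "z \<in> space \<mu>"
    then obtain d where d: "d \<in> A" "z \<in> fst d" using charts_cover space_riemannian by blast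
    have "(\<Sum>x\<in>I. scalar_at A (F x) z) = (\<Sum>x\<in>I. F x d (snd d z))"
      by (rule sum.cong[OF refl]) (rule scalar_at_eq[OF F(1) d])
    then show "scalar_at A L z = (\<Sum>x\<in>I. scalar_at A (F x) z)"
      using sumF[OF d(1) snd_in_image[OF d]] scalar_at_eq[OF L(1) d] by simp
  qed
  also have "\<dots> = (\<Sum>x\<in>I. manifold_integral M A g (F x))"
    unfolding manifold_integral_def
    by (rule Bochner_Integration.integral_sum) (rule integrable_scalar_at[OF F(1)])
  also have "\<dots> = 0" using F(2) by simp
  finally show ?thesis .
qed

end

section \<open>The integral formula\<close>

theorem lemma3p1:
  fixes M :: "'a::t2_space set"
    and A :: "('a, 'n::finite) chart set"
    and g \<phi> :: "('a, 'n) field"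
    and p :: nat
  assumes "compact M"
    and "smooth_atlas M A"
    and "oriented_atlas A"
    and "riemannian_metric A g"
    and "CARD('n) \<ge> 2"
    and "p \<ge> 1"
    and "\<phi> \<in> sym_tensor_fields A p"
  shows "inner_sym M A g p (yano_laplacian g \<phi>) \<phi>
           = inner_nabla M A g p \<phi> \<phi> - inner_sym M A g p (B_op g \<phi>) \<phi>
         \<and> inner_sym M A g p (B_op g \<phi>) \<phi> = manifold_integral M A g (\<lambda>c y. 1 / fact (p - 1) *
           ((\<Sum>i\<in>UNIV. \<Sum>j\<in>UNIV. \<Sum>is | length is = p - 1.
               ricci g c i j y * raise g p \<phi> c (i # is) y * raise g 1 \<phi> c (j # is) y)
            - (real p - 1) *
              (\<Sum>i\<in>UNIV. \<Sum>j\<in>UNIV. \<Sum>k\<in>UNIV. \<Sum>l\<in>UNIV. \<Sum>is | length is = p - 2.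
                 riemann g c i j k l y * raise g p \<phi> c (i # k # is) y * raise g 2 \<phi> c (j # l # is) y)))"
    (is "?eq1 \<and> ?B = manifold_integral M A g ?b")
proof -
  interpret closed_riemannian M A g by unfold_locales fact+
  note \<phi> = \<open>\<phi> \<in> sym_tensor_fields A p\<close>
  note T = sym_tensor_fieldsD(1)[OF \<phi>] and sym = sym_tensor_fieldsD(2)[OF \<phi>]
  note N = tensor_nabla[OF T]
  let ?W = "trace2 g (nabla g (nabla g \<phi>))"
  have W: "tensor A p ?W" by (intro tensor_trace2 tensor_nabla T)
  let ?Y = "tdot g p (yano_laplacian g \<phi>) \<phi>" and ?Bt = "tdot g p (B_op g \<phi>) \<phi>"
    and ?N = "tdot g (Suc p) (nabla g \<phi>) (nabla g \<phi>)"
  define L where "L c y = tdot g p ?W \<phi> c y + ?N c y" for c y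
  have sY: "scalar A ?Y" and sB: "scalar A ?Bt" and sN: "scalar A ?N"
    by (intro scalar_tdot tensor_yano[OF \<phi>] T N)+
  have sL: "scalar A L"
    unfolding L_def by (intro scalar_add scalar_tdot W T N)
  have chart: "\<exists>d\<in>A. z \<in> fst d \<and> snd d z \<in> chart_image d \<and> (\<forall>f. scalar_at A f z = f d (snd d z))"
    if "z \<in> space \<mu>" for z
  proof -
    have "\<exists>c\<in>A. z \<in> fst c" using that charts_cover space_riemannian by blast
    from scalar_at_chart[OF this] show ?thesis using snd_in_image by blast
  qed
  have Y: "?Y c y = ?N c y - ?Bt c y - L c y" if c: "c \<in> A" and y: "y \<in> chart_image c" for c y
  proof -
    have "?Y c y = tdot g p (\<lambda>c I y. (- 1) * (?W c I y + B_op g \<phi> c I y)) \<phi> c y"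
      by (rule tdot_cong)
        (simp_all add: chart_metric.yano_pointwise[OF chart_metric[OF c] tensorD(1)[OF T c] sym[OF c] y])
    also have "\<dots> = - (tdot g p ?W \<phi> c y + ?Bt c y)"
      unfolding tdot_scale_left[where a="\<lambda>_ _. - 1"] tdot_add_left by simp
    finally show ?thesis by (simp add: L_def)
  qed
  have L0: "manifold_integral M A g L = 0"
  proof (rule integral_divergence[OF _ _ sL])
    \<comment> \<open>The product rule differentiates both factors of the squared norm; the factor
      1/2 leaves the single pairing \<open>?X\<close>.\<close>
    define f where "f c y = tdot g p \<phi> \<phi> c y * (1 / 2)" for c y
    show "scalar A f"
      unfolding f_def by (intro scalar_mult scalar_tdot T) (auto intro!: scalarI)
    show smf: "smooth_on (chart_image c) (f c)" if c: "c \<in> A" for c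
      unfolding f_def[abs_def]
      by (intro smooth_on_mult smooth_on_tdot smooth_on_const open_image T c)
    fix c y assume c: "c \<in> A" and y: "y \<in> chart_image c"
    interpret chart_metric g c by (rule chart_metric[OF c])
    note sm = tensorD(1)[OF T c]
    let ?X = "\<lambda>j. tdot g p (\<lambda>c J. nabla g \<phi> c (j # J)) \<phi> c"
    have pdf: "pd j (f c) z = ?X j z" if z: "z \<in> chart_image c" for j z
    proof -
      have "pd j (f c) z = (?X j z + tdot g p \<phi> (\<lambda>c J. nabla g \<phi> c (j # J)) c z) * (1 / 2)"
        unfolding f_def[abs_def] pd_tdot[OF sm sm z, symmetric]
        by (subst pd_mult) (auto intro: smooth_on_differentiable[OF smooth_on_tdot[OF T T c] open_image[OF c] z])
      then show ?thesis by (simp add: tdot_sym[OF z, of p \<phi>])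
    qed
    have smX: "smooth_on (chart_image c) (?X j)" for j
      by (rule iffD1[OF smooth_on_cong[OF open_image[OF c] pdf] smooth_on_pd[OF smf[OF c]]])
    have "vol_density g c y * L c y = (\<Sum>k\<in>UNIV. pd k (\<lambda>y. vol y * (\<Sum>j\<in>UNIV. ginv g c j k y * ?X j y)) y)"
      unfolding L_def vol_density_def rough_laplacian_divergence[OF sm y, symmetric]
      by (rule divergence[OF y]) (rule smooth_on_differentiable[OF smX open_image[OF c] y])
    also have "\<dots> = (\<Sum>k\<in>UNIV. pd k (\<lambda>y. vol_density g c y * (\<Sum>j\<in>UNIV. ginv g c j k y * pd j (f c) y)) y)"
      by (intro sum.cong refl pd_cong[OF open_image[OF c] y]) (simp add: pdf vol_density_def)
    finally show "vol_density g c y * L c y = \<dots>" .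
  qed
  \<comment> \<open>The constant comes out of a Bochner integral whether or not the function is
    integrable. Both scalar products carry the same \<open>1 / fact p\<close>, so the factor can be
    put back at the end.\<close>
  have inner: "inner_sym M A g p \<psi> \<phi> = 1 / fact p * manifold_integral M A g (tdot g p \<psi> \<phi>)" for \<psi>
    unfolding inner_sym_def tdot_raise manifold_integral_def scalar_at_def Let_def by simp
  have innerN: "inner_nabla M A g p \<phi> \<phi> = 1 / fact p * manifold_integral M A g ?N"
    unfolding inner_nabla_def manifold_integral_def scalar_at_def Let_def tdot_raise[symmetric]
    by (simp add: mult.commute)
  have "manifold_integral M A g ?Y = (\<integral>z. scalar_at A ?N z - scalar_at A ?Bt z - scalar_at A L z \<partial>\<mu>)"
    unfolding manifold_integral_def
  proof (rule Bochner_Integration.integral_cong[OF refl])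
    fix z assume "z \<in> space \<mu>"
    from chart[OF this] obtain d where "d \<in> A" "snd d z \<in> chart_image d" "\<And>f. scalar_at A f z = f d (snd d z)"
      by blast
    then show "scalar_at A ?Y z = scalar_at A ?N z - scalar_at A ?Bt z - scalar_at A L z"
      using Y by simp
  qed
  also have "\<dots> = manifold_integral M A g ?N - manifold_integral M A g ?Bt - manifold_integral M A g L"
    unfolding manifold_integral_def
    by (simp add: integrable_scalar_at sN sB sL)
  finally have ?eq1
    unfolding inner innerN L0 by (simp add: right_diff_distrib)
  \<comment> \<open>The integrands coincide at each point in the chart chosen there, so this
    equality needs no calculus on the manifold.\<close>
  moreover have "?B = manifold_integral M A g ?b"
    unfolding inner_sym_def manifold_integral_def
  proof (rule Bochner_Integration.integral_cong[OF refl])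
    fix z assume "z \<in> space \<mu>"
    from chart[OF this] obtain d where d: "d \<in> A" "snd d z \<in> chart_image d" "\<And>f. scalar_at A f z = f d (snd d z)"
      by blast
    show "scalar_at A (\<lambda>c y. 1 / fact p * (\<Sum>is | length is = p. raise g p (B_op g \<phi>) c is y * \<phi> c is y)) z
        = scalar_at A ?b z"
      unfolding d(3) by (rule chart_metric.B_op_contract[OF chart_metric[OF d(1)] sym[OF d(1)] d(2) \<open>p \<ge> 1\<close>])
  qed
  ultimately show ?thesis ..
qed

end
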